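(* Let $(N,b\sigma)$ be an isoclinic isocrystal. Then there is a function $f:J_b(F)\to X_*(T)_{\mathrm{dom}}$ such that an element $g\in X_\mu(b)$ has $a$-invariant $1$ (i.e. $a(gM_0)=1$) if and only if $f_g$ lies in the $J_b(F)$-orbit of $f$.
   Context: Let $k$ be a finite field with $q=p^r$ elements and algebraic closure $\overline k$; let either $F=W(k)[1/p]$, $\epsilon=p$, or $F=k((t))$, $\epsilon=t$. Let $L$ be the completion of the maximal unramified extension of $F$, with valuation ring $\mathcal O_L$ and Frobenius $\sigma$ over $F$. Let $(N,b\sigma)$ be an isoclinic isocrystal (finite-dimensional $L$-vector space with $\sigma$-linear bijection $b\sigma$, of a single Newton slope) of slope $m/h$ with $m,h$ coprime natural numbers, $h\ge1$, $0\le m\le h$. Let $\Phi=b\sigma$, $V=\epsilon\Phi^{-1}$. Write $N=\bigoplus_{i=1}^{l}N_i$ with $N_i$ simple isocrystals (of dimension $h$). Let $a\in\mathbb Z$ be minimal positive such that there is $a'\in\mathbb Z$ with $am+a'h=1$, and put $\tau_0=(b\sigma)^h\epsilon^{-m}$, $\tau_1=(b\sigma)^a\epsilon^{a'}$. Choose $0\ne e_{i,0}\in N_i$ with $\tau_0(e_{i,0})=e_{i,0}$ and put $e_{i,j}=\tau_1^j(e_{i,0})$ for $j\in\mathbb Z$; then $e_{i,j+h}=\epsilon e_{i,j}$. Let $M_0$ be the $\mathcal O_L$-lattice generated by all $e_{i,j}$ with $j\ge0$; the $e_{i,j}$, $1\le i\le l$, $0\le j<h$, form an $\mathcal O_L$-basis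 of $M_0$, and $N$ is identified with $L^{lh}$ via this basis. Let $G=GL_{lh}=GL(N)$, $K=GL(M_0)$ the stabilizer of $M_0$, $T$ the diagonal torus, and $\mu=(1,\dots,1,0,\dots,0)$ the minuscule dominant cocharacter with $[b]\in B(G,\mu)$. Then $X_\mu(b)=\{g\in G(L)/K\mid g^{-1}b\sigma(g)\in K\mu(\epsilon)K\}$ is identified via $g\mapsto gM_0$ with the set of Dieudonné lattices, i.e. $\mathcal O_L$-lattices $M\subset N$ stable under $\Phi$ and $V$. The $a$-invariant of a Dieudonné lattice is $a(M)=\dim_{\overline k}M/(\Phi(M)+V(M))$. $J_b(F)=\{g\in G(L)\mid gb=b\sigma(g)\}$. For $g\in G(L)$, $f_g:J_b(F)\to X_*(T)_{\mathrm{dom}}$ is given by $f_g(j)=\mathrm{inv}(j,g)$, the unique dominant $\xi$ with $j^{-1}g\in K\xi(\epsilon)K$. $J_b(F)$ acts on functions $f:J_b(F)\to X_*(T)_{\mathrm{dom}}$ by $(j'\cdot f)(j)=f(j'^{-1}j)$, so that $j'\cdot f_g=f_{j'g}$. *)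

theory Defs
  imports "HOL-Algebra.Algebraic_Closure_Type" "HOL-Library.FuncSet" "HOL-Library.Cardinality"
begin

section \<open>The fields $F \subseteq L$\<close>

text \<open>
  The type \<open>'k\<close> is the finite field $k$, \<open>'k alg_closure\<close> is $\overline k$, and the type \<open>'a\<close>
  is the field $L$. The value of \<open>val\<close> at \<open>0\<close> is irrelevant. The map \<open>red\<close> is the reduction
  $\mathcal O_L \to \mathcal O_L/\epsilon \mathcal O_L = \overline k$; its values outside
  $\mathcal O_L$ are irrelevant.
\<close>

record (overloaded) ('a, 'k::field) field_data =
  val :: "'a \<Rightarrow> int"
  unif :: 'a
  base :: "'a set"
  red :: "'a \<Rightarrow> 'k alg_closure"
  frob :: "'a \<Rightarrow> 'a"

definition val_ideal :: "('a::field, 'k::{field,finite}, 'z) field_data_scheme \<Rightarrow> int \<Rightarrow> 'a set" where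
  "val_ideal D n = {x. x = 0 \<or> n \<le> val D x}"

abbreviation integers :: "('a::field, 'k::{field,finite}, 'z) field_data_scheme \<Rightarrow> 'a set" where
  "integers D \<equiv> val_ideal D 0"

definition discretely_valued :: "('a::field, 'k::{field,finite}, 'z) field_data_scheme \<Rightarrow> bool" where
  "discretely_valued D \<longleftrightarrow>
     (\<forall>x y. x \<noteq> 0 \<longrightarrow> y \<noteq> 0 \<longrightarrow> val D (x * y) = val D x + val D y) \<and>
     (\<forall>x y. x \<noteq> 0 \<longrightarrow> y \<noteq> 0 \<longrightarrow> x + y \<noteq> 0 \<longrightarrow> min (val D x) (val D y) \<le> val D (x + y)) \<and>
     unif D \<noteq> 0 \<and> val D (unif D) = 1"

definition complete_in :: "('a::field, 'k::{field,finite}, 'z) field_data_scheme \<Rightarrow> 'a set \<Rightarrow> bool" where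
  "complete_in D S \<longleftrightarrow>
     (\<forall>u :: nat \<Rightarrow> 'a. (\<forall>i. u i \<in> S) \<longrightarrow>
        (\<forall>n. \<exists>N. \<forall>i\<ge>N. \<forall>j\<ge>N. u i - u j \<in> val_ideal D n) \<longrightarrow>
        (\<exists>x\<in>S. \<forall>n. \<exists>N. \<forall>i\<ge>N. u i - x \<in> val_ideal D n))"

definition residue_map :: "('a::field, 'k::{field,finite}, 'z) field_data_scheme \<Rightarrow> bool" where
  "residue_map D \<longleftrightarrow>
     red D 1 = 1 \<and>
     (\<forall>x\<in>integers D. \<forall>y\<in>integers D.
        red D (x + y) = red D x + red D y \<and> red D (x * y) = red D x * red D y) \<and>
     red D ` integers D = UNIV \<and>
     (\<forall>x\<in>integers D. red D x = 0 \<longleftrightarrow> x \<in> val_ideal D 1)"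

definition is_subfield :: "'a::field set \<Rightarrow> bool" where
  "is_subfield S \<longleftrightarrow> 1 \<in> S \<and> (\<forall>x\<in>S. \<forall>y\<in>S. x - y \<in> S \<and> x * y \<in> S) \<and> (\<forall>x\<in>S. inverse x \<in> S)"

text \<open>
  $F = W(k)[1/p]$ with $\epsilon = p$, or $F = k((t))$ with $\epsilon = t$. Following Serre, Local
  Fields, II.5, $W(k)$ is the complete discrete valuation ring with uniformizer $p$ and residue
  field $k$, which is unique up to unique isomorphism. Likewise (loc. cit. II.4) a complete
  discretely valued field of characteristic $p$ with residue field $k$ and uniformizer $t$
  is $k((t))$. In the first case characteristic \<open>0\<close> is automatic, as $p = \epsilon \ne 0$.
\<close>

definition base_field :: "('a::field, 'k::{field,finite}, 'z) field_data_scheme \<Rightarrow> bool" where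
  "base_field D \<longleftrightarrow>
     is_subfield (base D) \<and> unif D \<in> base D \<and> complete_in D (base D) \<and>
     red D ` (base D \<inter> integers D) = range to_ac \<and>
     (unif D = of_nat CHAR('k) \<or> CHAR('a) = CHAR('k))"

text \<open>
  $\epsilon \in F$ is a uniformizer of $L$ and the residue field of $L$ is $\overline k$, so the
  algebraic closure of $F$ in $L$ is unramified over $F$, and it is a maximal unramified
  extension as soon as it is dense in $L$.
\<close>

definition max_unramified :: "('a::field, 'k::{field,finite}, 'z) field_data_scheme \<Rightarrow> 'a set" where
  "max_unramified D = {x. \<exists>P :: 'a poly. P \<noteq> 0 \<and> (\<forall>i. coeff P i \<in> base D) \<and> poly P x = 0}"

definition completed_max_unramified :: "('a::field, 'k::{field,finite}, 'z) field_data_scheme \<Rightarrow> bool" where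
  "completed_max_unramified D \<longleftrightarrow>
     complete_in D UNIV \<and> (\<forall>x n. \<exists>y\<in>max_unramified D. x - y \<in> val_ideal D n)"

definition frobenius_over_base :: "('a::field, 'k::{field,finite}, 'z) field_data_scheme \<Rightarrow> bool" where
  "frobenius_over_base D \<longleftrightarrow>
     bij (frob D) \<and>
     (\<forall>x y. frob D (x + y) = frob D x + frob D y \<and> frob D (x * y) = frob D x * frob D y) \<and>
     (\<forall>x\<in>base D. frob D x = x) \<and>
     (\<forall>x. x \<noteq> 0 \<longrightarrow> val D (frob D x) = val D x) \<and>
     (\<forall>x\<in>integers D. red D (frob D x) = red D x ^ CARD('k))"

definition field_setting :: "('a::field, 'k::{field,finite}, 'z) field_data_scheme \<Rightarrow> bool" where
  "field_setting D \<longleftrightarrow> discretely_valued D \<and> residue_map D \<and> base_field D \<and>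
     completed_max_unramified D \<and> frobenius_over_base D"


section \<open>Isocrystals and lattices\<close>

text \<open>The type \<open>'n\<close> is the space $N$, \<open>smul\<close> its $L$-scalar multiplication, \<open>Phi\<close> is $b\sigma$.\<close>

record (overloaded) ('a, 'k::field, 'n) isocrystal_data = "('a, 'k) field_data" +
  smul :: "'a \<Rightarrow> 'n \<Rightarrow> 'n"
  Phi :: "'n \<Rightarrow> 'n"

abbreviation L_subspace where "L_subspace D \<equiv> Modules.module.subspace (smul D)"
abbreviation L_span where "L_span D \<equiv> Modules.module.span (smul D)"
abbreviation L_dim where "L_dim D \<equiv> Vector_Spaces.vector_space.dim (smul D)"

definition isocrystal ::
  "('a::field, 'k::{field,finite}, 'n::ab_group_add, 'z) isocrystal_data_scheme \<Rightarrow> bool" where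
  "isocrystal D \<longleftrightarrow>
     Vector_Spaces.vector_space (smul D) \<and> (\<exists>B. finite B \<and> L_span D B = UNIV) \<and>
     bij (Phi D) \<and>
     (\<forall>x y. Phi D (x + y) = Phi D x + Phi D y) \<and>
     (\<forall>c x. Phi D (smul D c x) = smul D (frob D c) (Phi D x))"

definition Ver ::
  "('a::field, 'k::{field,finite}, 'n::ab_group_add, 'z) isocrystal_data_scheme \<Rightarrow> 'n \<Rightarrow> 'n" where
  "Ver D x = smul D (unif D) (Hilbert_Choice.inv (Phi D) x)"

definition O_submodule ::
  "('a::field, 'k::{field,finite}, 'n::ab_group_add, 'z) isocrystal_data_scheme \<Rightarrow> 'n set \<Rightarrow> bool" where
  "O_submodule D M \<longleftrightarrow>
     0 \<in> M \<and> (\<forall>x\<in>M. \<forall>y\<in>M. x + y \<in> M) \<and> (\<forall>c\<in>integers D. \<forall>x\<in>M. smul D c x \<in> M)"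

definition O_span ::
  "('a::field, 'k::{field,finite}, 'n::ab_group_add, 'z) isocrystal_data_scheme \<Rightarrow> 'n set \<Rightarrow> 'n set" where
  "O_span D S = O_submodule D hull S"

definition lattice_in ::
  "('a::field, 'k::{field,finite}, 'n::ab_group_add, 'z) isocrystal_data_scheme \<Rightarrow> 'n set \<Rightarrow> 'n set \<Rightarrow> bool" where
  "lattice_in D U M \<longleftrightarrow> (\<exists>B. finite B \<and> M = O_span D B \<and> L_span D B = U)"

definition subisocrystal ::
  "('a::field, 'k::{field,finite}, 'n::ab_group_add, 'z) isocrystal_data_scheme \<Rightarrow> 'n set \<Rightarrow> bool" where
  "subisocrystal D U \<longleftrightarrow> L_subspace D U \<and> Phi D ` U = U"

definition simple_subisocrystal ::
  "('a::field, 'k::{field,finite}, 'n::ab_group_add, 'z) isocrystal_data_scheme \<Rightarrow> 'n set \<Rightarrow> bool" where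
  "simple_subisocrystal D U \<longleftrightarrow> subisocrystal D U \<and> U \<noteq> {0} \<and>
     (\<forall>U'. subisocrystal D U' \<longrightarrow> U' \<subseteq> U \<longrightarrow> U' = {0} \<or> U' = U)"

text \<open>
  The slope decomposition: $N_\lambda$, for $\lambda = r/s$, is spanned by the subisocrystals that
  contain a lattice $M$ with $\Phi^s M = \epsilon^r M$. The slopes are those $\lambda$ with
  $N_\lambda \ne 0$, with multiplicity $\dim_L N_\lambda$.
\<close>

definition slope_part ::
  "('a::field, 'k::{field,finite}, 'n::ab_group_add, 'z) isocrystal_data_scheme \<Rightarrow> rat \<Rightarrow> 'n set" where
  "slope_part D lam = L_span D (\<Union>{U. subisocrystal D U \<and>
     (\<exists>M r s. lattice_in D U M \<and> 0 < s \<and> lam = of_int r / of_nat s \<and>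
        (Phi D ^^ s) ` M = smul D (unif D powi r) ` M)})"

definition newton_slopes ::
  "('a::field, 'k::{field,finite}, 'n::ab_group_add, 'z) isocrystal_data_scheme \<Rightarrow> rat set" where
  "newton_slopes D = {lam. slope_part D lam \<noteq> {0}}"

definition isoclinic ::
  "('a::field, 'k::{field,finite}, 'n::ab_group_add, 'z) isocrystal_data_scheme \<Rightarrow> rat \<Rightarrow> bool" where
  "isoclinic D lam \<longleftrightarrow> isocrystal D \<and> newton_slopes D = {lam}"

definition newton_vector ::
  "('a::field, 'k::{field,finite}, 'n::ab_group_add, 'z) isocrystal_data_scheme \<Rightarrow> rat list" where
  "newton_vector D = (THE nu. sorted_wrt (\<ge>) nu \<and>
     (\<forall>lam. count_list nu lam = L_dim D (slope_part D lam)))"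

text \<open>
  $\dim_{\overline k} M/M'$ for $\mathcal O_L$-modules $\epsilon M \subseteq M' \subseteq M$: the
  cardinality of a finite set of representatives of a $\overline k$-basis of $M/M'$, where the
  scalar $\mathit{red}(c) \in \overline k$ acts as multiplication by $c$.
\<close>

definition residue_dim ::
  "('a::field, 'k::{field,finite}, 'n::ab_group_add, 'z) isocrystal_data_scheme \<Rightarrow> 'n set \<Rightarrow> 'n set \<Rightarrow> nat" where
  "residue_dim D M M' = (THE d. \<exists>B. B \<subseteq> M \<and> finite B \<and> card B = d \<and>
     (\<forall>x\<in>M. \<exists>c. (\<forall>w\<in>B. c w \<in> integers D) \<and> x - (\<Sum>w\<in>B. smul D (c w) w) \<in> M') \<and>
     (\<forall>c. (\<forall>w\<in>B. c w \<in> integers D) \<longrightarrow> (\<Sum>w\<in>B. smul D (c w) w) \<in> M' \<longrightarrow>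
        (\<forall>w\<in>B. red D (c w) = 0)))"

definition a_invariant ::
  "('a::field, 'k::{field,finite}, 'n::ab_group_add, 'z) isocrystal_data_scheme \<Rightarrow> 'n set \<Rightarrow> nat" where
  "a_invariant D M = residue_dim D M {Phi D x + Ver D y | x y. x \<in> M \<and> y \<in> M}"


section \<open>The decomposition, the basis and the lattice $M_0$\<close>

text \<open>
  The slope is \<open>slope_m/slope_h\<close>; the summands $N_i$ are \<open>comp D i\<close> and the vectors
  $e_{i,0}$ are \<open>gen D i\<close>, with \<open>i\<close> running through \<open>0, \<dots>, ncomp D - 1\<close>.
\<close>

record (overloaded) ('a, 'k::field, 'n) decomposed_data = "('a, 'k, 'n) isocrystal_data" +
  slope_m :: nat
  slope_h :: nat
  ncomp :: nat
  comp :: "nat \<Rightarrow> 'n set"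
  gen :: "nat \<Rightarrow> 'n"

definition simple_decomposition ::
  "('a::field, 'k::{field,finite}, 'n::ab_group_add, 'z) decomposed_data_scheme \<Rightarrow> bool" where
  "simple_decomposition D \<longleftrightarrow>
     (\<forall>i<ncomp D. simple_subisocrystal D (comp D i)) \<and>
     (\<forall>x. \<exists>y. (\<forall>i<ncomp D. y i \<in> comp D i) \<and> x = (\<Sum>i<ncomp D. y i)) \<and>
     (\<forall>y. (\<forall>i<ncomp D. y i \<in> comp D i) \<longrightarrow> (\<Sum>i<ncomp D. y i) = 0 \<longrightarrow> (\<forall>i<ncomp D. y i = 0))"

definition bezout_a ::
  "('a::field, 'k::{field,finite}, 'n::ab_group_add, 'z) decomposed_data_scheme \<Rightarrow> nat" where
  "bezout_a D = (LEAST a. 0 < a \<and> (\<exists>a' :: int. int a * int (slope_m D) + a' * int (slope_h D) = 1))"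

definition bezout_a' ::
  "('a::field, 'k::{field,finite}, 'n::ab_group_add, 'z) decomposed_data_scheme \<Rightarrow> int" where
  "bezout_a' D = (THE a'. int (bezout_a D) * int (slope_m D) + a' * int (slope_h D) = 1)"

definition tau0 ::
  "('a::field, 'k::{field,finite}, 'n::ab_group_add, 'z) decomposed_data_scheme \<Rightarrow> 'n \<Rightarrow> 'n" where
  "tau0 D x = (Phi D ^^ slope_h D) (smul D (unif D powi (- int (slope_m D))) x)"

definition tau1 ::
  "('a::field, 'k::{field,finite}, 'n::ab_group_add, 'z) decomposed_data_scheme \<Rightarrow> 'n \<Rightarrow> 'n" where
  "tau1 D x = (Phi D ^^ bezout_a D) (smul D (unif D powi bezout_a' D) x)"

definition tau0_fixed_generators ::
  "('a::field, 'k::{field,finite}, 'n::ab_group_add, 'z) decomposed_data_scheme \<Rightarrow> bool" where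
  "tau0_fixed_generators D \<longleftrightarrow>
     (\<forall>i<ncomp D. gen D i \<in> comp D i \<and> gen D i \<noteq> 0 \<and> tau0 D (gen D i) = gen D i)"

definition evec ::
  "('a::field, 'k::{field,finite}, 'n::ab_group_add, 'z) decomposed_data_scheme \<Rightarrow> nat \<Rightarrow> nat \<Rightarrow> 'n" where
  "evec D i j = (tau1 D ^^ j) (gen D i)"

definition M0 ::
  "('a::field, 'k::{field,finite}, 'n::ab_group_add, 'z) decomposed_data_scheme \<Rightarrow> 'n set" where
  "M0 D = O_span D {evec D i j | i j. i < ncomp D}"

text \<open>
  $N$ is identified with $L^{lh}$ by the basis $e_{i,j}$ ($0 \le j < h$), ordered
  lexicographically in $(i,j)$.
\<close>

definition rk ::
  "('a::field, 'k::{field,finite}, 'n::ab_group_add, 'z) decomposed_data_scheme \<Rightarrow> nat" where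
  "rk D = ncomp D * slope_h D"

definition basis_vec ::
  "('a::field, 'k::{field,finite}, 'n::ab_group_add, 'z) decomposed_data_scheme \<Rightarrow> nat \<Rightarrow> 'n" where
  "basis_vec D t = evec D (t div slope_h D) (t mod slope_h D)"

definition coord ::
  "('a::field, 'k::{field,finite}, 'n::ab_group_add, 'z) decomposed_data_scheme \<Rightarrow> 'n \<Rightarrow> nat \<Rightarrow> 'a" where
  "coord D x t = Modules.module.representation (smul D) (basis_vec D ` {..<rk D}) x (basis_vec D t)"


section \<open>Groups, $X_\mu(b)$ and the functions $f_g$\<close>

definition GL ::
  "('a::field, 'k::{field,finite}, 'n::ab_group_add, 'z) decomposed_data_scheme \<Rightarrow> ('n \<Rightarrow> 'n) set" where
  "GL D = {g. Vector_Spaces.linear (smul D) (smul D) g \<and> bij g}"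

definition K_stab ::
  "('a::field, 'k::{field,finite}, 'n::ab_group_add, 'z) decomposed_data_scheme \<Rightarrow> ('n \<Rightarrow> 'n) set" where
  "K_stab D = {g \<in> GL D. g ` M0 D = M0 D}"

definition sigma_N ::
  "('a::field, 'k::{field,finite}, 'n::ab_group_add, 'z) decomposed_data_scheme \<Rightarrow> 'n \<Rightarrow> 'n" where
  "sigma_N D x = (\<Sum>t<rk D. smul D (frob D (coord D x t)) (basis_vec D t))"

definition sigma_G ::
  "('a::field, 'k::{field,finite}, 'n::ab_group_add, 'z) decomposed_data_scheme \<Rightarrow> ('n \<Rightarrow> 'n) \<Rightarrow> 'n \<Rightarrow> 'n" where
  "sigma_G D g = sigma_N D \<circ> g \<circ> Hilbert_Choice.inv (sigma_N D)"

definition b_elt ::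
  "('a::field, 'k::{field,finite}, 'n::ab_group_add, 'z) decomposed_data_scheme \<Rightarrow> 'n \<Rightarrow> 'n" where
  "b_elt D = Phi D \<circ> Hilbert_Choice.inv (sigma_N D)"

definition J_group ::
  "('a::field, 'k::{field,finite}, 'n::ab_group_add, 'z) decomposed_data_scheme \<Rightarrow> ('n \<Rightarrow> 'n) set" where
  "J_group D = {g \<in> GL D. g \<circ> b_elt D = b_elt D \<circ> sigma_G D g}"

text \<open>
  $X_*(T) = \mathbb Z^{lh}$ as lists, dominant meaning weakly decreasing (upper triangular Borel).
\<close>

definition dominant_cochars ::
  "('a::field, 'k::{field,finite}, 'n::ab_group_add, 'z) decomposed_data_scheme \<Rightarrow> int list set" where
  "dominant_cochars D = {xi. length xi = rk D \<and> sorted_wrt (\<ge>) xi}"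

definition cochar_at_unif ::
  "('a::field, 'k::{field,finite}, 'n::ab_group_add, 'z) decomposed_data_scheme \<Rightarrow> int list \<Rightarrow> 'n \<Rightarrow> 'n" where
  "cochar_at_unif D xi x = (\<Sum>t<rk D. smul D (unif D powi (xi ! t) * coord D x t) (basis_vec D t))"

definition double_coset ::
  "('a::field, 'k::{field,finite}, 'n::ab_group_add, 'z) decomposed_data_scheme \<Rightarrow> int list \<Rightarrow> ('n \<Rightarrow> 'n) set" where
  "double_coset D xi =
     {k1 \<circ> cochar_at_unif D xi \<circ> k2 | k1 k2. k1 \<in> K_stab D \<and> k2 \<in> K_stab D}"

text \<open>
  For $GL_n$, $[b] \in B(G,\mu)$ says that the Newton vector of $b$ is at most $\mu$ in the
  dominance order; the equality of the total sums is the condition $\kappa(b) = \mu^\natural$.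
\<close>

definition in_B_G_mu ::
  "('a::field, 'k::{field,finite}, 'n::ab_group_add, 'z) decomposed_data_scheme \<Rightarrow> int list \<Rightarrow> bool" where
  "in_B_G_mu D mu \<longleftrightarrow>
     (\<forall>i. sum_list (take i (newton_vector D)) \<le> of_int (sum_list (take i mu))) \<and>
     sum_list (newton_vector D) = of_int (sum_list mu)"

definition coset_K ::
  "('a::field, 'k::{field,finite}, 'n::ab_group_add, 'z) decomposed_data_scheme \<Rightarrow> ('n \<Rightarrow> 'n) \<Rightarrow> ('n \<Rightarrow> 'n) set" where
  "coset_K D g = {g \<circ> u | u. u \<in> K_stab D}"

definition X_mu_b ::
  "('a::field, 'k::{field,finite}, 'n::ab_group_add, 'z) decomposed_data_scheme \<Rightarrow> int list \<Rightarrow> ('n \<Rightarrow> 'n) set set" where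
  "X_mu_b D mu =
     {coset_K D g | g. g \<in> GL D \<and> Hilbert_Choice.inv g \<circ> b_elt D \<circ> sigma_G D g \<in> double_coset D mu}"

definition rel_pos ::
  "('a::field, 'k::{field,finite}, 'n::ab_group_add, 'z) decomposed_data_scheme \<Rightarrow> ('n \<Rightarrow> 'n) \<Rightarrow> ('n \<Rightarrow> 'n) \<Rightarrow> int list" where
  "rel_pos D j g = (THE xi. xi \<in> dominant_cochars D \<and> Hilbert_Choice.inv j \<circ> g \<in> double_coset D xi)"

definition f_of ::
  "('a::field, 'k::{field,finite}, 'n::ab_group_add, 'z) decomposed_data_scheme \<Rightarrow> ('n \<Rightarrow> 'n) \<Rightarrow> ('n \<Rightarrow> 'n) \<Rightarrow> int list" where
  "f_of D g = (\<lambda>j\<in>J_group D. rel_pos D j g)"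

definition J_act ::
  "('a::field, 'k::{field,finite}, 'n::ab_group_add, 'z) decomposed_data_scheme \<Rightarrow>
     ('n \<Rightarrow> 'n) \<Rightarrow> (('n \<Rightarrow> 'n) \<Rightarrow> int list) \<Rightarrow> ('n \<Rightarrow> 'n) \<Rightarrow> int list" where
  "J_act D j' f = (\<lambda>j\<in>J_group D. f (Hilbert_Choice.inv j' \<circ> j))"

definition J_orbit ::
  "('a::field, 'k::{field,finite}, 'n::ab_group_add, 'z) decomposed_data_scheme \<Rightarrow>
     (('n \<Rightarrow> 'n) \<Rightarrow> int list) \<Rightarrow> (('n \<Rightarrow> 'n) \<Rightarrow> int list) set" where
  "J_orbit D f = {J_act D j' f | j'. j' \<in> J_group D}"

end

theory Submission
  imports Defs
begin

text \<open>
  A lattice \<open>M\<close> is moved by $J_b(F)$ into a position where it lies in $M_0$ but in no smaller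
  $jM_0$. If $0 < m < h$ and $a(M) = 1$, then \<open>M\<close> is generated over $\mathcal O_L[\Phi, V]$ by one
  element $v$, and the class of $v$ in $M_0/\tau_1M_0$ lies in no proper $\tau_0$-stable subspace.
  The monomials $\Phi^aV^bv$ with $am + b(h-m) = k$ form a single chain under $\tau_0$, because
  $\tau_0 = \Phi^{h-m}V^{-m}$; so modulo any \<open>k\<close>-th graded piece of $jM_0$ they are linearly
  independent as long as there is room for them. Once there are more than \<open>r\<close> such monomials in some
  level, there are at least \<open>r\<close> of them in all higher levels. Hence the length of $M/(M \cap jM_0)$
  is the sum over \<open>k\<close> of the minimum of the number of monomials and the dimension of the \<open>k\<close>-th
  graded piece of $M_0/(M_0 \cap jM_0)$, which does not depend on \<open>M\<close>; these lengths determine all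
  relative positions. Conversely, if $f_g = f_{g'}$ and $g'M_0$ is such an \<open>M\<close>, then $gM_0$
  contains a lattice generated by one element as above, and the two have the same length modulo
  every $\tau_1^K M_0$, so they coincide. If \<open>m = 0\<close> or \<open>m = h\<close>, then $\Phi$ or $V$ is
  bijective on every Dieudonne lattice, and the \<open>a\<close>-invariant is never \<open>1\<close>; a constant function,
  which is no $f_g$, then serves as \<open>f\<close>.
\<close>

text \<open>The obstacle is that a combination of monomials of low level may cancel modulo jM_0 and
  reappear deeper, so the contribution of level k to the length is not obviously decided at level k.
  Two monotonicities remove the problem. The room that jM_0 leaves at level k never grows with k,
  because tau_1 maps jM_0 into itself, while the number of monomials of level k nearly grows. Hence
  there is a threshold. Before it the monomials are independent modulo jM_0, so every relation has
  coefficients divisible by \<epsilon>, and \<epsilon> = Phi V only produces monomials of higher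
  level. From the threshold on, the monomials of the level alone fill the room, and whatever arrives
  from lower levels adds nothing. That a generator in general position exists in a minimal translate
  is a descent statement: a tau_0-stable subspace of M_0/tau_1M_0 is defined over the field with q^h
  elements, and Teichmueller lifts in the complete field L turn an equation for it into an element
  of J_b(F).\<close>

locale isocrystal_over =
  fixes D :: "('a::field, 'k::{field,finite}, 'n::ab_group_add) decomposed_data"
  assumes field_setting: "field_setting D" and isocrystal: "isocrystal D"
begin

sublocale N: vector_space "smul D"
  using isocrystal unfolding isocrystal_def by blast

abbreviation scl (infixr "*s" 75) where "c *s x \<equiv> smul D c x"
abbreviation eps ("\<epsilon>") where "\<epsilon> \<equiv> unif D"
abbreviation \<O> where "\<O> \<equiv> integers D"
abbreviation is_sub where "is_sub \<equiv> O_submodule D"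

section \<open>Arithmetic in the valuation ring\<close>

lemma fs: "discretely_valued D" "residue_map D" "base_field D" "completed_max_unramified D" "frobenius_over_base D"
  using field_setting unfolding field_setting_def by blast+

lemma val_mult: "x \<noteq> 0 \<Longrightarrow> y \<noteq> 0 \<Longrightarrow> val D (x * y) = val D x + val D y"
  using fs(1) by (auto simp: discretely_valued_def)

lemma val_add: "x \<noteq> 0 \<Longrightarrow> y \<noteq> 0 \<Longrightarrow> x + y \<noteq> 0 \<Longrightarrow> min (val D x) (val D y) \<le> val D (x + y)"
  using fs(1) by (auto simp: discretely_valued_def)

lemma eps_nz [simp]: "\<epsilon> \<noteq> 0" and val_eps [simp]: "val D \<epsilon> = 1"
  using fs(1) by (auto simp: discretely_valued_def)

lemma val_1 [simp]: "val D 1 = 0"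
  using val_mult[of 1 1] by simp

lemma val_inverse: "x \<noteq> 0 \<Longrightarrow> val D (inverse x) = - val D x"
  using val_mult[of x "inverse x"] by simp

lemma val_minus [simp]: "val D (- x) = val D x"
proof (cases "x = 0")
  case False
  have "val D (-1) = 0" using val_mult[of "-1" "-1"] by simp
  then show ?thesis using val_mult[of "-1" x] False by simp
qed simp

lemma val_eps_power [simp]: "val D (\<epsilon> ^ n) = int n"
  by (induction n) (auto simp: val_mult)

lemma val_eps_powi [simp]: "val D (\<epsilon> powi n) = n"
  by (cases "n \<ge> 0") (auto simp: power_int_def val_inverse power_inverse)

lemma val_ideal_add: "x \<in> val_ideal D n \<Longrightarrow> y \<in> val_ideal D n \<Longrightarrow> x + y \<in> val_ideal D n"
  using val_add[of x y] by (fastforce simp: val_ideal_def)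

lemma val_ideal_minus: "x \<in> val_ideal D n \<Longrightarrow> - x \<in> val_ideal D n"
  by (auto simp: val_ideal_def)

lemma val_ideal_diff: "x \<in> val_ideal D n \<Longrightarrow> y \<in> val_ideal D n \<Longrightarrow> x - y \<in> val_ideal D n"
  using val_ideal_add[of x n "- y"] val_ideal_minus[of y n] by simp

lemma val_ideal_0 [simp]: "0 \<in> val_ideal D n"
  by (auto simp: val_ideal_def)

lemma val_ideal_mult: "x \<in> val_ideal D n \<Longrightarrow> y \<in> val_ideal D k \<Longrightarrow> x * y \<in> val_ideal D (n + k)"
  by (cases "x = 0 \<or> y = 0") (auto simp: val_ideal_def val_mult)

lemma val_ideal_antimono: "n \<le> k \<Longrightarrow> x \<in> val_ideal D k \<Longrightarrow> x \<in> val_ideal D n"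
  by (auto simp: val_ideal_def)

lemma OO_add: "x \<in> \<O> \<Longrightarrow> y \<in> \<O> \<Longrightarrow> x + y \<in> \<O>"
  and OO_mult: "x \<in> \<O> \<Longrightarrow> y \<in> \<O> \<Longrightarrow> x * y \<in> \<O>"
  and OO_minus: "x \<in> \<O> \<Longrightarrow> - x \<in> \<O>"
  and OO_diff: "x \<in> \<O> \<Longrightarrow> y \<in> \<O> \<Longrightarrow> x - y \<in> \<O>"
  and OO_0 [simp]: "0 \<in> \<O>" and OO_1 [simp]: "1 \<in> \<O>" and OO_eps [simp]: "\<epsilon> \<in> \<O>"
  using val_ideal_mult[of x 0 y 0]
  by (auto simp: val_ideal_add val_ideal_minus val_ideal_diff)
    (auto simp: val_ideal_def)

lemma OO_power: "x \<in> \<O> \<Longrightarrow> x ^ n \<in> \<O>"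
  by (induction n) (auto simp: OO_mult)

lemma OO_sum: "(\<And>i. i \<in> A \<Longrightarrow> f i \<in> \<O>) \<Longrightarrow> sum f A \<in> \<O>"
  by (induction A rule: infinite_finite_induct) (auto simp: OO_add)

lemma val_ideal_iff_eps_powi: "x \<in> val_ideal D n \<longleftrightarrow> (\<exists>y\<in>\<O>. x = \<epsilon> powi n * y)"
proof
  assume "x \<in> val_ideal D n"
  then have "x * \<epsilon> powi (- n) \<in> \<O>" by (cases "x = 0") (auto simp: val_ideal_def val_mult)
  moreover have "x = \<epsilon> powi n * (x * \<epsilon> powi (- n))" by (simp add: power_int_minus)
  ultimately show "\<exists>y\<in>\<O>. x = \<epsilon> powi n * y" by blast
next
  assume "\<exists>y\<in>\<O>. x = \<epsilon> powi n * y"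
  then obtain y where "y \<in> \<O>" "x = \<epsilon> powi n * y" by blast
  then show "x \<in> val_ideal D n"
    by (cases "y = 0") (auto simp: val_ideal_def val_mult)
qed

lemma val_ideal_1_iff: "x \<in> val_ideal D 1 \<longleftrightarrow> (\<exists>y\<in>\<O>. x = \<epsilon> * y)"
  using val_ideal_iff_eps_powi[of x 1] by simp

definition is_unit_OO where "is_unit_OO u \<longleftrightarrow> u \<in> \<O> \<and> u \<noteq> 0 \<and> inverse u \<in> \<O>"

text \<open>The valuation ring is local with maximal ideal generated by \<open>\<epsilon>\<close>.
  The arguments on coefficients below run through this dichotomy: a unit can be divided out, a
  multiple of \<open>\<epsilon>\<close> pushes its term deeper.\<close>

lemma unit_or_ideal: "c \<in> \<O> \<Longrightarrow> is_unit_OO c \<or> (\<exists>y\<in>\<O>. c = \<epsilon> * y)"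
  unfolding val_ideal_1_iff[symmetric] is_unit_OO_def
  by (cases "c = 0 \<or> val D c = 0") (auto simp: val_ideal_def val_inverse)

lemma one_minus_eps_unit: "y \<in> \<O> \<Longrightarrow> is_unit_OO (1 - \<epsilon> * y)"
proof (rule ccontr)
  assume y: "y \<in> \<O>" and "\<not> is_unit_OO (1 - \<epsilon> * y)"
  then obtain z where "z \<in> \<O>" "1 - \<epsilon> * y = \<epsilon> * z"
    using unit_or_ideal[of "1 - \<epsilon> * y"] by (auto simp: OO_diff OO_mult)
  then have "1 = \<epsilon> * (y + z)" "y + z \<in> \<O>" using y by (auto simp: algebra_simps OO_add)
  then have "1 \<in> val_ideal D 1" unfolding val_ideal_1_iff by blast
  then show False by (auto simp: val_ideal_def)
qed

lemma decompose_val: "x \<noteq> 0 \<Longrightarrow> \<exists>u. is_unit_OO u \<and> x = \<epsilon> powi (val D x) * u"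
  by (rule exI[of _ "x * \<epsilon> powi (- val D x)"])
    (auto simp: is_unit_OO_def val_ideal_def val_mult val_inverse power_int_minus)

lemma OO_abs_powi: "n \<ge> 0 \<Longrightarrow> \<epsilon> powi n \<in> \<O>"
  by (auto simp: val_ideal_def)

subsection \<open>Frobenius and reduction\<close>

lemma frob_add: "frob D (x + y) = frob D x + frob D y"
  and frob_mult: "frob D (x * y) = frob D x * frob D y"
  and bij_frob: "bij (frob D)"
  and val_frob: "x \<noteq> 0 \<Longrightarrow> val D (frob D x) = val D x"
  and red_frob: "x \<in> \<O> \<Longrightarrow> red D (frob D x) = red D x ^ CARD('k)"
  using fs(5) by (auto simp: frobenius_over_base_def)

lemma frob_eps [simp]: "frob D \<epsilon> = \<epsilon>"
  using fs(5,3) by (auto simp: frobenius_over_base_def base_field_def)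

lemma frob_0 [simp]: "frob D 0 = 0"
  using frob_add[of 0 0] by (metis add.right_neutral add_left_cancel)

lemma frob_nz: "x \<noteq> 0 \<Longrightarrow> frob D x \<noteq> 0"
  using bij_is_inj[OF bij_frob] frob_0 by (metis injD)

lemma frob_eq_0_iff [simp]: "frob D x = 0 \<longleftrightarrow> x = 0"
  using frob_nz[of x] by auto

lemma frob_1 [simp]: "frob D 1 = 1"
  using frob_mult[of 1 1] frob_nz[of 1] by simp

lemma frob_minus: "frob D (- x) = - frob D x"
  using frob_add[of x "- x"] by (simp add: add_eq_0_iff)

lemma frob_diff: "frob D (x - y) = frob D x - frob D y"
  using frob_add[of x "- y"] by (simp add: frob_minus)

lemma frob_val_ideal: "frob D x \<in> val_ideal D n \<longleftrightarrow> x \<in> val_ideal D n"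
  by (cases "x = 0") (auto simp: val_ideal_def val_frob)

lemma frob_power: "frob D (x ^ n) = frob D x ^ n"
  by (induction n) (auto simp: frob_mult)

lemma red_1 [simp]: "red D 1 = 1"
  and red_add: "x \<in> \<O> \<Longrightarrow> y \<in> \<O> \<Longrightarrow> red D (x + y) = red D x + red D y"
  and red_mult: "x \<in> \<O> \<Longrightarrow> y \<in> \<O> \<Longrightarrow> red D (x * y) = red D x * red D y"
  and red_eq_0_iff: "x \<in> \<O> \<Longrightarrow> red D x = 0 \<longleftrightarrow> (\<exists>y\<in>\<O>. x = \<epsilon> * y)"
  using fs(2) unfolding residue_map_def val_ideal_1_iff by blast+

lemma red_surj: "\<exists>x\<in>\<O>. red D x = c"
  using fs(2) unfolding residue_map_def by (metis UNIV_I imageE)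

lemma red_0 [simp]: "red D 0 = 0"
  using red_eq_0_iff[of 0] by (auto intro!: bexI[of _ 0])

lemma red_diff: "x \<in> \<O> \<Longrightarrow> y \<in> \<O> \<Longrightarrow> red D (x - y) = red D x - red D y"
  using red_add[of "x - y" y] by (simp add: OO_diff)

lemma red_power: "x \<in> \<O> \<Longrightarrow> red D (x ^ n) = red D x ^ n"
  by (induction n) (auto simp: red_mult OO_power)

lemma red_sum: "(\<And>i. i \<in> A \<Longrightarrow> f i \<in> \<O>) \<Longrightarrow> red D (sum f A) = (\<Sum>i\<in>A. red D (f i))"
  by (induction A rule: infinite_finite_induct) (auto simp: red_add OO_sum)

lemma unit_iff_red: "c \<in> \<O> \<Longrightarrow> is_unit_OO c \<longleftrightarrow> red D c \<noteq> 0"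
proof
  assume c: "c \<in> \<O>" and "is_unit_OO c"
  then have "red D c * red D (inverse c) = 1"
    by (auto simp: is_unit_OO_def simp flip: red_mult)
  then show "red D c \<noteq> 0" by auto
next
  assume c: "c \<in> \<O>" and "red D c \<noteq> 0"
  then show "is_unit_OO c" using unit_or_ideal[OF c] red_eq_0_iff[OF c] by blast
qed


section \<open>Submodules over the valuation ring: sums, lines and spans\<close>

definition msum :: "'n set \<Rightarrow> 'n set \<Rightarrow> 'n set" where
  "msum A B = {x + y | x y. x \<in> A \<and> y \<in> B}"

definition line :: "'n \<Rightarrow> 'n set" where
  "line z = {c *s z | c. c \<in> \<O>}"

lemma sub_0: "is_sub A \<Longrightarrow> 0 \<in> A"
  and sub_add: "is_sub A \<Longrightarrow> x \<in> A \<Longrightarrow> y \<in> A \<Longrightarrow> x + y \<in> A"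
  and sub_scale: "is_sub A \<Longrightarrow> c \<in> \<O> \<Longrightarrow> x \<in> A \<Longrightarrow> c *s x \<in> A"
  unfolding O_submodule_def by blast+

lemma sub_minus: "is_sub A \<Longrightarrow> x \<in> A \<Longrightarrow> - x \<in> A"
  using sub_scale[of A "-1" x] by (simp add: OO_minus)

lemma sub_diff: "is_sub A \<Longrightarrow> x \<in> A \<Longrightarrow> y \<in> A \<Longrightarrow> x - y \<in> A"
  using sub_add[of A x "- y"] sub_minus[of A y] by simp

lemma sub_sum: "is_sub A \<Longrightarrow> (\<And>i. i \<in> I \<Longrightarrow> f i \<in> A) \<Longrightarrow> sum f I \<in> A"
  by (induction I rule: infinite_finite_induct) (auto simp: sub_0 sub_add)

lemma sub_unit: "is_sub A \<Longrightarrow> is_unit_OO c \<Longrightarrow> c *s x \<in> A \<Longrightarrow> x \<in> A"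
  using sub_scale[of A "inverse c" "c *s x"] by (simp add: is_unit_OO_def)

lemma sub_eps: "is_sub A \<Longrightarrow> x \<in> A \<Longrightarrow> \<epsilon> *s x \<in> A"
  by (simp add: sub_scale)

lemma sub_diff_cancel: "is_sub A \<Longrightarrow> y \<in> A \<Longrightarrow> x - y \<in> A \<Longrightarrow> x \<in> A"
  using sub_add[of A "x - y" y] by simp

lemma subI: "0 \<in> A \<Longrightarrow> (\<And>x y. x \<in> A \<Longrightarrow> y \<in> A \<Longrightarrow> x + y \<in> A) \<Longrightarrow>
    (\<And>c x. c \<in> \<O> \<Longrightarrow> x \<in> A \<Longrightarrow> c *s x \<in> A) \<Longrightarrow> is_sub A"
  unfolding O_submodule_def by blast

lemma sub_Int: "is_sub A \<Longrightarrow> is_sub B \<Longrightarrow> is_sub (A \<inter> B)"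
  by (intro subI) (auto simp: sub_0 sub_add sub_scale)

lemma msumI: "x \<in> A \<Longrightarrow> y \<in> B \<Longrightarrow> x + y \<in> msum A B"
  unfolding msum_def by blast

lemma msumE: "z \<in> msum A B \<Longrightarrow> (\<And>x y. z = x + y \<Longrightarrow> x \<in> A \<Longrightarrow> y \<in> B \<Longrightarrow> P) \<Longrightarrow> P"
  unfolding msum_def by blast

lemma lineE: "z \<in> line w \<Longrightarrow> (\<And>c. z = c *s w \<Longrightarrow> c \<in> \<O> \<Longrightarrow> P) \<Longrightarrow> P"
  unfolding line_def by blast

lemma lineI: "c \<in> \<O> \<Longrightarrow> c *s w \<in> line w"
  unfolding line_def by blast

lemma line_self: "w \<in> line w"
  using lineI[of 1 w] by simp

lemma sub_msum: "is_sub A \<Longrightarrow> is_sub B \<Longrightarrow> is_sub (msum A B)"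
proof (rule subI)
  assume A: "is_sub A" and B: "is_sub B"
  show "0 \<in> msum A B" using msumI[OF sub_0[OF A] sub_0[OF B]] by simp
  show "c *s x \<in> msum A B" if "c \<in> \<O>" "x \<in> msum A B" for c x
  proof -
    obtain a b where x: "x = a + b" "a \<in> A" "b \<in> B" using \<open>x \<in> msum A B\<close> by (rule msumE)
    show ?thesis unfolding x(1) N.scale_right_distrib
      by (intro msumI sub_scale A B that(1) x)
  qed
  show "x + y \<in> msum A B" if "x \<in> msum A B" "y \<in> msum A B" for x y
  proof -
    obtain a b where x: "x = a + b" "a \<in> A" "b \<in> B" using \<open>x \<in> msum A B\<close> by (rule msumE)
    obtain c d where y: "y = c + d" "c \<in> A" "d \<in> B" using \<open>y \<in> msum A B\<close> by (rule msumE)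
    have "x + y = (a + c) + (b + d)" by (simp add: x y algebra_simps)
    then show ?thesis using msumI[OF sub_add[OF A x(2) y(2)] sub_add[OF B x(3) y(3)]] by simp
  qed
qed

lemma sub_line: "is_sub (line w)"
proof (rule subI)
  show "0 \<in> line w" using lineI[of 0 w] by simp
  show "c *s x \<in> line w" if "c \<in> \<O>" "x \<in> line w" for c x
  proof -
    from that(2) obtain d where "x = d *s w" "d \<in> \<O>" by (rule lineE)
    then show ?thesis using lineI[of "c * d" w] OO_mult[OF that(1)] by simp
  qed
  show "x + y \<in> line w" if "x \<in> line w" "y \<in> line w" for x y
  proof -
    from that obtain c d where "x = c *s w" "c \<in> \<O>" "y = d *s w" "d \<in> \<O>" by (metis lineE)
    then show ?thesis using lineI[of "c + d" w] by (simp add: OO_add N.scale_left_distrib)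
  qed
qed

lemma msum_le: "is_sub C \<Longrightarrow> A \<subseteq> C \<Longrightarrow> B \<subseteq> C \<Longrightarrow> msum A B \<subseteq> C"
  by (auto elim!: msumE intro: sub_add)

lemma line_le: "is_sub C \<Longrightarrow> w \<in> C \<Longrightarrow> line w \<subseteq> C"
  by (auto elim!: lineE intro: sub_scale)

lemma msum_ge1: "is_sub B \<Longrightarrow> A \<subseteq> msum A B"
  using msumI[of _ A 0 B] by (auto simp: sub_0)

lemma msum_ge2: "is_sub A \<Longrightarrow> B \<subseteq> msum A B"
  using msumI[of 0 A _ B] by (auto simp: sub_0)

lemma msum_mono: "A \<subseteq> A' \<Longrightarrow> B \<subseteq> B' \<Longrightarrow> msum A B \<subseteq> msum A' B'"
  unfolding msum_def by blast

lemma msum_absorb: "is_sub A \<Longrightarrow> is_sub B \<Longrightarrow> B \<subseteq> A \<Longrightarrow> msum A B = A"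
  using msum_le[of A A B] msum_ge1[of B A] by auto

lemma msum_commute: "msum A B = msum B A"
  unfolding msum_def by (auto simp: add.commute) (metis add.commute)+

lemma msum_line_mem: "is_sub A \<Longrightarrow> w \<in> msum A (line w)"
  using msum_ge2[of A "line w"] line_self by blast

lemma sub_O_span: "is_sub (O_span D S)"
  unfolding O_span_def by (rule hull_in) (auto intro!: subI simp: sub_0 sub_add sub_scale)

lemma O_span_inc: "x \<in> S \<Longrightarrow> x \<in> O_span D S"
  unfolding O_span_def by (rule hull_inc)

lemma O_span_min: "is_sub T \<Longrightarrow> S \<subseteq> T \<Longrightarrow> O_span D S \<subseteq> T"
  unfolding O_span_def by (rule hull_minimal)

lemma O_span_mono: "S \<subseteq> T \<Longrightarrow> O_span D S \<subseteq> O_span D T"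
  unfolding O_span_def by (rule hull_mono)

lemma O_span_insert: "O_span D (insert w S) = msum (O_span D S) (line w)"
proof (rule subset_antisym)
  show "O_span D (insert w S) \<subseteq> msum (O_span D S) (line w)"
    using msum_line_mem[OF sub_O_span, of w S] msum_ge1[OF sub_line, of "O_span D S" w] O_span_inc
    by (intro O_span_min sub_msum sub_O_span sub_line) blast
  show "msum (O_span D S) (line w) \<subseteq> O_span D (insert w S)"
    by (intro msum_le sub_O_span line_le O_span_mono) (auto intro: O_span_inc)
qed

lemma O_span_empty: "O_span D {} = {0}"
proof -
  have "is_sub {0}" by (rule subI) auto
  then show ?thesis using O_span_min[of "{0}" "{}"] sub_0[OF sub_O_span[of "{}"]] by blast
qed

lemma O_span_finite: "finite B \<Longrightarrow> x \<in> O_span D B \<Longrightarrow> \<exists>c. (\<forall>w\<in>B. c w \<in> \<O>) \<and> x = (\<Sum>w\<in>B. c w *s w)"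
proof (induction B arbitrary: x rule: finite_induct)
  case (insert w B)
  then obtain y d where x: "x = y + d *s w" "y \<in> O_span D B" "d \<in> \<O>"
    by (auto simp: O_span_insert elim!: msumE lineE)
  then obtain c where c: "\<forall>w\<in>B. c w \<in> \<O>" "y = (\<Sum>w\<in>B. c w *s w)" using insert by blast
  have "(\<Sum>v\<in>B. (c(w := d)) v *s v) = (\<Sum>v\<in>B. c v *s v)"
    using insert by (intro sum.cong) auto
  then have "x = (\<Sum>v\<in>insert w B. (c(w := d)) v *s v)"
    using insert x c by (simp add: add.commute)
  then show ?case using c x by (intro exI[of _ "c(w := d)"]) auto
qed (simp add: O_span_empty)

subsection \<open>Lengths\<close>

text \<open>The length of A/B without quotient modules: a chain from B up to A in which each step
  adds one vector \<open>z\<close> with \<open>\<epsilon> *s z\<close> already present, so that the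
  step is a line over the residue field. Pairs without a finite chain are simply unrelated;
  \<open>len_unique\<close> makes the relation single-valued.\<close>

inductive len :: "'n set \<Rightarrow> 'n set \<Rightarrow> nat \<Rightarrow> bool" where
  len_refl: "is_sub A \<Longrightarrow> len A A 0"
| len_step: "is_sub A' \<Longrightarrow> z \<notin> A' \<Longrightarrow> \<epsilon> *s z \<in> A' \<Longrightarrow> len A' B n \<Longrightarrow>
    len (msum A' (line z)) B (Suc n)"

lemma len_sub: "len A B n \<Longrightarrow> is_sub A \<and> is_sub B \<and> B \<subseteq> A"
  by (induction rule: len.induct) (use msum_ge1[OF sub_line] in \<open>auto simp: sub_msum sub_line\<close>)

lemma len_trans: "len A B n \<Longrightarrow> len B C k \<Longrightarrow> len A C (n + k)"
  by (induction rule: len.induct) (auto intro: len_step)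

text \<open>One step of a chain is simple: a vector a + c z of \<open>C\<close> either has a unit
  \<open>c\<close>, which puts \<open>z\<close> into \<open>C\<close>, or a \<open>c\<close>
  divisible by \<open>\<epsilon>\<close>, which puts the vector into \<open>A'\<close>.\<close>

lemma sub_between_line:
  assumes A: "is_sub A'" and z: "\<epsilon> *s z \<in> A'" and C: "is_sub C" "A' \<subseteq> C" "C \<subseteq> msum A' (line z)"
  shows "C = A' \<or> C = msum A' (line z)"
proof (rule disjCI)
  assume "C \<noteq> msum A' (line z)"
  then have zC: "z \<notin> C" using C A msum_le[OF C(1,2) line_le[OF C(1)], of z] by blast
  show "C = A'"
  proof (rule subset_antisym)
    show "C \<subseteq> A'"
    proof
      fix x assume x: "x \<in> C"
      then obtain a c where ac: "x = a + c *s z" "a \<in> A'" "c \<in> \<O>"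
        using C(3) by (auto elim!: msumE lineE)
      have "c *s z \<in> C" using ac x sub_diff[OF C(1) x, of a] C(2) by auto
      then have "\<not> is_unit_OO c" using sub_unit[OF C(1)] zC by blast
      then obtain d where "d \<in> \<O>" "c = \<epsilon> * d" using unit_or_ideal[OF ac(3)] by blast
      then have "c *s z \<in> A'" using sub_scale[OF A _ z, of d] by (simp add: mult.commute)
      then show "x \<in> A'" using ac sub_add[OF A] by blast
    qed
  qed (use C in auto)
qed

text \<open>Modular law for one step: C/(C \<inter> A') embeds into the simple quotient generated by
  \<open>z\<close>, so any \<open>y\<close> in \<open>C\<close> outside \<open>A'\<close> generates
  both quotients.\<close>

lemma Int_msum_line:
  assumes A: "is_sub A'" and z: "\<epsilon> *s z \<in> A'" and C: "is_sub C" "C \<subseteq> msum A' (line z)" "\<not> C \<subseteq> A'"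
  shows "\<exists>y. y \<in> C \<and> y \<notin> A' \<and> \<epsilon> *s y \<in> A' \<and> C = msum (C \<inter> A') (line y) \<and> msum A' (line z) = msum A' C"
proof -
  obtain y where y: "y \<in> C" "y \<notin> A'" using C by blast
  have ey: "\<epsilon> *s y \<in> A'"
  proof -
    obtain a c where "y = a + c *s z" "a \<in> A'" "c \<in> \<O>" using y C(2) by (auto elim!: msumE lineE)
    then have "\<epsilon> *s y = \<epsilon> *s a + c *s (\<epsilon> *s z)" by (simp add: N.scale_right_distrib mult.commute)
    then show ?thesis using \<open>a \<in> A'\<close> \<open>c \<in> \<O>\<close> z A by (metis sub_add sub_eps sub_scale)
  qed
  have yl: "msum A' (line y) \<subseteq> msum A' (line z)"
    using msum_ge1[OF sub_line] y C(2)
    by (intro msum_le[OF sub_msum[OF A sub_line]] line_le[OF sub_msum[OF A sub_line]]) auto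
  moreover have "msum A' (line y) \<noteq> A'" using y(2) msum_line_mem[OF A, of y] by auto
  ultimately have eq: "msum A' (line y) = msum A' (line z)"
    using sub_between_line[OF A z sub_msum[OF A sub_line] msum_ge1[OF sub_line]] by blast
  have "C = msum (C \<inter> A') (line y)"
  proof (rule subset_antisym)
    show "C \<subseteq> msum (C \<inter> A') (line y)"
    proof
      fix x assume x: "x \<in> C"
      then have "x \<in> msum A' (line y)" using C eq by blast
      then obtain a c where ac: "x = a + c *s y" "a \<in> A'" "c \<in> \<O>"
        by (auto elim!: msumE lineE)
      then have "a = x - c *s y" by simp
      then have "a \<in> C" using x y C(1) ac(3) by (simp add: sub_diff sub_scale)
      then show "x \<in> msum (C \<inter> A') (line y)" using ac by (auto intro: msumI lineI)
    qed
    show "msum (C \<inter> A') (line y) \<subseteq> C"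
      using y C(1) by (intro msum_le line_le) auto
  qed
  moreover have "msum A' (line z) = msum A' C"
  proof (rule subset_antisym)
    show "msum A' (line z) \<subseteq> msum A' C"
      unfolding eq[symmetric] by (intro msum_mono subset_refl line_le C y)
    show "msum A' C \<subseteq> msum A' (line z)"
      using C(2) msum_ge1[OF sub_line] A by (intro msum_le sub_msum sub_line) auto
  qed
  ultimately show ?thesis using y ey by blast
qed

text \<open>The surjection from U/W to (U + Z)/(W + Z) has kernel coming from U \<inter> Z, which
  lies in W. Hence the same vectors form a chain after adding Z.\<close>

lemma len_msum:
  assumes "len U W n" and Z: "is_sub Z" and "U \<inter> Z \<subseteq> W"
  shows "len (msum U Z) (msum W Z) n"
  using assms(1,3)
proof (induction rule: len.induct)
  case (len_refl A)
  then show ?case by (simp add: len.len_refl sub_msum Z)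
next
  case (len_step A' z B n)
  have *: "is_sub B" "B \<subseteq> A'" using len_sub[OF len_step(4)] by auto
  have "A' \<inter> Z \<subseteq> B" using len_step.prems msum_ge1[OF sub_line, of A' z] by blast
  then have IH: "len (msum A' Z) (msum B Z) n" using len_step.IH by blast
  have "z \<notin> msum A' Z"
  proof
    assume "z \<in> msum A' Z"
    then obtain a c where ac: "z = a + c" "a \<in> A'" "c \<in> Z" by (rule msumE)
    then have "c = (- a) + 1 *s z" by simp
    then have "c \<in> msum A' (line z)"
      using msumI[of "- a" A' "1 *s z" "line z"] lineI[of 1 z] sub_minus[OF len_step(1) ac(2)] by simp
    then have "c \<in> A'" using len_step.prems ac * by blast
    then show False using ac len_step sub_add by blast
  qed
  moreover have "\<epsilon> *s z \<in> msum A' Z" using len_step(3) msum_ge1[OF Z] by blast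
  moreover have "msum (msum A' (line z)) Z = msum (msum A' Z) (line z)"
    unfolding msum_def by (auto, metis add.assoc add.commute, metis add.assoc add.commute)
  ultimately show ?case using len.len_step[OF sub_msum[OF len_step(1) Z] _ _ IH, of z] by simp
qed

text \<open>Induction on the chain. If \<open>C\<close> is not inside \<open>A'\<close>, then
  \<open>C\<close> has one more step over C \<inter> A', and by \<open>len_msum\<close> the quotient
  A/C has the same length as A'/(C \<inter> A').\<close>

lemma len_split:
  assumes "len A B n" and "is_sub C" "B \<subseteq> C" "C \<subseteq> A"
  shows "\<exists>n1 n2. len A C n1 \<and> len C B n2 \<and> n1 + n2 = n"
  using assms
proof (induction arbitrary: C rule: len.induct)
  case (len_refl A)
  then have "C = A" by blast
  then show ?case using len_refl len.len_refl by auto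
next
  case (len_step A' z B n)
  have CA: "is_sub (C \<inter> A')" using len_step by (simp add: sub_Int)
  have "B \<subseteq> C \<inter> A'" using len_step len_sub[OF len_step(4)] by auto
  then obtain n1 n2 where n: "len A' (C \<inter> A') n1" "len (C \<inter> A') B n2" "n1 + n2 = n"
    using len_step.IH[OF CA] by auto
  show ?case
  proof (cases "C \<subseteq> A'")
    case True
    then have "C \<inter> A' = C" by blast
    then show ?thesis using n len.len_step[OF len_step(1-3)] by (intro exI[of _ "Suc n1"] exI[of _ n2]) auto
  next
    case False
    obtain y where y: "y \<in> C" "y \<notin> A'" "\<epsilon> *s y \<in> A'" "C = msum (C \<inter> A') (line y)"
        "msum A' (line z) = msum A' C"
      using Int_msum_line[OF len_step(1,3) len_step.prems(1,3) False] by blast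
    have "len (msum (C \<inter> A') (line y)) B (Suc n2)"
      using y len_step.prems by (intro len.len_step[OF CA _ _ n(2)]) (auto intro: sub_eps)
    then have "len C B (Suc n2)" using y(4) by simp
    moreover have "len (msum A' C) (msum (C \<inter> A') C) n1"
      using n(1) len_step.prems by (intro len_msum) auto
    moreover have "msum (C \<inter> A') C = C"
      using msum_absorb[OF len_step.prems(1) CA] by (simp add: msum_commute)
    ultimately show ?thesis using y(5) n(3) by (intro exI[of _ n1] exI[of _ "Suc n2"]) auto
  qed
qed

lemma len_self: "len A A n \<Longrightarrow> n = 0"
proof (erule len.cases)
  fix A' z B m assume *: "A = msum A' (line z)" "A = B" "z \<notin> A'" "len A' B m" "is_sub A'"
  then have "z \<in> A'" using len_sub[OF *(4)] msum_line_mem[OF *(5), of z] by blast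
  then show "n = 0" using * by blast
qed auto

text \<open>Jordan-Hoelder: the second chain is split at the top step of the first, and simplicity
  of that step forces the upper piece to have length one.\<close>

lemma len_unique: "len A B n \<Longrightarrow> len A B k \<Longrightarrow> n = k"
proof (induction arbitrary: k rule: len.induct)
  case (len_refl A)
  then show ?case using len_self by auto
next
  case (len_step A' z B n)
  have "B \<subseteq> A'" using len_sub[OF len_step(4)] by auto
  then obtain n1 n2 where n: "len (msum A' (line z)) A' n1" "len A' B n2" "n1 + n2 = k"
    using len_split[OF len_step.prems len_step(1) _ msum_ge1[OF sub_line]] by blast
  have "n1 = 1"
    using n(1)
  proof (cases rule: len.cases)
    case len_refl
    then show ?thesis using msum_line_mem[OF len_step(1), of z] len_step(2) by simp
  next
    case (len_step A'' y m)
    note l = len_sub[OF len_step(6)]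
    have "A'' \<noteq> msum A' (line z)" using len_step msum_line_mem[of A'' y] by auto
    then have "A'' = A'"
      using sub_between_line[OF \<open>is_sub A'\<close> \<open>\<epsilon> *s z \<in> A'\<close>, of A''] l len_step(1) msum_ge1[OF sub_line, of A'' y]
      by auto
    then show ?thesis using len_step len_self by auto
  qed
  then show ?case using len_step.IH[OF n(2)] n(3) by simp
qed

lemma len_0_eq: "len A B 0 \<Longrightarrow> A = B"
  by (erule len.cases) auto

lemma len_ex_finite:
  assumes "finite B" "is_sub A'" "\<And>w. w \<in> B \<Longrightarrow> \<epsilon> *s w \<in> A'"
  shows "\<exists>n. len (msum A' (O_span D B)) A' n"
  using assms
proof (induction B rule: finite_induct)
  case empty
  then show ?case using msum_absorb[of A' "{0}"] sub_O_span[of "{}"]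
    by (auto simp: O_span_empty sub_0 intro: len_refl)
next
  case (insert w B)
  then obtain n where n: "len (msum A' (O_span D B)) A' n" by auto
  have s: "is_sub (msum A' (O_span D B))" using insert by (simp add: sub_msum sub_O_span)
  have eq: "msum A' (O_span D (insert w B)) = msum (msum A' (O_span D B)) (line w)"
    unfolding O_span_insert unfolding msum_def by (auto, metis add.assoc, metis add.assoc)
  have ew: "\<epsilon> *s w \<in> msum A' (O_span D B)" using insert msum_ge1[OF sub_O_span] by blast
  show ?case
  proof (cases "w \<in> msum A' (O_span D B)")
    case True
    then show ?thesis unfolding eq using msum_absorb[OF s sub_line line_le[OF s True]] n by auto
  next
    case False
    then show ?thesis unfolding eq using len_step[OF s False ew n] by blast
  qed
qed

text \<open>Generators are eliminated one at a time. In w = a + \<epsilon>(s + c w) the factor 1 -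
  \<epsilon>c is a unit, so \<open>w\<close> is expressed by \<open>A\<close> and the remaining
  generators, and is then substituted into their relations.\<close>

lemma nakayama:
  assumes "finite B" "is_sub A" "\<And>b. b \<in> B \<Longrightarrow> \<exists>a\<in>A. \<exists>s\<in>O_span D (A \<union> B). b = a + \<epsilon> *s s"
  shows "B \<subseteq> A"
  using assms(1,3)
proof (induction B rule: finite_induct)
  case (insert w B)
  let ?S = "O_span D (A \<union> B)"
  note S = sub_O_span[of "A \<union> B"]
  have AS: "A \<subseteq> ?S" by (auto intro: O_span_inc)
  have dec: "\<exists>s\<in>?S. \<exists>c\<in>\<O>. t = s + c *s w" if "t \<in> O_span D (A \<union> insert w B)" for t
    using that by (auto simp: O_span_insert elim!: msumE lineE)
  obtain a s c where w: "w = a + \<epsilon> *s (s + c *s w)" "a \<in> A" "s \<in> ?S" "c \<in> \<O>"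
  proof -
    from insert.prems[of w] obtain a t where a: "a \<in> A" "t \<in> O_span D (A \<union> insert w B)" "w = a + \<epsilon> *s t"
      by blast
    from dec[OF a(2)] obtain s c where "s \<in> ?S" "c \<in> \<O>" "t = s + c *s w" by blast
    then show ?thesis using a that by blast
  qed
  let ?u = "inverse (1 - \<epsilon> * c)"
  have u: "is_unit_OO (1 - \<epsilon> * c)" using one_minus_eps_unit[OF w(4)] .
  have "(1 - \<epsilon> * c) *s w = a + \<epsilon> *s s"
    using w(1) by (simp add: N.scale_left_diff_distrib N.scale_right_distrib algebra_simps)
  then have w': "w = ?u *s a + \<epsilon> *s (?u *s s)"
  proof -
    have "w = ?u *s ((1 - \<epsilon> * c) *s w)" using u by (simp add: is_unit_OO_def)
    also have "\<dots> = ?u *s a + ?u *s (\<epsilon> *s s)"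
      by (simp only: \<open>(1 - \<epsilon> * c) *s w = a + \<epsilon> *s s\<close> N.scale_right_distrib)
    also have "?u *s (\<epsilon> *s s) = \<epsilon> *s (?u *s s)" by (simp add: mult.commute)
    finally show ?thesis .
  qed
  have uO: "?u \<in> \<O>" using u by (simp add: is_unit_OO_def)
  have wS: "w \<in> ?S" 
    by (subst w') (intro sub_add[OF S] sub_eps[OF S] sub_scale[OF S] uO w, use w AS in auto)
  have "B \<subseteq> A"
  proof (rule insert.IH)
    fix b assume "b \<in> B"
    then obtain a' t where b: "b = a' + \<epsilon> *s t" "a' \<in> A" "t \<in> O_span D (A \<union> insert w B)"
      using insert.prems by blast
    obtain s' d where "t = s' + d *s w" "s' \<in> ?S" "d \<in> \<O>" using dec[OF b(3)] by blast
    then have "t \<in> ?S" using wS S by (simp add: sub_add sub_scale)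
    then show "\<exists>a\<in>A. \<exists>s\<in>?S. b = a + \<epsilon> *s s" using b by blast
  qed
  then have "?S = A" using O_span_min[of A "A \<union> B"] AS assms(2) by blast
  then have "w \<in> A" by (subst w') (intro sub_add[OF assms(2)] sub_eps[OF assms(2)] sub_scale[OF assms(2)] uO, use w in auto)
  then show ?case using \<open>B \<subseteq> A\<close> by blast
qed simp

lemma nakayama_span:
  assumes "finite B" "is_sub A" "M = O_span D B" "\<And>x. x \<in> M \<Longrightarrow> \<exists>a\<in>A. \<exists>s\<in>M. x = a + \<epsilon> *s s"
  shows "M \<subseteq> A"
proof -
  have "B \<subseteq> A"
  proof (rule nakayama[OF assms(1,2)])
    fix b assume "b \<in> B"
    then obtain a s where "a \<in> A" "s \<in> M" "b = a + \<epsilon> *s s" using assms(3,4) O_span_inc by blast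
    moreover have "M \<subseteq> O_span D (A \<union> B)" using assms(3) by (auto intro!: O_span_mono)
    ultimately show "\<exists>a\<in>A. \<exists>s\<in>O_span D (A \<union> B). b = a + \<epsilon> *s s" by blast
  qed
  then show ?thesis using assms(2,3) O_span_min by blast
qed


section \<open>Semilinear bijections\<close>

text \<open>Wide enough for Phi, V, tau_0, tau_1, their inverses and all of GL(N). The twist
  \<open>\<theta>\<close> preserves the valuation ring and fixes \<open>\<epsilon>\<close>, so that
  submodules, lines and chains are carried to submodules, lines and chains.\<close>

definition semilin :: "('n \<Rightarrow> 'n) \<Rightarrow> bool" where
  "semilin T \<longleftrightarrow> bij T \<and> (\<forall>x y. T (x + y) = T x + T y) \<and>
     (\<exists>\<theta>. (\<forall>c x. T (c *s x) = \<theta> c *s T x) \<and> bij \<theta> \<and> (\<forall>c. \<theta> c \<in> \<O> \<longleftrightarrow> c \<in> \<O>) \<and> \<theta> \<epsilon> = \<epsilon>)"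

lemma semilinI:
  "bij T \<Longrightarrow> (\<And>x y. T (x + y) = T x + T y) \<Longrightarrow> (\<And>c x. T (c *s x) = \<theta> c *s T x) \<Longrightarrow> bij \<theta> \<Longrightarrow>
    (\<And>c. \<theta> c \<in> \<O> \<longleftrightarrow> c \<in> \<O>) \<Longrightarrow> \<theta> \<epsilon> = \<epsilon> \<Longrightarrow> semilin T"
  unfolding semilin_def by blast

lemma semilin_bij: "semilin T \<Longrightarrow> bij T"
  and semilin_add: "semilin T \<Longrightarrow> T (x + y) = T x + T y"
  and semilin_eps: "semilin T \<Longrightarrow> T (\<epsilon> *s x) = \<epsilon> *s T x"
  unfolding semilin_def by auto

lemma semilinE:
  assumes "semilin T"
  obtains \<theta> where "\<And>c x. T (c *s x) = \<theta> c *s T x" "bij \<theta>" "\<And>c. \<theta> c \<in> \<O> \<longleftrightarrow> c \<in> \<O>" "\<theta> \<epsilon> = \<epsilon>"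
  using assms unfolding semilin_def by blast

lemma semilin_0: "semilin T \<Longrightarrow> T 0 = 0"
  using semilin_add[of T 0 0] by (metis add.right_neutral add_left_cancel)

lemma semilin_minus: "semilin T \<Longrightarrow> T (- x) = - T x"
  using semilin_add[of T x "- x"] semilin_0[of T] by (simp add: add_eq_0_iff)

lemma semilin_diff: "semilin T \<Longrightarrow> T (x - y) = T x - T y"
  using semilin_add[of T x "- y"] semilin_minus[of T y] by simp

lemma semilin_sum: "semilin T \<Longrightarrow> T (sum f I) = (\<Sum>i\<in>I. T (f i))"
  by (induction I rule: infinite_finite_induct) (auto simp: semilin_0 semilin_add)

lemma semilin_inj: "semilin T \<Longrightarrow> T x = T y \<longleftrightarrow> x = y"
  using semilin_bij[of T] by (metis bij_is_inj injD)

lemma semilin_eps_power: "semilin T \<Longrightarrow> T (\<epsilon> ^ n *s x) = \<epsilon> ^ n *s T x"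
proof (induction n)
  case (Suc n)
  have "T (\<epsilon> *s (\<epsilon> ^ n *s x)) = \<epsilon> *s T (\<epsilon> ^ n *s x)" using Suc by (intro semilin_eps)
  then show ?case using Suc by simp
qed simp

lemma semilin_eps_powi: "semilin T \<Longrightarrow> T (\<epsilon> powi n *s x) = \<epsilon> powi n *s T x"
proof (cases "n \<ge> 0")
  case True
  then show "semilin T \<Longrightarrow> ?thesis" using semilin_eps_power[of T "nat n"] by (simp add: power_int_def)
next
  case False
  let ?k = "nat (- n)"
  have e: "\<epsilon> powi n = inverse (\<epsilon> ^ ?k)" using False by (simp add: power_int_def power_inverse)
  assume T: "semilin T"
  have "T x = T (\<epsilon> ^ ?k *s (\<epsilon> powi n *s x))" unfolding e by simp
  also have "\<dots> = \<epsilon> ^ ?k *s T (\<epsilon> powi n *s x)" by (rule semilin_eps_power[OF T])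
  finally show ?thesis unfolding e by simp
qed

lemma semilin_id: "semilin (\<lambda>x. x)"
  by (rule semilinI[where \<theta> = "\<lambda>c. c"]) (auto simp: bij_id[unfolded id_def])

lemma semilin_comp: "semilin S \<Longrightarrow> semilin T \<Longrightarrow> semilin (S \<circ> T)"
proof -
  assume S: "semilin S" and T: "semilin T"
  obtain \<theta> where 1: "\<And>c x. S (c *s x) = \<theta> c *s S x" "bij \<theta>" "\<And>c. \<theta> c \<in> \<O> \<longleftrightarrow> c \<in> \<O>" "\<theta> \<epsilon> = \<epsilon>"
    by (rule semilinE[OF S]) (rule that; assumption)
  obtain \<eta> where 2: "\<And>c x. T (c *s x) = \<eta> c *s T x" "bij \<eta>" "\<And>c. \<eta> c \<in> \<O> \<longleftrightarrow> c \<in> \<O>" "\<eta> \<epsilon> = \<epsilon>"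
    by (rule semilinE[OF T]) (rule that; assumption)
  show ?thesis
    by (rule semilinI[where \<theta> = "\<theta> \<circ> \<eta>"])
      (simp_all add: 1 2 bij_comp semilin_bij S T semilin_add)
qed

lemma semilin_inv: "semilin T \<Longrightarrow> semilin (Hilbert_Choice.inv T)"
proof -
  assume T: "semilin T"
  note b = semilin_bij[OF T]
  obtain \<theta> where 1: "\<And>c x. T (c *s x) = \<theta> c *s T x" "bij \<theta>" "\<And>c. \<theta> c \<in> \<O> \<longleftrightarrow> c \<in> \<O>" "\<theta> \<epsilon> = \<epsilon>"
    by (rule semilinE[OF T]) (rule that; assumption)
  let ?t = "Hilbert_Choice.inv \<theta>" and ?T = "Hilbert_Choice.inv T"
  have t: "\<theta> (?t c) = c" "?t (\<theta> c) = c" for c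
    using 1(2) by (auto simp: bij_is_surj surj_f_inv_f bij_is_inj)
  have T': "T (?T x) = x" "?T (T x) = x" for x
    using b by (auto simp: bij_is_surj surj_f_inv_f bij_is_inj)
  show ?thesis
  proof (rule semilinI[where \<theta> = ?t])
    show "bij ?T" "bij ?t" using b 1(2) by (auto simp: bij_imp_bij_inv)
    show "?T (x + y) = ?T x + ?T y" for x y
      using T'(1) semilin_add[OF T, of "?T x" "?T y"] T'(2)[of "?T x + ?T y"] by simp
    show "?T (c *s x) = ?t c *s ?T x" for c x
      using T'(1)[of x] 1(1)[of "?t c" "?T x"] t(1) T'(2)[of "?t c *s ?T x"] by simp
    show "?t c \<in> \<O> \<longleftrightarrow> c \<in> \<O>" for c using 1(3)[of "?t c"] t by simp
    show "?t \<epsilon> = \<epsilon>" using t(2)[of \<epsilon>] 1(4) by simp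
  qed
qed

lemma semilin_funpow: "semilin T \<Longrightarrow> semilin (T ^^ n)"
  by (induction n) (use semilin_id in \<open>auto simp: semilin_comp id_def\<close>)

lemma bij_smul: "c \<noteq> 0 \<Longrightarrow> bij (\<lambda>x. c *s x)"
  by (rule bij_betw_byWitness[where f' = "\<lambda>x. inverse c *s x"]) auto

lemma semilin_smul: "c \<noteq> 0 \<Longrightarrow> semilin (\<lambda>x. c *s x)"
  by (rule semilinI[where \<theta> = "\<lambda>c. c"]) (auto simp: bij_id[unfolded id_def] bij_smul N.scale_right_distrib mult.commute)

lemma Phi_add: "Phi D (x + y) = Phi D x + Phi D y"
  and Phi_scale: "Phi D (c *s x) = frob D c *s Phi D x"
  and bij_Phi: "bij (Phi D)"
  using isocrystal unfolding isocrystal_def by blast+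

lemma semilin_Phi: "semilin (Phi D)"
  by (rule semilinI[where \<theta> = "frob D"]) (auto simp: Phi_add Phi_scale bij_Phi bij_frob frob_val_ideal)

lemma Ver_eq: "Ver D = (\<lambda>x. \<epsilon> *s x) \<circ> Hilbert_Choice.inv (Phi D)"
  by (auto simp: Ver_def)

lemma semilin_Ver: "semilin (Ver D)"
  unfolding Ver_eq by (intro semilin_comp semilin_smul semilin_inv semilin_Phi) simp

lemma Phi_Ver: "Phi D (Ver D x) = \<epsilon> *s x"
  using bij_Phi by (simp add: Ver_def Phi_scale bij_is_surj surj_f_inv_f)

lemma Ver_Phi: "Ver D (Phi D x) = \<epsilon> *s x"
  using bij_Phi by (simp add: Ver_def bij_is_inj)

lemma semilin_GL: "g \<in> GL D \<Longrightarrow> semilin g"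
proof -
  assume "g \<in> GL D"
  then have g: "Vector_Spaces.linear (smul D) (smul D) g" "bij g" by (simp_all add: GL_def)
  show ?thesis
    by (rule semilinI[where \<theta> = "\<lambda>c. c"])
      (use g in \<open>auto simp: bij_id[unfolded id_def] Vector_Spaces.linear_iff\<close>)
qed

lemma GL_iff: "g \<in> GL D \<longleftrightarrow> bij g \<and> (\<forall>x y. g (x + y) = g x + g y) \<and> (\<forall>c x. g (c *s x) = c *s g x)"
  unfolding GL_def Vector_Spaces.linear_iff using N.vector_space_axioms by blast

lemma GL_id: "(\<lambda>x. x) \<in> GL D"
  by (simp add: GL_iff bij_id[unfolded id_def])

lemma GL_comp: "f \<in> GL D \<Longrightarrow> g \<in> GL D \<Longrightarrow> f \<circ> g \<in> GL D"
  by (simp add: GL_iff bij_comp)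

lemma GL_inv: "g \<in> GL D \<Longrightarrow> Hilbert_Choice.inv g \<in> GL D"
proof -
  assume g: "g \<in> GL D"
  then have b: "bij g" by (simp add: GL_iff)
  have T': "g (Hilbert_Choice.inv g x) = x" "Hilbert_Choice.inv g (g x) = x" for x
    using b by (auto simp: bij_is_surj surj_f_inv_f bij_is_inj)
  have "Hilbert_Choice.inv g (c *s x) = c *s Hilbert_Choice.inv g x" for c x
    using g T'(1)[of x] T'(2)[of "c *s Hilbert_Choice.inv g x"] by (simp add: GL_iff)
  then show ?thesis
    using semilin_inv[OF semilin_GL[OF g]] by (simp add: GL_iff semilin_bij semilin_add)
qed

lemma inv_inv_image: "bij T \<Longrightarrow> Hilbert_Choice.inv T ` (T ` A) = A"
  and image_inv_image: "bij T \<Longrightarrow> T ` (Hilbert_Choice.inv T ` A) = A"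
  by (auto simp: bij_is_inj bij_is_surj image_inv_f_f image_f_inv_f)

lemma sub_image: "semilin T \<Longrightarrow> is_sub A \<Longrightarrow> is_sub (T ` A)"
proof -
  assume T: "semilin T" and A: "is_sub A"
  obtain \<theta> where 1: "\<And>c x. T (c *s x) = \<theta> c *s T x" "bij \<theta>" "\<And>c. \<theta> c \<in> \<O> \<longleftrightarrow> c \<in> \<O>" "\<theta> \<epsilon> = \<epsilon>"
    by (rule semilinE[OF T]) (rule that; assumption)
  show ?thesis
  proof (rule subI)
    show "0 \<in> T ` A" using semilin_0[OF T] sub_0[OF A] by (metis imageI)
    show "x + y \<in> T ` A" if xy: "x \<in> T ` A" "y \<in> T ` A" for x y
    proof -
      from xy obtain u v where "x = T u" "u \<in> A" "y = T v" "v \<in> A" by blast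
      then show ?thesis using sub_add[OF A, of u v] semilin_add[OF T, of u v] by (metis imageI)
    qed
    show "c *s x \<in> T ` A" if "c \<in> \<O>" "x \<in> T ` A" for c x
    proof -
      obtain d where d: "c = \<theta> d" using 1(2) by (metis bij_pointE)
      from that(2) obtain y where "x = T y" "y \<in> A" by blast
      with that(1) have "c *s x = T (d *s y)" "d *s y \<in> A" using d 1 sub_scale[OF A] by auto
      then show ?thesis by blast
    qed
  qed
qed

lemma msum_image: "semilin T \<Longrightarrow> T ` msum A B = msum (T ` A) (T ` B)"
proof (intro subset_antisym subsetI)
  assume T: "semilin T"
  show "x \<in> msum (T ` A) (T ` B)" if "x \<in> T ` msum A B" for x
    using that by (auto simp: semilin_add[OF T] elim!: msumE intro!: msumI)
  show "x \<in> T ` msum A B" if "x \<in> msum (T ` A) (T ` B)" for x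
    using that by (auto elim!: msumE simp flip: semilin_add[OF T] intro: msumI)
qed

lemma line_image: "semilin T \<Longrightarrow> T ` line z = line (T z)"
proof -
  assume T: "semilin T"
  obtain \<theta> where 1: "\<And>c x. T (c *s x) = \<theta> c *s T x" "bij \<theta>" "\<And>c. \<theta> c \<in> \<O> \<longleftrightarrow> c \<in> \<O>" "\<theta> \<epsilon> = \<epsilon>"
    by (rule semilinE[OF T]) (rule that; assumption)
  show ?thesis
  proof
    show "T ` line z \<subseteq> line (T z)" unfolding line_def by (auto simp: 1)
    show "line (T z) \<subseteq> T ` line z"
    proof
      fix x assume "x \<in> line (T z)"
      then obtain c where c: "x = c *s T z" "c \<in> \<O>" by (rule lineE)
      obtain d where d: "c = \<theta> d" using 1(2) by (metis bij_pointE)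
      then have "d *s z \<in> line z" "x = T (d *s z)" using c 1 by (auto simp: line_def)
      then show "x \<in> T ` line z" by blast
    qed
  qed
qed

lemma O_span_image: "semilin T \<Longrightarrow> T ` O_span D S = O_span D (T ` S)"
proof
  assume T: "semilin T"
  show "O_span D (T ` S) \<subseteq> T ` O_span D S"
    by (intro O_span_min sub_image T sub_O_span) (auto intro: O_span_inc)
  have "O_span D S \<subseteq> Hilbert_Choice.inv T ` O_span D (T ` S)"
    using inv_inv_image[OF semilin_bij[OF T], of S]
    by (intro O_span_min sub_image semilin_inv T sub_O_span) (metis O_span_inc image_mono subsetI)
  then show "T ` O_span D S \<subseteq> O_span D (T ` S)"
    using image_inv_image[OF semilin_bij[OF T]] by (metis image_mono)
qed

lemma len_image: "len A B n \<Longrightarrow> semilin T \<Longrightarrow> len (T ` A) (T ` B) n"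
proof (induction rule: len.induct)
  case (len_refl A)
  then show ?case by (simp add: len.len_refl sub_image)
next
  case (len_step A' z B n)
  have "T z \<notin> T ` A'" using len_step semilin_inj[OF len_step.prems] by auto
  moreover have "\<epsilon> *s T z \<in> T ` A'" using len_step semilin_eps[OF len_step.prems] by (metis image_eqI)
  ultimately show ?case
    unfolding msum_image[OF len_step.prems] line_image[OF len_step.prems]
    using len_step by (intro len.len_step sub_image) auto
qed

lemma len_inv_image: "semilin T \<Longrightarrow> len (T ` A) (T ` B) n \<Longrightarrow> len A B n"
  using len_image[of "T ` A" "T ` B" n "Hilbert_Choice.inv T"]
  by (simp add: semilin_inv semilin_bij inv_inv_image)

subsection \<open>The a-invariant\<close>

definition res_indep :: "'n set \<Rightarrow> 'n set \<Rightarrow> bool" where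
  "res_indep M' B \<longleftrightarrow> (\<forall>c. (\<forall>w\<in>B. c w \<in> \<O>) \<longrightarrow> (\<Sum>w\<in>B. c w *s w) \<in> M' \<longrightarrow> (\<forall>w\<in>B. red D (c w) = 0))"

definition res_basis :: "'n set \<Rightarrow> 'n set \<Rightarrow> 'n set \<Rightarrow> bool" where
  "res_basis M M' B \<longleftrightarrow> B \<subseteq> M \<and> finite B \<and>
     (\<forall>x\<in>M. \<exists>c. (\<forall>w\<in>B. c w \<in> \<O>) \<and> x - (\<Sum>w\<in>B. c w *s w) \<in> M') \<and> res_indep M' B"

lemma residue_dim_eq: "residue_dim D M M' = (THE d. \<exists>B. res_basis M M' B \<and> card B = d)"
  unfolding residue_dim_def res_basis_def res_indep_def
  by (rule arg_cong[where f = The]) (auto intro!: ext)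

lemma res_indep_len:
  assumes M': "is_sub M'" and "finite B" "res_indep M' B" "\<And>w. w \<in> B \<Longrightarrow> \<epsilon> *s w \<in> M'"
  shows "A \<subseteq> B \<Longrightarrow> len (msum M' (O_span D A)) M' (card A)"
proof -
  have "finite A \<Longrightarrow> A \<subseteq> B \<Longrightarrow> ?thesis"
  proof (induction A rule: finite_induct)
    case empty
    then show ?case using msum_absorb[OF M' sub_O_span[of "{}"]] M'
      by (simp add: O_span_empty sub_0 len_refl)
  next
    case (insert w A)
    have s: "is_sub (msum M' (O_span D A))" using M' by (simp add: sub_msum sub_O_span)
    have eq: "msum M' (O_span D (insert w A)) = msum (msum M' (O_span D A)) (line w)"
      unfolding O_span_insert unfolding msum_def by (auto, metis add.assoc, metis add.assoc)
    have "w \<notin> msum M' (O_span D A)"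
    proof
      assume "w \<in> msum M' (O_span D A)"
      then obtain y z where yz: "w = y + z" "y \<in> M'" "z \<in> O_span D A" by (rule msumE)
      obtain c where c: "\<forall>v\<in>A. c v \<in> \<O>" "z = (\<Sum>v\<in>A. c v *s v)"
        using O_span_finite[OF insert(1) yz(3)] by blast
      \<comment> \<open>If \<open>w\<close> were redundant, this would be a relation modulo
        \<open>M'\<close> with coefficient 1 at \<open>w\<close>, whose reduction is not 0.\<close>
      define d where "d = (\<lambda>v. if v = w then 1 else if v \<in> A then - c v else 0)"
      have "(\<Sum>v\<in>B. d v *s v) = (\<Sum>v\<in>insert w A. d v *s v)"
        using assms(2) insert by (intro sum.mono_neutral_right) (auto simp: d_def)
      also have "\<dots> = w + (\<Sum>v\<in>A. d v *s v)" using insert by (simp add: d_def)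
      also have "(\<Sum>v\<in>A. d v *s v) = - z"
        unfolding c(2) sum_negf[symmetric] using insert by (intro sum.cong) (auto simp: d_def)
      finally have "(\<Sum>v\<in>B. d v *s v) \<in> M'" using yz by simp
      moreover have "\<forall>v\<in>B. d v \<in> \<O>" using c by (auto simp: d_def OO_minus)
      ultimately have "red D (d w) = 0" using assms(3) insert unfolding res_indep_def by blast
      then show False by (simp add: d_def)
    qed
    moreover have "\<epsilon> *s w \<in> msum M' (O_span D A)" using assms(4) insert msum_ge1[OF sub_O_span] by blast
    ultimately show ?case unfolding eq using insert by (auto intro!: len_step s)
  qed
  then show "A \<subseteq> B \<Longrightarrow> ?thesis" using finite_subset[OF _ assms(2)] by blast
qed

text \<open>Identifies the cardinality of every basis of M/M' with one length, which is what makes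
  the definite description in \<open>residue_dim\<close> denote.\<close>

lemma res_basis_len:
  assumes M': "is_sub M'" and M: "is_sub M" "M' \<subseteq> M" "\<And>w. w \<in> M \<Longrightarrow> \<epsilon> *s w \<in> M'" and B: "res_basis M M' B"
  shows "len M M' (card B)"
proof -
  have *: "B \<subseteq> M" "finite B" "res_indep M' B" using B unfolding res_basis_def by auto
  have "msum M' (O_span D B) = M"
  proof
    show "msum M' (O_span D B) \<subseteq> M" using * M by (intro msum_le O_span_min) auto
    show "M \<subseteq> msum M' (O_span D B)"
    proof
      fix x assume "x \<in> M"
      then obtain c where c: "\<forall>w\<in>B. c w \<in> \<O>" "x - (\<Sum>w\<in>B. c w *s w) \<in> M'"
        using B unfolding res_basis_def by blast
      have "(\<Sum>w\<in>B. c w *s w) \<in> O_span D B"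
        using c by (intro sub_sum sub_scale sub_O_span O_span_inc) auto
      then show "x \<in> msum M' (O_span D B)" using msumI[OF c(2)] by fastforce
    qed
  qed
  then show ?thesis using res_indep_len[OF M' *(2,3) _ subset_refl] * M by auto
qed

text \<open>Greedy selection: a new \<open>w\<close> outside the span so far cannot occur in a
  relation with a unit coefficient, and with a coefficient divisible by \<open>\<epsilon>\<close>
  its term lies in \<open>M'\<close> and drops out.\<close>

lemma res_indep_subset:
  assumes M': "is_sub M'" and "finite B1" "\<And>w. w \<in> B1 \<Longrightarrow> \<epsilon> *s w \<in> M'"
  shows "\<exists>B. B \<subseteq> B1 \<and> B1 \<subseteq> msum M' (O_span D B) \<and> res_indep M' B"
  using assms(2,3)
proof (induction B1 rule: finite_induct)
  case empty
  then show ?case by (auto simp: res_indep_def)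
next
  case (insert w B1)
  then obtain B where B: "B \<subseteq> B1" "B1 \<subseteq> msum M' (O_span D B)" "res_indep M' B" by auto
  have finB: "finite B" using B(1) insert(1) finite_subset by blast
  show ?case
  proof (cases "w \<in> msum M' (O_span D B)")
    case True
    then show ?thesis using B by (intro exI[of _ B]) auto
  next
    case False
    have "w \<in> msum M' (O_span D (insert w B))"
      using msum_ge2[OF M'] O_span_inc[of w "insert w B"] by blast
    moreover have "B1 \<subseteq> msum M' (O_span D (insert w B))"
      using B(2) msum_mono[OF subset_refl O_span_mono[of B "insert w B"]] by blast
    moreover have "res_indep M' (insert w B)"
      unfolding res_indep_def
    proof (intro allI impI)
      fix c assume c: "\<forall>v\<in>insert w B. c v \<in> \<O>" "(\<Sum>v\<in>insert w B. c v *s v) \<in> M'"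
      have wB: "w \<notin> B" using B(1) insert by blast
      have eq: "(\<Sum>v\<in>insert w B. c v *s v) = c w *s w + (\<Sum>v\<in>B. c v *s v)" using finB wB by simp
      have nu: "\<not> is_unit_OO (c w)"
      proof
        assume u: "is_unit_OO (c w)"
        have "c w *s w = (\<Sum>v\<in>insert w B. c v *s v) + - (\<Sum>v\<in>B. c v *s v)" using eq by simp
        moreover have "- (\<Sum>v\<in>B. c v *s v) \<in> O_span D B"
          using c by (intro sub_minus sub_sum sub_scale sub_O_span O_span_inc) auto
        ultimately have "c w *s w \<in> msum M' (O_span D B)" by (simp only: msumI[OF c(2)])
        then show False using False sub_unit[OF sub_msum[OF M' sub_O_span] u] by blast
      qed
      then obtain y where y: "y \<in> \<O>" "c w = \<epsilon> * y" using c unit_or_ideal by blast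
      have "\<epsilon> *s w \<in> M'" using insert by blast
      then have "c w *s w \<in> M'" using y sub_scale[OF M' y(1)] by (metis N.scale_scale mult.commute)
      then have "(\<Sum>v\<in>B. c v *s v) \<in> M'" using c(2) eq sub_diff[OF M' c(2)] by (metis add_diff_cancel_left')
      then have "\<forall>v\<in>B. red D (c v) = 0" using B(3) c unfolding res_indep_def by blast
      moreover have "red D (c w) = 0" using nu c unit_iff_red by auto
      ultimately show "\<forall>v\<in>insert w B. red D (c v) = 0" by auto
    qed
    ultimately show ?thesis using B by (intro exI[of _ "insert w B"]) auto
  qed
qed

lemma res_basis_exists:
  assumes M': "is_sub M'" and "finite B0" "M = O_span D B0" "M' \<subseteq> M" "\<And>w. w \<in> M \<Longrightarrow> \<epsilon> *s w \<in> M'"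
  shows "\<exists>B. res_basis M M' B"
proof -
  have "\<epsilon> *s w \<in> M'" if "w \<in> B0" for w
    using that assms(3,5) O_span_inc by blast
  then obtain B where B: "B \<subseteq> B0" "B0 \<subseteq> msum M' (O_span D B)" "res_indep M' B"
    using res_indep_subset[OF M' assms(2)] by blast
  have finB: "finite B" using B(1) assms(2) finite_subset by blast
  have M: "M \<subseteq> msum M' (O_span D B)"
    using B(2) assms(3) O_span_min[OF sub_msum[OF M' sub_O_span]] by blast
  have "res_basis M M' B"
    unfolding res_basis_def
  proof (intro conjI ballI)
    show "B \<subseteq> M" using B(1) assms(3) O_span_inc by blast
    fix x assume "x \<in> M"
    then obtain y z where yz: "x = y + z" "y \<in> M'" "z \<in> O_span D B" using M by (blast elim: msumE)
    then show "\<exists>c. (\<forall>w\<in>B. c w \<in> \<O>) \<and> x - (\<Sum>w\<in>B. c w *s w) \<in> M'"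
      using O_span_finite[OF finB yz(3)] by (metis add_diff_cancel_right')
  qed (use B finB in auto)
  then show ?thesis by blast
qed

lemma residue_dim_1_iff:
  assumes M': "is_sub M'" and fin: "finite B0" "M = O_span D B0" and M: "M' \<subseteq> M" "\<And>w. w \<in> M \<Longrightarrow> \<epsilon> *s w \<in> M'"
  shows "residue_dim D M M' = 1 \<longleftrightarrow> (\<exists>v\<in>M. v \<notin> M' \<and> M = msum M' (line v))"
proof -
  have sM: "is_sub M" using fin sub_O_span by simp
  obtain B where B: "res_basis M M' B" using res_basis_exists[OF M' fin M] by blast
  have l: "len M M' (card B)" by (rule res_basis_len[OF M' sM M B])
  have "residue_dim D M M' = card B"
    unfolding residue_dim_eq
    by (rule the_equality) (use B res_basis_len[OF M' sM M] len_unique l in blast)+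
  moreover have "(\<exists>v\<in>M. v \<notin> M' \<and> M = msum M' (line v)) \<longleftrightarrow> len M M' 1"
  proof
    assume "\<exists>v\<in>M. v \<notin> M' \<and> M = msum M' (line v)"
    then obtain v where v: "v \<in> M" "v \<notin> M'" "M = msum M' (line v)" by blast
    then show "len M M' 1" using len_step[OF M' v(2) M(2)[OF v(1)] len_refl[OF M']] by simp
  next
    assume "len M M' 1"
    then show "\<exists>v\<in>M. v \<notin> M' \<and> M = msum M' (line v)"
    proof (cases rule: len.cases)
      case (len_step A' z n)
      then have "A' = M'" using len_0_eq by auto
      then show ?thesis using len_step msum_line_mem[of A' z] by blast
    qed simp
  qed
  ultimately show ?thesis using l len_unique by metis
qed

end

section \<open>The vectors e_{i,j} and the operators tau_0, tau_1\<close>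

locale decomposed_isocrystal = isocrystal_over D
  for D :: "('a::field, 'k::{field,finite}, 'n::ab_group_add) decomposed_data" +
  assumes h_pos: "1 \<le> slope_h D" and m_le_h: "slope_m D \<le> slope_h D"
    and coprime_mh: "coprime (slope_m D) (slope_h D)"
    and decomposition: "simple_decomposition D"
    and generators: "tau0_fixed_generators D"
    and ncomp_pos: "0 < ncomp D"
begin

abbreviation "m \<equiv> slope_m D"
abbreviation "h \<equiv> slope_h D"
abbreviation "l \<equiv> ncomp D"
abbreviation e where "e \<equiv> evec D"

lemma bezout_a: "0 < bezout_a D" and bezout: "int (bezout_a D) * int m + bezout_a' D * int h = 1"
proof -
  obtain u v :: int where uv: "u * int m + v * int h = 1"
    using bezout_int[of "int m" "int h"] coprime_mh by auto
  \<comment> \<open>The first Bezout coefficient may be changed by multiples of \<open>h\<close>;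
    adding |u| + 1 copies makes it positive.\<close>
  let ?a = "nat (u + (\<bar>u\<bar> + 1) * int h)"
  have "u + (\<bar>u\<bar> + 1) * 1 \<le> u + (\<bar>u\<bar> + 1) * int h" using h_pos by (intro add_left_mono mult_left_mono) auto
  moreover have "0 < u + (\<bar>u\<bar> + 1) * 1" by simp
  ultimately have "0 < u + (\<bar>u\<bar> + 1) * int h" by (rule less_le_trans[rotated])
  then have a: "0 < ?a" "int ?a = u + (\<bar>u\<bar> + 1) * int h" by auto
  have "int ?a * int m + (v - (\<bar>u\<bar> + 1) * int m) * int h = 1"
    unfolding a(2) using uv by (simp add: algebra_simps)
  then have "0 < ?a \<and> (\<exists>a'. int ?a * int m + a' * int h = 1)" using a(1) by blast
  then have P: "0 < bezout_a D \<and> (\<exists>a'. int (bezout_a D) * int m + a' * int h = 1)"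
    unfolding bezout_a_def by (rule LeastI)
  then show "0 < bezout_a D" by blast
  obtain a' where a': "int (bezout_a D) * int m + a' * int h = 1" using P by blast
  have uniq: "b = a'" if "int (bezout_a D) * int m + b * int h = 1" for b
  proof -
    have "b * int h = a' * int h" using that a' by linarith
    then show ?thesis using h_pos by simp
  qed
  show "int (bezout_a D) * int m + bezout_a' D * int h = 1"
    unfolding bezout_a'_def
    by (rule theI[where P = "\<lambda>a'. int (bezout_a D) * int m + a' * int h = 1"]) (rule a', erule uniq)
qed

lemma tau0_eq: "tau0 D = (Phi D ^^ h) \<circ> (\<lambda>x. \<epsilon> powi (- int m) *s x)"
  by (auto simp: tau0_def)

lemma tau1_eq: "tau1 D = (Phi D ^^ bezout_a D) \<circ> (\<lambda>x. \<epsilon> powi (bezout_a' D) *s x)"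
  by (auto simp: tau1_def)

lemma semilin_tau0: "semilin (tau0 D)" and semilin_tau1: "semilin (tau1 D)"
  unfolding tau0_eq tau1_eq by (intro semilin_comp semilin_funpow semilin_Phi semilin_smul; simp)+

lemmas semilin_Phi_pow = semilin_funpow[OF semilin_Phi]

lemma Phi_pow_add: "(Phi D ^^ i) ((Phi D ^^ j) x) = (Phi D ^^ (i + j)) x"
  by (simp add: funpow_add)

lemma tau0_alt: "tau0 D x = \<epsilon> powi (- int m) *s (Phi D ^^ h) x"
  unfolding tau0_def by (rule semilin_eps_powi[OF semilin_Phi_pow])

lemma tau1_alt: "tau1 D x = \<epsilon> powi (bezout_a' D) *s (Phi D ^^ bezout_a D) x"
  unfolding tau1_def by (rule semilin_eps_powi[OF semilin_Phi_pow])

lemma tau1_pow: "(tau1 D ^^ j) x = \<epsilon> powi (bezout_a' D * int j) *s (Phi D ^^ (bezout_a D * j)) x"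
proof (induction j)
  case (Suc j)
  have "(tau1 D ^^ Suc j) x = tau1 D (\<epsilon> powi (bezout_a' D * int j) *s (Phi D ^^ (bezout_a D * j)) x)"
    using Suc by simp
  also have "\<dots> = \<epsilon> powi (bezout_a' D * int j) *s tau1 D ((Phi D ^^ (bezout_a D * j)) x)"
    by (rule semilin_eps_powi[OF semilin_tau1])
  also have "\<dots> = (\<epsilon> powi (bezout_a' D * int j) * \<epsilon> powi (bezout_a' D)) *s (Phi D ^^ (bezout_a D + bezout_a D * j)) x"
    unfolding tau1_alt Phi_pow_add by simp
  also have "\<epsilon> powi (bezout_a' D * int j) * \<epsilon> powi (bezout_a' D) = \<epsilon> powi (bezout_a' D * int (Suc j))"
    by (simp add: algebra_simps power_int_add)
  finally show ?case by simp
qed simp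

lemma Phi_tau0: "Phi D (tau0 D x) = tau0 D (Phi D x)"
  unfolding tau0_alt semilin_eps_powi[OF semilin_Phi] by (simp add: funpow_swap1)

lemma Phi_pow_tau0: "(Phi D ^^ j) (tau0 D x) = tau0 D ((Phi D ^^ j) x)"
  by (induction j) (auto simp: Phi_tau0)

lemma tau0_tau1: "tau0 D (tau1 D x) = tau1 D (tau0 D x)"
  unfolding tau1_alt Phi_pow_tau0 by (simp add: semilin_eps_powi[OF semilin_tau0])

text \<open>All e_{i,j} are of this kind, and on such vectors Phi^h is multiplication by
  \<epsilon>^m. The relation am + a'h = 1 then turns \<epsilon> and Phi into powers of tau_1, see
  \<open>tau1_h\<close> and \<open>tau1_m\<close>.\<close>

definition tfix :: "'n \<Rightarrow> bool" where "tfix y \<longleftrightarrow> tau0 D y = y"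

lemma tfix_tau1: "tfix y \<Longrightarrow> tfix (tau1 D y)"
  by (simp add: tfix_def tau0_tau1)

lemma tfix_tau1_pow: "tfix y \<Longrightarrow> tfix ((tau1 D ^^ j) y)"
  by (induction j) (auto simp: tfix_tau1)

lemma tfix_Phi_pow: assumes "tfix y" shows "(Phi D ^^ (h * k)) y = \<epsilon> ^ (m * k) *s y"
proof (induction k)
  case (Suc k)
  have y: "(Phi D ^^ h) y = \<epsilon> ^ m *s y"
  proof -
    have "y = \<epsilon> powi (- int m) *s (Phi D ^^ h) y" using assms unfolding tfix_def tau0_alt by simp
    then have "\<epsilon> ^ m *s y = \<epsilon> ^ m *s (\<epsilon> powi (- int m) *s (Phi D ^^ h) y)" by simp
    then show ?thesis by (simp add: power_int_minus)
  qed
  have "(Phi D ^^ (h * Suc k)) y = (Phi D ^^ h) ((Phi D ^^ (h * k)) y)" by (simp add: Phi_pow_add)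
  also have "\<dots> = \<epsilon> ^ (m * k) *s (Phi D ^^ h) y"
    unfolding Suc by (rule semilin_eps_power[OF semilin_Phi_pow])
  finally show ?case unfolding y by (simp add: power_add mult.commute)
qed simp

lemma tau1_h: assumes "tfix y" shows "(tau1 D ^^ h) y = \<epsilon> *s y"
proof -
  have "(tau1 D ^^ h) y = (\<epsilon> powi (bezout_a' D * int h) * \<epsilon> ^ (m * bezout_a D)) *s y"
    unfolding tau1_pow by (simp add: tfix_Phi_pow[OF assms, of "bezout_a D", unfolded mult.commute[of h]])
  also have "\<epsilon> powi (bezout_a' D * int h) * \<epsilon> ^ (m * bezout_a D) = \<epsilon> powi (bezout_a' D * int h + int (m * bezout_a D))"
    by (subst power_int_add) (simp_all only: power_int_of_nat eps_nz simp_thms)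
  also have "bezout_a' D * int h + int (m * bezout_a D) = 1" using bezout by (simp add: algebra_simps)
  finally show ?thesis by simp
qed

text \<open>For a' \<le> 0 put b = -a'. Then am = 1 + hb, so tau_1^m = \<epsilon>^(-bm) Phi^(1+hb),
  where Phi^(hb) contributes \<epsilon>^(mb). The sign of a' matters because Phi is iterated with
  natural exponents only.\<close>

lemma tau1_m: assumes "tfix y" shows "(tau1 D ^^ m) y = Phi D y"
proof (cases "bezout_a' D \<le> 0")
  case True
  let ?b = "nat (- bezout_a' D)"
  have "int (bezout_a D * m) = 1 + int h * int ?b" using bezout True by (simp add: algebra_simps)
  then have am: "bezout_a D * m = 1 + h * ?b" 
  proof -
    have "int (1 + h * ?b) = 1 + int h * int ?b" by (simp only: of_nat_add of_nat_mult of_nat_1)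
    then show ?thesis using \<open>int (bezout_a D * m) = 1 + int h * int ?b\<close> by (metis of_nat_eq_iff)
  qed
  have "(tau1 D ^^ m) y = \<epsilon> powi (- int (?b * m)) *s Phi D ((Phi D ^^ (h * ?b)) y)"
  proof -
    have 1: "bezout_a' D * int m = - int (?b * m)" using True by simp
    show ?thesis unfolding tau1_pow am 1 by (simp add: funpow_swap1)
  qed
  also have "\<dots> = \<epsilon> powi (- int (?b * m)) *s (\<epsilon> ^ (m * ?b) *s Phi D y)"
    unfolding tfix_Phi_pow[OF assms] semilin_eps_power[OF semilin_Phi] ..
  also have "\<dots> = Phi D y" by (simp add: power_int_minus mult.commute flip: power_int_of_nat)
  finally show ?thesis .
next
  case False
  \<comment> \<open>Both summands of am + a'h = 1 are nonnegative and the second is positive, which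
    leaves only m = 0 and h = 1.\<close>
  then have "bezout_a' D * int h \<ge> 1 * 1" using h_pos by (intro mult_mono) auto
  then have 1: "int (bezout_a D) * int m = 0" "bezout_a' D * int h = 1"
    using bezout mult_nonneg_nonneg[of "int (bezout_a D)" "int m"] by linarith+
  then have m0: "m = 0" using bezout_a by simp
  have "h = 1" using 1(2) by (metis nat_int nat_one_as_int of_nat_1 False pos_zmult_eq_1_iff linorder_not_le)
  then show ?thesis using tfix_Phi_pow[OF assms, of 1] m0 by simp
qed

lemma tfix_gen: "i < l \<Longrightarrow> tfix (gen D i)"
  and gen_comp: "i < l \<Longrightarrow> gen D i \<in> comp D i"
  and gen_nz: "i < l \<Longrightarrow> gen D i \<noteq> 0"
  using generators unfolding tau0_fixed_generators_def tfix_def by auto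

lemma tfix_e: "i < l \<Longrightarrow> tfix (e i j)"
  unfolding evec_def by (intro tfix_tau1_pow tfix_gen)

lemma tau0_e: "i < l \<Longrightarrow> tau0 D (e i j) = e i j"
  using tfix_e unfolding tfix_def by blast

lemma tau1_e: "tau1 D (e i j) = e i (Suc j)"
  by (simp add: evec_def)

lemma tau1_pow_e: "(tau1 D ^^ k) (e i j) = e i (k + j)"
  by (simp add: evec_def funpow_add)

lemma e_h: "i < l \<Longrightarrow> e i (j + h) = \<epsilon> *s e i j"
  using tau1_h[OF tfix_e, of i j] by (simp add: tau1_pow_e add.commute)

lemma e_mult_h: "i < l \<Longrightarrow> e i (j + n * h) = \<epsilon> ^ n *s e i j"
proof (induction n)
  case (Suc n)
  have "e i (j + Suc n * h) = e i ((j + n * h) + h)" by (simp add: algebra_simps)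
  then show ?case unfolding e_h[OF Suc.prems] using Suc by simp
qed simp

lemma Phi_e: "i < l \<Longrightarrow> Phi D (e i j) = e i (j + m)"
  using tau1_m[OF tfix_e, of i j] by (simp add: tau1_pow_e add.commute)

lemma Ver_e: "i < l \<Longrightarrow> Ver D (e i j) = e i (j + (h - m))"
proof -
  assume i: "i < l"
  have "Phi D (e i (j + (h - m))) = e i (j + h)" using m_le_h by (simp add: Phi_e[OF i])
  also have "\<dots> = Phi D (Ver D (e i j))" unfolding Phi_Ver e_h[OF i] ..
  finally show ?thesis using semilin_inj[OF semilin_Phi] by metis
qed

section \<open>The filtration of M_0 by powers of tau_1\<close>

text \<open>This is the lattice tau_1^k M_0. Indexing by k puts Phi, V and \<epsilon> on one scale:
  they shift the index by m, h - m and h.\<close>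

definition Fil :: "nat \<Rightarrow> 'n set" where
  "Fil k = O_span D {e i j | i j. i < l \<and> k \<le> j}"

lemma sub_Fil: "is_sub (Fil k)"
  unfolding Fil_def by (rule sub_O_span)

lemma e_Fil: "i < l \<Longrightarrow> k \<le> j \<Longrightarrow> e i j \<in> Fil k"
  unfolding Fil_def by (rule O_span_inc) blast

lemma M0_eq: "M0 D = Fil 0"
  unfolding M0_def Fil_def by simp

lemma Fil_shift:
  assumes "semilin T" "\<And>i j. i < l \<Longrightarrow> T (e i j) = e i (j + n)"
  shows "T ` Fil k = Fil (k + n)"
proof -
  have "T ` {e i j | i j. i < l \<and> k \<le> j} = {e i j | i j. i < l \<and> k + n \<le> j}"
  proof
    show "T ` {e i j | i j. i < l \<and> k \<le> j} \<subseteq> {e i j | i j. i < l \<and> k + n \<le> j}"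
      using assms(2) by fastforce
    show "{e i j | i j. i < l \<and> k + n \<le> j} \<subseteq> T ` {e i j | i j. i < l \<and> k \<le> j}"
    proof
      fix x assume "x \<in> {e i j | i j. i < l \<and> k + n \<le> j}"
      then obtain i j where ij: "i < l" "k + n \<le> j" "x = e i j" by blast
      then have "x = T (e i (j - n))" "k \<le> j - n" using assms(2)[of i "j - n"] by auto
      then show "x \<in> T ` {e i j | i j. i < l \<and> k \<le> j}" using ij by blast
    qed
  qed
  then show ?thesis unfolding Fil_def O_span_image[OF assms(1)] by simp
qed

lemma Phi_Fil: "Phi D ` Fil k = Fil (k + m)"
  and Ver_Fil: "Ver D ` Fil k = Fil (k + (h - m))"
  and tau0_Fil: "tau0 D ` Fil k = Fil k"
  and tau1_Fil: "tau1 D ` Fil k = Fil (k + 1)"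
  and eps_Fil: "(\<lambda>x. \<epsilon> *s x) ` Fil k = Fil (k + h)"
  using Fil_shift[OF semilin_tau0, of 0] Fil_shift[OF semilin_tau1, of 1 k]
  by (auto intro!: Fil_shift[where n = m] Fil_shift[where n = "h - m"] Fil_shift[where n = h]
    semilin_Phi semilin_Ver semilin_smul simp: Phi_e Ver_e tau0_e tau1_e e_h)

lemma Fil_antimono: "k \<le> k' \<Longrightarrow> Fil k' \<subseteq> Fil k"
  unfolding Fil_def by (rule O_span_mono) (use le_trans in blast)

lemma eps_mem_Fil: "x \<in> Fil k \<Longrightarrow> \<epsilon> *s x \<in> Fil (k + h)"
  using eps_Fil by blast

lemma eps_mem_Fil1: "x \<in> Fil k \<Longrightarrow> \<epsilon> *s x \<in> Fil (Suc k)"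
  using eps_mem_Fil[of x k] Fil_antimono[of "Suc k" "k + h"] h_pos by auto

lemma Fil_step: "Fil k = msum (Fil (Suc k)) (O_span D {e i k | i. i < l})"
proof
  have "{e i j | i j. i < l \<and> k \<le> j} \<subseteq> msum (Fil (Suc k)) (O_span D {e i k | i. i < l})"
  proof
    fix x assume "x \<in> {e i j | i j. i < l \<and> k \<le> j}"
    then obtain i j where ij: "i < l" "k \<le> j" "x = e i j" by blast
    show "x \<in> msum (Fil (Suc k)) (O_span D {e i k | i. i < l})"
    proof (cases "j = k")
      case True
      then have "x \<in> O_span D {e i k | i. i < l}" using ij by (auto intro: O_span_inc)
      then show ?thesis using msum_ge2[OF sub_Fil] by blast
    next
      case False
      then have "x \<in> Fil (Suc k)" using ij by (auto intro: e_Fil)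
      then show ?thesis using msum_ge1[OF sub_O_span] by blast
    qed
  qed
  then show "Fil k \<subseteq> msum (Fil (Suc k)) (O_span D {e i k | i. i < l})"
    unfolding Fil_def[of k] by (intro O_span_min sub_msum sub_Fil sub_O_span)
  show "msum (Fil (Suc k)) (O_span D {e i k | i. i < l}) \<subseteq> Fil k"
    by (intro msum_le sub_Fil O_span_min Fil_antimono) (auto intro: e_Fil)
qed

lemma finite_e: "finite {e i k | i. i < l}"
  by simp

lemma len_Fil_Suc: "\<exists>n. len (Fil k) (Fil (Suc k)) n"
  using len_ex_finite[OF finite_e sub_Fil[of "Suc k"], of k] Fil_step[of k]
  by (auto intro!: eps_mem_Fil1 e_Fil)

lemma len_Fil_add: "\<exists>n. len (Fil k) (Fil (k + d)) n"
proof (induction d)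
  case 0
  then show ?case using len_refl[OF sub_Fil] by auto
next
  case (Suc d)
  then show ?case using len_Fil_Suc[of "k + d"] len_trans by (metis add_Suc_right)
qed

lemma len_Fil: "k \<le> k' \<Longrightarrow> \<exists>n. len (Fil k) (Fil k') n"
  using len_Fil_add[of k "k' - k"] by simp

text \<open>Indices beyond the window reduce to smaller ones by e_{i,j+h} = \<epsilon>e_{i,j}. It
  yields finite generating sets for \<open>Fil\<close> and \<open>EL\<close>, as Nakayama
  requires.\<close>

lemma e_window:
  assumes i: "i < l" and S: "is_sub S" "\<And>j. k \<le> j \<Longrightarrow> j < k + h \<Longrightarrow> e i j \<in> S"
  shows "k \<le> j \<Longrightarrow> e i j \<in> S"
proof (induction j rule: less_induct)
  case (less j)
  show ?case
  proof (cases "j < k + h")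
    case False
    then have "e i (j - h) \<in> S" using less h_pos by auto
    then show ?thesis using e_h[OF i, of "j - h"] False sub_eps[OF S(1)] by auto
  qed (use less S in auto)
qed

lemma Fil_fin: "Fil k = O_span D ((\<lambda>(i, j). e i j) ` ({..<l} \<times> {k..<k + h}))"
proof
  show "Fil k \<subseteq> O_span D ((\<lambda>(i, j). e i j) ` ({..<l} \<times> {k..<k + h}))"
    unfolding Fil_def
  proof (intro O_span_min sub_O_span subsetI)
    fix x assume "x \<in> {e i j | i j. i < l \<and> k \<le> j}"
    then obtain i j where ij: "i < l" "k \<le> j" "x = e i j" by blast
    show "x \<in> O_span D ((\<lambda>(i, j). e i j) ` ({..<l} \<times> {k..<k + h}))"
      unfolding ij(3)
    proof (rule e_window[OF ij(1) sub_O_span _ ij(2)])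
      fix j' assume "k \<le> j'" "j' < k + h"
      then have "(i, j') \<in> {..<l} \<times> {k..<k + h}" using ij(1) by simp
      then have "(\<lambda>(i, j). e i j) (i, j') \<in> (\<lambda>(i, j). e i j) ` ({..<l} \<times> {k..<k + h})" by (rule imageI)
      then show "e i j' \<in> O_span D ((\<lambda>(i, j). e i j) ` ({..<l} \<times> {k..<k + h}))"
        unfolding prod.case by (rule O_span_inc)
    qed
  qed
  show "O_span D ((\<lambda>(i, j). e i j) ` ({..<l} \<times> {k..<k + h})) \<subseteq> Fil k"
    by (intro O_span_min sub_Fil) (auto intro: e_Fil)
qed


section \<open>Linear independence of the e_{i,j} and coordinates\<close>

lemma e_nz: "i < l \<Longrightarrow> e i j \<noteq> 0"
proof -
  assume i: "i < l"
  have "(tau1 D ^^ j) (gen D i) \<noteq> (tau1 D ^^ j) 0"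
    unfolding semilin_inj[OF semilin_funpow[OF semilin_tau1]] using gen_nz[OF i] .
  then show ?thesis unfolding semilin_0[OF semilin_funpow[OF semilin_tau1]] evec_def .
qed

definition EL :: "nat \<Rightarrow> nat \<Rightarrow> 'n set" where
  "EL i k = O_span D (e i ` {k..})"

lemma EL_fin: "i < l \<Longrightarrow> EL i k = O_span D (e i ` {k..<k + h})"
proof
  assume i: "i < l"
  show "EL i k \<subseteq> O_span D (e i ` {k..<k + h})"
    unfolding EL_def
  proof (intro O_span_min sub_O_span subsetI)
    fix x assume "x \<in> e i ` {k..}"
    then obtain j where j: "k \<le> j" "x = e i j" by auto
    show "x \<in> O_span D (e i ` {k..<k + h})"
      unfolding j(2) by (rule e_window[OF i sub_O_span _ j(1)]) (auto intro!: O_span_inc)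
  qed
  show "O_span D (e i ` {k..<k + h}) \<subseteq> EL i k"
    unfolding EL_def by (rule O_span_mono) auto
qed

lemma tau1_EL: "tau1 D ` EL i k = EL i (Suc k)"
proof -
  have "tau1 D ` (e i ` {k..}) = e i ` (Suc ` {k..})" by (simp add: image_image tau1_e)
  also have "Suc ` {k..} = {Suc k..}" 
  proof (intro subset_antisym subsetI)
    fix x assume "x \<in> {Suc k..}"
    then show "x \<in> Suc ` {k..}" by (intro image_eqI[of _ _ "x - 1"]) auto
  qed auto
  finally show ?thesis unfolding EL_def O_span_image[OF semilin_tau1] by simp
qed

text \<open>Otherwise \<open>EL i\<close> would not change from k to k + 1, hence, after shifting by
  tau_1, not from k to k + h. There it has been multiplied by \<epsilon>, so Nakayama would make it
  zero.\<close>

lemma e_not_in_EL: assumes i: "i < l" shows "e i k \<notin> EL i (Suc k)"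
proof
  assume k: "e i k \<in> EL i (Suc k)"
  have step: "EL i k = EL i (Suc k)"
  proof
    have "{k..} = insert k {Suc k..}" by auto
    then have "e i ` {k..} \<subseteq> EL i (Suc k)" using k unfolding EL_def by (auto intro: O_span_inc)
    then show "EL i k \<subseteq> EL i (Suc k)" unfolding EL_def[of i k] EL_def[of i "Suc k"]
      by (intro O_span_min sub_O_span)
    show "EL i (Suc k) \<subseteq> EL i k" unfolding EL_def by (rule O_span_mono) auto
  qed
  have "EL i (k + n) = EL i (k + Suc n)" for n
  proof (induction n)
    case (Suc n)
    have "tau1 D ` EL i (k + n) = tau1 D ` EL i (k + Suc n)" using Suc by simp
    then show ?case unfolding tau1_EL by simp
  qed (use step in simp)
  then have "EL i k = EL i (k + n)" for n by (induction n) auto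
  then have kh: "EL i k = EL i (k + h)" .
  have "EL i (k + h) = (\<lambda>x. \<epsilon> *s x) ` EL i k"
  proof -
    have "(\<lambda>x. \<epsilon> *s x) ` (e i ` {k..}) = e i ` ((\<lambda>j. j + h) ` {k..})"
      by (simp add: image_image e_h[OF i])
    also have "(\<lambda>j. j + h) ` {k..} = {k + h..}"
    proof (intro subset_antisym subsetI)
      fix x assume "x \<in> {k + h..}"
      then show "x \<in> (\<lambda>j. j + h) ` {k..}" by (intro image_eqI[of _ _ "x - h"]) auto
    qed auto
    finally show ?thesis unfolding EL_def O_span_image[OF semilin_smul[OF eps_nz]] by simp
  qed
  then have "\<exists>s\<in>EL i k. x = 0 + \<epsilon> *s s" if "x \<in> EL i k" for x
    using that kh by auto
  then have "EL i k \<subseteq> {0}"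
    by (intro nakayama_span[OF _ _ EL_fin[OF i]]) (auto intro: subI)
  moreover have "e i k \<in> EL i k" unfolding EL_def by (auto intro: O_span_inc)
  ultimately show False using e_nz[OF i] by blast
qed

text \<open>Up to a unit, x e_{i,j} is e_{i,n} with n = j + h val(x). The valuation may be negative
  as long as n is at least k.\<close>

lemma scaled_e_in_EL:
  assumes i: "i < l" and k: "int k \<le> int j + val D x * int h" and x: "x \<noteq> 0"
  shows "x *s e i j \<in> EL i k"
proof -
  obtain u where u: "is_unit_OO u" "x = \<epsilon> powi (val D x) * u" using decompose_val[OF x] by blast
  define n where "n = nat (int j + val D x * int h)"
  have n: "int n = int j + val D x * int h" "k \<le> n" using k unfolding n_def by auto
  have "\<epsilon> powi (val D x) *s e i j = e i n"
  proof (cases "val D x \<ge> 0")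
    case True
    then have "n = j + nat (val D x) * h" using n(1) by (simp add: n_def nat_add_distrib nat_mult_distrib)
    then show ?thesis using e_mult_h[OF i, of j "nat (val D x)"] True by (simp add: power_int_def)
  next
    case False
    let ?v = "nat (- val D x)"
    have "int j = int (n + ?v * h)" using n(1) False by simp
    then have "j = n + ?v * h" by (simp only: of_nat_eq_iff)
    then show ?thesis using e_mult_h[OF i, of n ?v] False by (simp add: power_int_def power_inverse)
  qed
  moreover have "x *s e i j = u *s (\<epsilon> powi (val D x) *s e i j)"
    using u(2) by (metis N.scale_scale mult.commute)
  ultimately have "x *s e i j = u *s e i n" by simp
  moreover have "e i n \<in> EL i k" using n(2) unfolding EL_def by (auto intro: O_span_inc)
  moreover have "is_sub (EL i k)" unfolding EL_def by (rule sub_O_span)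
  moreover have "u \<in> \<O>" using u(1) unfolding is_unit_OO_def by blast
  ultimately show ?thesis using sub_scale by metis
qed

text \<open>The values \<open>j + h * val (c j)\<close> are pairwise distinct, so a nontrivial relation would
  express the vector of least value by vectors of larger index.\<close>

lemma e_indep_single:
  assumes i: "i < l" and rel: "(\<Sum>j<h. c j *s e i j) = 0" and j: "j < h"
  shows "c j = 0"
proof (rule ccontr)
  assume "c j \<noteq> 0"
  define S where "S = {j. j < h \<and> c j \<noteq> 0}"
  define w where "w = (\<lambda>j. int j + val D (c j) * int h)"
  have S: "finite S" "S \<noteq> {}" using j \<open>c j \<noteq> 0\<close> unfolding S_def by auto
  obtain j0 where j0: "j0 \<in> S" "\<And>j. j \<in> S \<Longrightarrow> w j0 \<le> w j"
    using arg_min_if_finite[OF S, of w] by (metis not_le)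
  have inj: "w j0 < w j'" if "j' \<in> S" "j' \<noteq> j0" for j'
  proof -
    have "w j0 \<noteq> w j'"
    proof
      assume "w j0 = w j'"
      then have "w j0 mod int h = w j' mod int h" by simp
      then have "j0 = j'" using j0(1) that(1) unfolding w_def S_def by simp
      then show False using that by simp
    qed
    then show ?thesis using j0(2)[OF that(1)] by simp
  qed
  have c0: "c j0 \<noteq> 0" "j0 < h" using j0 unfolding S_def by auto
  have "(\<Sum>j<h. c j *s e i j) = c j0 *s e i j0 + (\<Sum>j\<in>{..<h} - {j0}. c j *s e i j)"
    using c0 by (simp add: sum.remove[of _ j0])
  then have "c j0 *s e i j0 = - (\<Sum>j\<in>{..<h} - {j0}. c j *s e i j)"
    using rel by (simp add: eq_neg_iff_add_eq_0)
  then have "inverse (c j0) *s (c j0 *s e i j0) = inverse (c j0) *s (- (\<Sum>j\<in>{..<h} - {j0}. c j *s e i j))"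
    by (rule arg_cong)
  then have "e i j0 = - (\<Sum>j\<in>{..<h} - {j0}. (inverse (c j0) * c j) *s e i j)"
    using c0 by (simp add: N.scale_sum_right)
  moreover have "(\<Sum>j\<in>{..<h} - {j0}. (inverse (c j0) * c j) *s e i j) \<in> EL i (Suc j0)"
  proof (intro sub_sum)
    show EL: "is_sub (EL i (Suc j0))" unfolding EL_def by (rule sub_O_span)
    fix j' assume j': "j' \<in> {..<h} - {j0}"
    show "(inverse (c j0) * c j') *s e i j' \<in> EL i (Suc j0)"
    proof (cases "c j' = 0")
      case True
      then show ?thesis using sub_0[OF EL] by simp
    next
      case False
      then have "w j0 < w j'" using j' inj unfolding S_def by simp
      then have "int (Suc j0) \<le> int j' + val D (inverse (c j0) * c j') * int h"
        using False c0 by (simp add: w_def val_mult val_inverse algebra_simps)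
      then show ?thesis using False c0 by (intro scaled_e_in_EL[OF i]) auto
    qed
  qed
  ultimately have "e i j0 \<in> EL i (Suc j0)" using sub_minus[of "EL i (Suc j0)"] unfolding EL_def
    by (metis sub_O_span)
  then show False using e_not_in_EL[OF i] by blast
qed

lemma semilin_subspace: 
  assumes "T = Phi D" "N.subspace U" shows "N.subspace (T ` U)"
proof (rule N.subspaceI)
  show "0 \<in> T ` U" using semilin_0[OF semilin_Phi] N.subspace_0[OF assms(2)] assms(1) by (metis imageI)
  show "x + y \<in> T ` U" if "x \<in> T ` U" "y \<in> T ` U" for x y
    using that N.subspace_add[OF assms(2)] assms(1) by (auto simp flip: Phi_add)
  show "c *s x \<in> T ` U" if "x \<in> T ` U" for c x
  proof -
    obtain d where d: "c = frob D d" using bij_frob by (metis bij_pointE)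
    then show ?thesis using that N.subspace_scale[OF assms(2)] assms(1) by (auto simp flip: Phi_scale)
  qed
qed

lemma subspace_window:
  assumes i: "i < l" and S: "N.subspace S" "\<And>j. j < h \<Longrightarrow> e i j \<in> S"
  shows "e i j \<in> S"
proof (induction j rule: less_induct)
  case (less j)
  show ?case
  proof (cases "j < h")
    case False
    then have "e i (j - h) \<in> S" using less h_pos by auto
    then show ?thesis using e_h[OF i, of "j - h"] False N.subspace_scale[OF S(1)] by auto
  qed (use S in auto)
qed

lemma comp_simple: "i < l \<Longrightarrow> simple_subisocrystal D (comp D i)"
  using decomposition unfolding simple_decomposition_def by blast

lemma comp_subspace: "i < l \<Longrightarrow> N.subspace (comp D i)" and comp_Phi: "i < l \<Longrightarrow> Phi D ` comp D i = comp D i"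
  using comp_simple unfolding simple_subisocrystal_def subisocrystal_def by blast+

lemma e_comp: "i < l \<Longrightarrow> e i j \<in> comp D i"
proof -
  assume i: "i < l"
  have Phi: "(Phi D ^^ n) x \<in> comp D i" if "x \<in> comp D i" for n x
    using that comp_Phi[OF i] by (induction n) auto
  show ?thesis
  proof (induction j)
    case 0
    then show ?case using gen_comp[OF i] by (simp add: evec_def)
  next
    case (Suc j)
    then show ?case
      unfolding tau1_e[symmetric] tau1_def by (intro Phi N.subspace_scale[OF comp_subspace[OF i]])
  qed
qed

text \<open>The span is a nonzero subisocrystal of N_i, so simplicity makes it all of N_i. It is
  contained in its image under Phi because e_{i,j} = Phi(\<epsilon>^(-1) e_{i,j+h-m}).\<close>

lemma comp_span: assumes i: "i < l" shows "N.span (e i ` {..<h}) = comp D i"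
proof -
  let ?U = "N.span (e i ` {..<h})"
  have eU: "e i j \<in> ?U" for j
    by (rule subspace_window[OF i N.subspace_span]) (auto intro: N.span_base)
  have "subisocrystal D ?U"
    unfolding subisocrystal_def
  proof (intro conjI subset_antisym)
    show "N.subspace ?U" by (rule N.subspace_span)
    have "N.subspace {x. Phi D x \<in> ?U}"
      by (rule N.subspaceI) (auto simp: Phi_add Phi_scale semilin_0[OF semilin_Phi] N.span_zero N.span_add N.span_scale)
    then have "?U \<subseteq> {x. Phi D x \<in> ?U}" using eU by (intro N.span_minimal) (auto simp: Phi_e[OF i])
    then show "Phi D ` ?U \<subseteq> ?U" by blast
    show "?U \<subseteq> Phi D ` ?U"
    proof (rule N.span_minimal[OF _ semilin_subspace[OF refl N.subspace_span]])
      show "e i ` {..<h} \<subseteq> Phi D ` ?U"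
      proof
        fix x assume "x \<in> e i ` {..<h}"
        then obtain j where x: "x = e i j" by blast
        have "Phi D (\<epsilon> powi (-1) *s e i (j + h - m)) = \<epsilon> powi (-1) *s e i (j + h)"
          unfolding semilin_eps_powi[OF semilin_Phi] using m_le_h by (simp add: Phi_e[OF i])
        also have "\<dots> = x" unfolding e_h[OF i] x by (simp add: power_int_minus)
        finally show "x \<in> Phi D ` ?U" using eU N.span_scale by (metis imageI)
      qed
    qed
  qed
  moreover have "?U \<subseteq> comp D i" using e_comp[OF i] by (intro N.span_minimal comp_subspace i) auto
  moreover have "?U \<noteq> {0}" using eU e_nz[OF i] by blast
  ultimately show ?thesis using comp_simple[OF i] unfolding simple_subisocrystal_def by blast
qed

abbreviation "bv \<equiv> basis_vec D"

lemma sum_rk: "(\<Sum>t<rk D. f (t div h) (t mod h)) = (\<Sum>i<l. \<Sum>j<h. f i j)" for f :: "nat \<Rightarrow> nat \<Rightarrow> 'x::comm_monoid_add"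
proof -
  have "(\<Sum>t<rk D. f (t div h) (t mod h)) = (\<Sum>i<l. \<Sum>t\<in>{i * h..<i * h + h}. f (t div h) (t mod h))"
    unfolding rk_def by (rule sum.nat_group[symmetric])
  also have "\<dots> = (\<Sum>i<l. \<Sum>j<h. f i j)"
  proof (rule sum.cong[OF refl])
    fix i
    have "(\<Sum>t\<in>{i * h..<i * h + h}. f (t div h) (t mod h)) = (\<Sum>j<h. f ((j + i * h) div h) ((j + i * h) mod h))"
      using sum.shift_bounds_nat_ivl[of "\<lambda>t. f (t div h) (t mod h)" 0 "i * h" h]
      by (simp add: atLeast0LessThan add.commute)
    also have "\<dots> = (\<Sum>j<h. f i j)" by (rule sum.cong) auto
    finally show "(\<Sum>t\<in>{i * h..<i * h + h}. f (t div h) (t mod h)) = (\<Sum>j<h. f i j)" .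
  qed
  finally show ?thesis .
qed

lemma rk_index: "t < rk D \<Longrightarrow> t div h < l \<and> t mod h < h"
  unfolding rk_def using h_pos by (auto simp: less_mult_imp_div_less)

lemma index_rk: "i < l \<Longrightarrow> j < h \<Longrightarrow> i * h + j < rk D"
proof -
  assume "i < l" "j < h"
  then have "i * h + j < Suc i * h" "Suc i * h \<le> l * h" using mult_le_mono1[of "Suc i" l h] by auto
  then show ?thesis unfolding rk_def by linarith
qed

lemma bv_index: "j < h \<Longrightarrow> bv (i * h + j) = e i j"
  unfolding basis_vec_def by simp

lemma rk_pos: "0 < rk D"
  using h_pos ncomp_pos by (simp add: rk_def)

lemma comp_direct: "(\<And>i. i < l \<Longrightarrow> y i \<in> comp D i) \<Longrightarrow> (\<Sum>i<l. y i) = 0 \<Longrightarrow> i < l \<Longrightarrow> y i = 0"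
  using decomposition unfolding simple_decomposition_def by blast

lemma bv_indep:
  assumes "(\<Sum>t<rk D. c t *s bv t) = 0" "t < rk D"
  shows "c t = 0"
proof -
  have "(\<Sum>t<rk D. c t *s bv t) = (\<Sum>t<rk D. (\<lambda>i j. c (i * h + j) *s e i j) (t div h) (t mod h))"
    unfolding basis_vec_def by (intro sum.cong refl) (simp only: div_mult_mod_eq)
  also have "\<dots> = (\<Sum>i<l. \<Sum>j<h. c (i * h + j) *s e i j)" by (rule sum_rk)
  finally have "(\<Sum>i<l. \<Sum>j<h. c (i * h + j) *s e i j) = 0" using assms(1) by simp
  then have "(\<Sum>j<h. c (i * h + j) *s e i j) = 0" if "i < l" for i
    using that by (intro comp_direct[of "\<lambda>i. \<Sum>j<h. c (i * h + j) *s e i j"])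
      (auto intro!: N.subspace_sum N.subspace_scale comp_subspace e_comp)
  then have "c (t div h * h + t mod h) = 0"
    using rk_index[OF assms(2)] e_indep_single[of "t div h" "\<lambda>j. c (t div h * h + j)" "t mod h"] by simp
  then show ?thesis by simp
qed

lemma inj_bv: "inj_on bv {..<rk D}"
proof (rule inj_onI, rule ccontr)
  fix s t assume *: "s \<in> {..<rk D}" "t \<in> {..<rk D}" "bv s = bv t" "s \<noteq> t"
  let ?c = "\<lambda>r. if r = s then 1 else if r = t then -1 else 0 :: 'a"
  have "(\<Sum>r<rk D. ?c r *s bv r) = (\<Sum>r\<in>{s, t}. ?c r *s bv r)"
    using * by (intro sum.mono_neutral_right) auto
  also have "\<dots> = 0" using * by simp
  finally have "?c s = 0" by (rule bv_indep[of ?c s]) (use * in auto)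
  then show False by simp
qed

lemma bv_independent: "N.independent (bv ` {..<rk D})"
proof (rule N.independent_if_scalars_zero)
  fix f x assume f: "(\<Sum>v\<in>bv ` {..<rk D}. f v *s v) = 0" and "x \<in> bv ` {..<rk D}"
  then obtain t where "x = bv t" "t < rk D" by auto
  moreover have "(\<Sum>t<rk D. f (bv t) *s bv t) = 0" using f by (simp add: sum.reindex[OF inj_bv])
  ultimately show "f x = 0" using bv_indep by metis
qed simp

lemma bv_span: "N.span (bv ` {..<rk D}) = UNIV"
proof -
  let ?U = "N.span (bv ` {..<rk D})"
  have sub: "comp D i \<subseteq> ?U" if "i < l" for i
    unfolding comp_span[OF that, symmetric]
  proof (rule N.span_mono)
    show "e i ` {..<h} \<subseteq> bv ` {..<rk D}"
      using bv_index index_rk[OF that] by (auto simp flip: bv_index)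
  qed
  have "x \<in> ?U" for x
  proof -
    obtain y where y: "\<forall>i<l. y i \<in> comp D i" "x = (\<Sum>i<l. y i)"
      using decomposition unfolding simple_decomposition_def by blast
    show ?thesis unfolding y(2) using y(1) sub by (intro N.span_sum) blast
  qed
  then show ?thesis by blast
qed

abbreviation crd where "crd \<equiv> coord D"

lemma coord_sum: "(\<Sum>t<rk D. crd x t *s bv t) = x"
proof -
  have "(\<Sum>b\<in>bv ` {..<rk D}. N.representation (bv ` {..<rk D}) x b *s b) = x"
    using bv_span by (intro N.sum_representation_eq bv_independent) auto
  then show ?thesis by (simp add: sum.reindex[OF inj_bv] coord_def)
qed

lemma coord_unique:
  assumes "x = (\<Sum>t<rk D. c t *s bv t)" "t < rk D"
  shows "crd x t = c t"
proof -
  have "(\<Sum>t<rk D. (crd x t - c t) *s bv t) = 0"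
    using coord_sum[of x] assms(1) by (simp add: N.scale_left_diff_distrib sum_subtractf)
  then show ?thesis using bv_indep[OF _ assms(2)] by fastforce
qed

lemma coord_add: "t < rk D \<Longrightarrow> crd (x + y) t = crd x t + crd y t"
  by (rule coord_unique) (simp_all add: N.scale_left_distrib sum.distrib coord_sum)

lemma coord_scale: "t < rk D \<Longrightarrow> crd (c *s x) t = c * crd x t"
  by (rule coord_unique) (simp_all add: coord_sum flip: N.scale_scale N.scale_sum_right)

lemma coord_bv: "s < rk D \<Longrightarrow> t < rk D \<Longrightarrow> crd (bv s) t = (if s = t then 1 else 0)"
proof (rule coord_unique)
  assume s: "s < rk D"
  have "(\<Sum>t<rk D. (if s = t then 1 else 0) *s bv t) = (\<Sum>t\<in>{s}. (if s = t then 1 else 0) *s bv t)"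
    using s by (intro sum.mono_neutral_right) auto
  then show "bv s = (\<Sum>t<rk D. (if s = t then 1 else 0) *s bv t)" by simp
qed

lemma coord_eqI: "(\<And>t. t < rk D \<Longrightarrow> crd x t = crd y t) \<Longrightarrow> x = y"
  using coord_sum[of x] coord_sum[of y] by (metis (no_types, lifting) lessThan_iff sum.cong)

lemma bv_M0: "t < rk D \<Longrightarrow> bv t \<in> M0 D"
  unfolding M0_eq basis_vec_def using rk_index by (auto intro: e_Fil)

lemma M0_span: "M0 D = O_span D (bv ` {..<rk D})"
proof
  show "O_span D (bv ` {..<rk D}) \<subseteq> M0 D"
    using bv_M0 unfolding M0_eq by (intro O_span_min sub_Fil) auto
  show "M0 D \<subseteq> O_span D (bv ` {..<rk D})"
    unfolding M0_eq Fil_fin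
  proof (rule O_span_mono)
    show "(\<lambda>(i, j). e i j) ` ({..<l} \<times> {0..<0 + h}) \<subseteq> bv ` {..<rk D}"
      using index_rk bv_index by (auto simp flip: bv_index)
  qed
qed

lemma M0_iff: "x \<in> M0 D \<longleftrightarrow> (\<forall>t<rk D. crd x t \<in> \<O>)"
proof
  assume "x \<in> M0 D"
  moreover have "is_sub {x. \<forall>t<rk D. crd x t \<in> \<O>}"
    by (rule subI) (auto simp: coord_add coord_scale OO_add OO_mult, metis N.scale_zero_left coord_scale mult_zero_left OO_0)
  moreover have "bv ` {..<rk D} \<subseteq> {x. \<forall>t<rk D. crd x t \<in> \<O>}" by (auto simp: coord_bv)
  ultimately show "\<forall>t<rk D. crd x t \<in> \<O>" unfolding M0_span using O_span_min by blast
next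
  assume "\<forall>t<rk D. crd x t \<in> \<O>"
  then have "(\<Sum>t<rk D. crd x t *s bv t) \<in> M0 D"
    unfolding M0_eq by (intro sub_sum sub_scale sub_Fil) (use bv_M0 in \<open>auto simp: M0_eq\<close>)
  then show "x \<in> M0 D" by (simp add: coord_sum)
qed

end

subsection \<open>Counting monomials of a given level\<close>

definition cnt :: "nat \<Rightarrow> nat \<Rightarrow> nat \<Rightarrow> nat" where
  "cnt p q k = card {(a, b). a * p + b * q = k}"

text \<open>By coprimality, solutions differ by multiples of (q, -p). Starting from the solution
  with the least a, they form a single progression, which ends when b can no longer be lowered by
  p.\<close>

lemma solutions_param:
  assumes pq: "0 < p" "0 < q" "coprime p q"
  shows "\<exists>a0 b0. (\<forall>s<cnt p q k. s * p \<le> b0 \<and> (a0 + s * q) * p + (b0 - s * p) * q = k) \<and>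
     (\<forall>a b. a * p + b * q = k \<longrightarrow> (\<exists>s<cnt p q k. a = a0 + s * q \<and> b = b0 - s * p))"
proof (cases "\<exists>a b. a * p + b * q = k")
  case False
  then have "cnt p q k = 0" unfolding cnt_def by auto
  then show ?thesis using False by auto
next
  case True
  define a0 where "a0 = (LEAST a. \<exists>b. a * p + b * q = k)"
  have "\<exists>b. a0 * p + b * q = k" unfolding a0_def by (rule LeastI_ex[OF True])
  then obtain b0 where b0: "a0 * p + b0 * q = k" by blast
  let ?f = "\<lambda>s. (a0 + s * q, b0 - s * p)"
  have sol: "s * p \<le> b0 \<and> (a0 + s * q) * p + (b0 - s * p) * q = k" if "s \<le> b0 div p" for s
  proof -
    have le: "s * p \<le> b0" using that pq(1) by (simp add: less_eq_div_iff_mult_less_eq)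
    then obtain c where "b0 = s * p + c" using le_Suc_ex by blast
    then show ?thesis using b0 by (auto simp: algebra_simps)
  qed
  have param: "\<exists>s\<le>b0 div p. a = a0 + s * q \<and> b = b0 - s * p" if ab: "a * p + b * q = k" for a b
  proof -
    have "a0 \<le> a" unfolding a0_def using ab by (intro Least_le) blast
    then obtain d where d: "a = a0 + d" using le_Suc_ex by blast
    have eq: "d * p + b * q = b0 * q" using ab b0 unfolding d by (simp add: algebra_simps)
    then have "b * q \<le> b0 * q" by linarith
    then have "b \<le> b0" using pq(2) by simp
    then obtain c where c: "b0 = b + c" using le_Suc_ex by blast
    have dc: "d * p = c * q" using eq unfolding c by (simp add: algebra_simps)
    then have "q dvd d * p" by simp
    then have "q dvd d" using pq(3) by (simp add: coprime_dvd_mult_left_iff coprime_commute)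
    then obtain s where s: "d = s * q" by (metis dvdE mult.commute)
    have "c = s * p" using dc pq(2) unfolding s by simp
    then have "s \<le> b0 div p" using c pq(1) by (simp add: less_eq_div_iff_mult_less_eq)
    then show ?thesis using s d c \<open>c = s * p\<close> by auto
  qed
  have set: "{(a, b). a * p + b * q = k} = ?f ` {..b0 div p}"
    using sol param by (auto simp: image_iff) blast
  have "inj_on ?f {..b0 div p}" using pq by (intro inj_onI) auto
  then have "cnt p q k = Suc (b0 div p)" unfolding cnt_def set by (simp add: card_image)
  then show ?thesis using sol param by (intro exI[of _ a0] exI[of _ b0]) (auto simp: less_Suc_eq_le)
qed

text \<open>With more than r solutions, the one numbered r (counting from 0) has a \<ge> rq, and
  already ap \<ge> rpq.\<close>

lemma cnt_level: assumes pq: "0 < p" "0 < q" "coprime p q" and "r < cnt p q k"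
  shows "r * p * q \<le> k"
proof -
  obtain a0 b0 where "r * p \<le> b0 \<and> (a0 + r * q) * p + (b0 - r * p) * q = k"
    using solutions_param[OF pq, of k] assms(4) by blast
  moreover have "r * p * q \<le> (a0 + r * q) * p + (b0 - r * p) * q" by (simp add: algebra_simps)
  ultimately show ?thesis by linarith
qed

lemma finite_solutions: "0 < p \<Longrightarrow> 0 < q \<Longrightarrow> finite {(a, b). a * p + b * q = (k :: nat)}"
proof (rule finite_subset[of _ "{..k} \<times> {..k}"])
  assume pq: "0 < p" "0 < q"
  have "a \<le> a * p" "b \<le> b * q" for a b using pq by auto
  then show "{(a, b). a * p + b * q = k} \<subseteq> {..k} \<times> {..k}" by (auto intro: order_trans trans_le_add1 trans_le_add2)
qed simp

text \<open>Start with the solution having 0 \<le> a < q. Then bq = k - ap exceeds (r-1)pq, so p can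
  be taken from b at least r - 1 times.\<close>

lemma cnt_large: assumes pq: "0 < p" "0 < q" "coprime p q" and k: "r * p * q \<le> k"
  shows "r \<le> cnt p q k"
proof (cases r)
  case (Suc r')
  obtain u y where uy: "p * u = q * y + 1" using bezout_nat[of p q] pq by auto
  \<comment> \<open>The residue modulo q with ap congruent to k, obtained from the inverse u of p
    modulo q.\<close>
  define a where "a = (k * u) mod q"
  have "(a * p) mod q = (k * (p * u)) mod q" unfolding a_def by (simp add: mod_simps ac_simps)
  also have "\<dots> = (k * 1 + q * (k * y)) mod q" unfolding uy by (simp add: algebra_simps)
  also have "\<dots> = k mod q" by simp
  finally have am: "(a * p) mod q = k mod q" .
  have "a < q" unfolding a_def using pq by simp
  then have apq: "a * p < q * p" using pq by simp
  have kk: "r' * p * q + p * q \<le> k" using k Suc by (simp add: algebra_simps)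
  then have ak: "a * p \<le> k" using apq mult.commute[of q p] by linarith
  then have "q dvd k - a * p" using am by (metis mod_eq_dvd_iff_nat)
  then obtain b where b: "k - a * p = q * b" by (rule dvdE)
  have "k = a * p + b * q" using b ak by (simp add: mult.commute)
  then have "r' * p * q \<le> b * q" using kk apq mult.commute[of q p] by linarith
  then have b': "r' * p \<le> b" using pq by simp
  have "(\<lambda>s. (a + s * q, b - s * p)) ` {..r'} \<subseteq> {(a, b). a * p + b * q = k}"
  proof clarify
    fix s assume "s \<le> r'"
    then have "s * p \<le> b" using b' mult_le_mono1[of s r' p] by linarith
    then obtain c where "b = s * p + c" using le_Suc_ex by blast
    then show "(a + s * q) * p + (b - s * p) * q = k" using b ak by (simp add: algebra_simps)
  qed
  then have "card ((\<lambda>s. (a + s * q, b - s * p)) ` {..r'}) \<le> cnt p q k"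
    unfolding cnt_def using finite_solutions[OF pq(1,2)] by (intro card_mono)
  moreover have "inj_on (\<lambda>s. (a + s * q, b - s * p)) {..r'}" using pq by (intro inj_onI) auto
  ultimately show ?thesis using Suc by (simp add: card_image)
qed simp

text \<open>The loss of one is real: for p = 2 and q = 3 level 6 has two solutions and level 7 has
  one.\<close>

lemma cnt_mono: "0 < p \<Longrightarrow> 0 < q \<Longrightarrow> coprime p q \<Longrightarrow> r < cnt p q k0 \<Longrightarrow> k0 \<le> k \<Longrightarrow> r \<le> cnt p q k"
  by (rule cnt_large) (use cnt_level[of p q r k0] in auto)

section \<open>Monomials in Phi and V\<close>

locale nondegenerate_isocrystal = decomposed_isocrystal D
  for D :: "('a::field, 'k::{field,finite}, 'n::ab_group_add) decomposed_data" +
  assumes m_pos: "0 < slope_m D" and m_less: "slope_m D < slope_h D"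
begin

abbreviation "ct \<equiv> cnt m (h - m)"

lemma pq: "0 < m" "0 < h - m" "coprime m (h - m)"
  using m_pos m_less coprime_mh by (auto simp: coprime_diff_one_left) (metis coprime_iff_gcd_eq_1 gcd_diff1_nat gcd.commute less_or_eq_imp_le)

definition mon :: "'n \<Rightarrow> nat \<Rightarrow> nat \<Rightarrow> 'n" where
  "mon v a b = (Phi D ^^ a) ((Ver D ^^ b) v)"

text \<open>\<open>Dl v 0\<close> is the module generated by \<open>v\<close> over the ring
  generated by Phi and V. The index is the level that \<open>mon_Fil\<close> assigns to a monomial,
  which makes \<open>Dl v k\<close> comparable with \<open>Fil k\<close>.\<close>

definition Dl :: "'n \<Rightarrow> nat \<Rightarrow> 'n set" where
  "Dl v k = O_span D {mon v a b | a b. k \<le> a * m + b * (h - m)}"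

text \<open>In terms of the identification of \<open>Fil 0 / Fil 1\<close> with the space of \<open>l\<close>-tuples over the residue
  field, the coordinates of a good \<open>v\<close> are linearly independent over the subfield with \<open>q ^ h\<close>
  elements.\<close>

definition good :: "'n \<Rightarrow> bool" where
  "good v \<longleftrightarrow> v \<in> Fil 0 \<and>
     (\<forall>P'. is_sub P' \<longrightarrow> Fil 1 \<subseteq> P' \<longrightarrow> P' \<subseteq> Fil 0 \<longrightarrow> v \<in> P' \<longrightarrow> tau0 D ` P' \<subseteq> P' \<longrightarrow> P' = Fil 0)"

lemmas semilin_Ver_pow = semilin_funpow[OF semilin_Ver]

lemma sub_Dl: "is_sub (Dl v k)"
  unfolding Dl_def by (rule sub_O_span)

lemma mon_Dl: "k \<le> a * m + b * (h - m) \<Longrightarrow> mon v a b \<in> Dl v k"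
  unfolding Dl_def by (rule O_span_inc) blast

lemma Dl_antimono: "k \<le> k' \<Longrightarrow> Dl v k' \<subseteq> Dl v k"
  unfolding Dl_def by (rule O_span_mono) (use le_trans in blast)

lemma Phi_Ver_commute: "Phi D (Ver D x) = Ver D (Phi D x)"
  by (simp add: Phi_Ver Ver_Phi)

lemma Ver_pow_Phi: "Ver D ((Phi D ^^ a) x) = (Phi D ^^ a) (Ver D x)"
  by (induction a) (auto simp flip: Phi_Ver_commute)

lemma Phi_mon: "Phi D (mon v a b) = mon v (Suc a) b"
  and Ver_mon: "Ver D (mon v a b) = mon v a (Suc b)"
  by (simp_all add: mon_def Ver_pow_Phi)

lemma eps_mon: "\<epsilon> *s mon v a b = mon v (Suc a) (Suc b)"
  using Phi_Ver[of "mon v a b"] by (simp add: Phi_mon Ver_mon)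

lemma Ver_tau0: "Ver D (tau0 D x) = tau0 D (Ver D x)"
proof -
  have "Phi D (Ver D (tau0 D x)) = Phi D (tau0 D (Ver D x))"
    unfolding Phi_Ver Phi_tau0 by (simp add: semilin_eps[OF semilin_tau0])
  then show ?thesis using semilin_inj[OF semilin_Phi] by blast
qed

lemma mon_tau0: "mon (tau0 D v) a b = tau0 D (mon v a b)"
proof -
  have "(Ver D ^^ b) (tau0 D v) = tau0 D ((Ver D ^^ b) v)" by (induction b) (auto simp: Ver_tau0)
  then show ?thesis unfolding mon_def by (simp add: Phi_pow_tau0)
qed

lemma Phi_Ver_pow: "(Phi D ^^ k) ((Ver D ^^ k) x) = \<epsilon> ^ k *s x"
proof (induction k arbitrary: x)
  case (Suc k)
  have "(Phi D ^^ Suc k) ((Ver D ^^ Suc k) x) = Phi D ((Phi D ^^ k) ((Ver D ^^ k) (Ver D x)))"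
    by (simp add: funpow_swap1)
  also have "\<dots> = \<epsilon> ^ k *s (\<epsilon> *s x)" unfolding Suc semilin_eps_power[OF semilin_Phi] Phi_Ver ..
  finally show ?case by (simp add: mult.commute)
qed simp

lemma tau0_mon: "tau0 D (mon v a (b + m)) = mon v (a + (h - m)) b"
proof -
  let ?y = "(Ver D ^^ b) v"
  have "mon v a (b + m) = (Phi D ^^ a) ((Ver D ^^ m) ?y)"
    unfolding mon_def by (simp add: funpow_add add.commute[of b])
  then have "tau0 D (mon v a (b + m)) = \<epsilon> powi (- int m) *s (Phi D ^^ (h + a)) ((Ver D ^^ m) ?y)"
    unfolding tau0_alt by (simp add: Phi_pow_add)
  also have "(Phi D ^^ (h + a)) ((Ver D ^^ m) ?y) = (Phi D ^^ (a + (h - m))) ((Phi D ^^ m) ((Ver D ^^ m) ?y))"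
    unfolding Phi_pow_add using m_le_h by (simp add: add.commute)
  also have "\<dots> = \<epsilon> ^ m *s (Phi D ^^ (a + (h - m))) ?y"
    unfolding Phi_Ver_pow by (rule semilin_eps_power[OF semilin_Phi_pow])
  finally show ?thesis unfolding mon_def by (simp add: power_int_minus)
qed

lemma tau0_pow_mon: "s * m \<le> b \<Longrightarrow> (tau0 D ^^ s) (mon v a b) = mon v (a + s * (h - m)) (b - s * m)"
proof (induction s)
  case (Suc s)
  have 1: "b - s * m = (b - Suc s * m) + m" using Suc.prems by simp
  have "(tau0 D ^^ Suc s) (mon v a b) = tau0 D (mon v (a + s * (h - m)) (b - s * m))" using Suc by simp
  also have "\<dots> = mon v (a + s * (h - m) + (h - m)) (b - Suc s * m)"
    by (subst 1) (rule tau0_mon)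
  finally show ?case by (simp only: mult_Suc ac_simps)
qed simp

lemma semilin_mon: "semilin (\<lambda>v. mon v a b)"
  using semilin_comp[OF semilin_Phi_pow[of a] semilin_Ver_pow[of b]] by (simp add: mon_def o_def)

lemma mon_Fil: "(\<lambda>v. mon v a b) ` Fil k = Fil (k + (a * m + b * (h - m)))"
proof -
  have V: "(Ver D ^^ b) ` Fil k = Fil (k + b * (h - m))" for k
  proof (induction b)
    case (Suc b)
    have "(Ver D ^^ Suc b) ` Fil k = Ver D ` ((Ver D ^^ b) ` Fil k)" by (simp add: image_comp)
    then show ?case unfolding Suc Ver_Fil by (simp only: mult_Suc add.assoc add.commute add.left_commute)
  qed simp
  have P: "(Phi D ^^ a) ` Fil k = Fil (k + a * m)" for k
  proof (induction a)
    case (Suc a)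
    have "(Phi D ^^ Suc a) ` Fil k = Phi D ` ((Phi D ^^ a) ` Fil k)" by (simp add: image_comp)
    then show ?case unfolding Suc Phi_Fil by (simp only: mult_Suc add.assoc add.commute add.left_commute)
  qed simp
  have "(\<lambda>v. mon v a b) ` Fil k = (Phi D ^^ a) ` ((Ver D ^^ b) ` Fil k)"
    unfolding mon_def by (simp add: image_image)
  then show ?thesis unfolding V P by (simp only: ac_simps)
qed

lemma mon_mem_Fil: "v \<in> Fil 0 \<Longrightarrow> mon v a b \<in> Fil (a * m + b * (h - m))"
  using mon_Fil[of a b 0] by auto

lemma Dl_Fil: "v \<in> Fil 0 \<Longrightarrow> Dl v k \<subseteq> Fil k"
  unfolding Dl_def by (intro O_span_min sub_Fil) (use mon_mem_Fil Fil_antimono in blast)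

subsection \<open>The length formula\<close>

text \<open>For P = jM_0 the quotient of \<open>Fil k\<close> by \<open>Pk P k\<close> is the k-th
  graded piece of M_0/(M_0 \<inter> P). Its length \<open>rr P k\<close> is the room that P leaves
  at level k.\<close>

definition Pk :: "'n set \<Rightarrow> nat \<Rightarrow> 'n set" where
  "Pk P k = msum (Fil (Suc k)) (P \<inter> Fil k)"

definition rr :: "'n set \<Rightarrow> nat \<Rightarrow> nat" where
  "rr P k = (THE n. len (Fil k) (Pk P k) n)"

section \<open>Levelwise comparison with a submodule stable under tau_0 and tau_1\<close>

context
  fixes P assumes P: "is_sub P" "tau0 D ` P \<subseteq> P" "tau1 D ` P \<subseteq> P"
begin

lemma sub_Pk: "is_sub (Pk P k)"
  unfolding Pk_def by (intro sub_msum sub_Fil sub_Int P)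

lemma Fil_le_Pk: "Fil (Suc k) \<subseteq> Pk P k"
  unfolding Pk_def by (intro msum_ge1 sub_Int P sub_Fil)

lemma Pk_le: "Pk P k \<subseteq> Fil k"
  unfolding Pk_def by (intro msum_le sub_Fil Fil_antimono) auto

lemma Pk_alt: "x \<in> msum (Fil (Suc k)) P \<Longrightarrow> x \<in> Fil k \<Longrightarrow> x \<in> Pk P k"
proof (erule msumE)
  fix f p assume *: "x \<in> Fil k" "x = f + p" "f \<in> Fil (Suc k)" "p \<in> P"
  then have "f \<in> Fil k" using Fil_antimono[of k "Suc k"] by auto
  then have "p \<in> Fil k" using *(1,2) sub_diff[OF sub_Fil *(1)] by (metis add_diff_cancel_left')
  then show "x \<in> Pk P k" using * unfolding Pk_def by (auto intro: msumI)
qed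

lemma rr_len: "len (Fil k) (Pk P k) (rr P k)"
proof -
  obtain n where "len (Fil k) (Fil (Suc k)) n" using len_Fil_Suc by blast
  then obtain n' where "len (Fil k) (Pk P k) n'" using len_split[OF _ sub_Pk Fil_le_Pk Pk_le] by blast
  then show ?thesis unfolding rr_def by (rule theI) (erule len_unique[OF _ \<open>len (Fil k) (Pk P k) n'\<close>])
qed

text \<open>tau_1 carries the step at k isomorphically onto the step at k + 1 and maps P into
  itself, so P fills at least as much of the later step.\<close>

lemma rr_Suc: "rr P (Suc k) \<le> rr P k"
proof -
  have "len (tau1 D ` Fil k) (tau1 D ` Pk P k) (rr P k)" by (rule len_image[OF rr_len semilin_tau1])
  then have 1: "len (Fil (Suc k)) (tau1 D ` Pk P k) (rr P k)" using tau1_Fil by simp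
  have "tau1 D ` Pk P k = msum (Fil (Suc (Suc k))) (tau1 D ` (P \<inter> Fil k))"
    unfolding Pk_def msum_image[OF semilin_tau1] using tau1_Fil by simp
  also have "\<dots> \<subseteq> Pk P (Suc k)"
    unfolding Pk_def using P(3) tau1_Fil[of k] by (intro msum_mono) auto
  finally obtain n1 n2 where "len (Fil (Suc k)) (Pk P (Suc k)) n1" "n1 + n2 = rr P k"
    using len_split[OF 1 sub_Pk _ Pk_le] by blast
  then show ?thesis using len_unique[OF rr_len] by fastforce
qed

lemma rr_mono: "k \<le> k' \<Longrightarrow> rr P k' \<le> rr P k"
  by (rule lift_Suc_antimono_le[of "rr P", OF rr_Suc])

lemma tau0_Pk: "x \<in> Pk P k \<Longrightarrow> tau0 D x \<in> Pk P k"
proof -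
  have "tau0 D ` Pk P k = msum (Fil (Suc k)) (tau0 D ` (P \<inter> Fil k))"
    unfolding Pk_def msum_image[OF semilin_tau0] tau0_Fil by simp
  also have "\<dots> \<subseteq> Pk P k"
    unfolding Pk_def using P(2) tau0_Fil[of k] by (intro msum_mono) auto
  finally show "x \<in> Pk P k \<Longrightarrow> tau0 D x \<in> Pk P k" by blast
qed

text \<open>Starting from the first monomial of level k, the vectors \<open>x s\<close> with s <
  \<open>ct k\<close> are the monomials of that level. The sequence is continued past
  \<open>ct k\<close> by tau_0, so that the linear algebra of the chain need not know how many of
  its members are monomials.\<close>

context
  fixes v a0 b0 k x U
  assumes v: "good v" and k: "a0 * m + b0 * (h - m) = k"
  defines "x \<equiv> \<lambda>s. (tau0 D ^^ s) (mon v a0 b0)"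
  defines "U \<equiv> \<lambda>s. msum (Pk P k) (O_span D (x ` {..<s}))"
begin

lemma x_Fil: "x s \<in> Fil k"
proof (induction s)
  case 0
  then show ?case using v mon_mem_Fil[of v a0 b0] k unfolding x_def good_def by simp
next
  case (Suc s)
  then show ?case using tau0_Fil[of k] unfolding x_def by auto
qed

lemma eps_x_Fil: "\<epsilon> *s x s \<in> Fil (Suc k)"
  by (rule eps_mem_Fil1[OF x_Fil])

lemma sub_U: "is_sub (U s)"
  unfolding U_def by (intro sub_msum sub_Pk sub_O_span)

lemma Pk_le_U: "Pk P k \<subseteq> U s"
  unfolding U_def by (intro msum_ge1 sub_O_span)

lemma x_U: "i < s \<Longrightarrow> x i \<in> U s"
proof -
  assume "i < s"
  then have "x i \<in> O_span D (x ` {..<s})" by (intro O_span_inc imageI) simp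
  then show ?thesis unfolding U_def using msum_ge2[OF sub_Pk] by blast
qed

lemma U_le: "U s \<subseteq> Fil k"
  unfolding U_def by (intro msum_le sub_Fil Pk_le O_span_min) (use x_Fil in auto)

lemma U_Suc: "U (Suc s) = msum (U s) (line (x s))"
  unfolding U_def lessThan_Suc image_insert O_span_insert
  unfolding msum_def by (auto, metis add.assoc, metis add.assoc)

text \<open>If \<open>U s\<close> contains \<open>x s\<close>, it is stable under \<open>tau0\<close>, so its preimage under the
  monomial is ruled out by goodness unless \<open>U s\<close> is everything.\<close>

lemma x_not_U: assumes "U s \<noteq> Fil k" shows "x s \<notin> U s"
proof
  assume xs: "x s \<in> U s"
  let ?T = "\<lambda>v. mon v a0 b0"
  have tU: "tau0 D y \<in> U s" if yU: "y \<in> U s" for y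
  proof -
    have "O_span D (x ` {..<s}) \<subseteq> {y. tau0 D y \<in> U s}"
    proof -
      have "is_sub {y. tau0 D y \<in> U s}"
        using sub_image[OF semilin_inv[OF semilin_tau0] sub_U[of s]]
        by (simp add: bij_vimage_eq_inv_image[OF semilin_bij[OF semilin_tau0], symmetric] vimage_def)
      moreover have "tau0 D (x i) \<in> U s" if "i < s" for i
      proof -
        have "tau0 D (x i) = x (Suc i)" by (simp add: x_def)
        moreover have "x (Suc i) \<in> U s" using that xs x_U[of "Suc i" s] by (cases "Suc i = s") auto
        ultimately show ?thesis by simp
      qed
      ultimately show ?thesis by (intro O_span_min) auto
    qed
    moreover obtain p w where pw: "y = p + w" "p \<in> Pk P k" "w \<in> O_span D (x ` {..<s})"
      using yU unfolding U_def by (rule msumE)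
    ultimately have "tau0 D w \<in> U s" "tau0 D p \<in> U s" using tau0_Pk Pk_le_U by blast+
    then show ?thesis using sub_add[OF sub_U] unfolding pw(1) by (simp add: semilin_add[OF semilin_tau0])
  qed
  let ?P = "Hilbert_Choice.inv ?T ` U s"
  note bT = semilin_bij[OF semilin_mon[of a0 b0]]
  have mem: "y \<in> ?P \<longleftrightarrow> mon y a0 b0 \<in> U s" for y
    using bij_vimage_eq_inv_image[OF bT, of "U s"] by auto
  have F: "?T ` Fil n = Fil (n + k)" for n using mon_Fil[of a0 b0 n] k by simp
  have 1: "is_sub ?P" by (intro sub_image semilin_inv semilin_mon sub_U)
  have 2: "Fil 1 \<subseteq> ?P"
  proof
    fix y assume "y \<in> Fil 1"
    then have "mon y a0 b0 \<in> Fil (Suc k)" using F[of 1] by auto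
    then show "y \<in> ?P" unfolding mem using Fil_le_Pk Pk_le_U by blast
  qed
  have 3: "?P \<subseteq> Fil 0"
  proof
    fix y assume "y \<in> ?P"
    then have "mon y a0 b0 \<in> ?T ` Fil 0" unfolding mem F using U_le by auto
    then obtain y0 where "mon y a0 b0 = mon y0 a0 b0" "y0 \<in> Fil 0" by blast
    then show "y \<in> Fil 0" using semilin_inj[OF semilin_mon[of a0 b0], of y y0] by simp
  qed
  have "x 0 \<in> U s" using xs x_U[of 0 s] by (cases s) auto
  then have 4: "v \<in> ?P" unfolding mem by (simp add: x_def)
  have 5: "tau0 D ` ?P \<subseteq> ?P"
  proof
    fix z assume "z \<in> tau0 D ` ?P"
    then obtain y where "z = tau0 D y" "y \<in> ?P" by blast
    then show "z \<in> ?P" unfolding mem using tU by (simp add: mon_tau0)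
  qed
  have "?P = Fil 0" using v 1 2 3 4 5 unfolding good_def by blast
  then have "?T ` ?P = Fil k" using F[of 0] by simp
  then have "U s = Fil k" using image_inv_image[OF bT] by simp
  then show False using assms by simp
qed

text \<open>As long as s is below \<open>rr P k\<close>, the submodule \<open>U s\<close> is too
  short to be all of \<open>Fil k\<close>, so \<open>x_not_U\<close> supplies another independent
  vector.\<close>

lemma len_U: "s \<le> rr P k \<Longrightarrow> len (U s) (Pk P k) s"
proof (induction s)
  case 0
  have "U 0 = Pk P k" unfolding U_def
    using msum_absorb[OF sub_Pk sub_O_span[of "{}"]] sub_0[OF sub_Pk] by (simp add: O_span_empty)
  then show ?case using len_refl[OF sub_Pk] by simp
next
  case (Suc s)
  then have IH: "len (U s) (Pk P k) s" by simp
  have "U s \<noteq> Fil k" using len_unique[OF rr_len[of k]] IH Suc.prems by auto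
  then have "x s \<notin> U s" by (rule x_not_U)
  moreover have "\<epsilon> *s x s \<in> U s" using eps_x_Fil Fil_le_Pk Pk_le_U by blast
  ultimately show ?case unfolding U_Suc using len_step[OF sub_U] IH by blast
qed

lemma U_rr: "U (rr P k) = Fil k"
proof -
  obtain n1 n2 where n: "len (Fil k) (U (rr P k)) n1" "len (U (rr P k)) (Pk P k) n2" "n1 + n2 = rr P k"
    using len_split[OF rr_len sub_U Pk_le_U U_le] by blast
  then have "n1 = 0" using len_unique[OF n(2) len_U] by simp
  then show ?thesis using n(1) len_0_eq by auto
qed

lemma x_not_U': "s < rr P k \<Longrightarrow> x s \<notin> U s"
proof -
  assume s: "s < rr P k"
  have "U s \<noteq> Fil k"
  proof
    assume "U s = Fil k"
    then show False using len_U[of s] len_unique[OF rr_len[of k], of s] s by simp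
  qed
  then show ?thesis by (rule x_not_U)
qed

text \<open>Independence modulo \<open>Pk P k\<close>, in integral form: the last coefficient cannot
  be a unit, so its term lies in \<open>T\<close> by assumption and can be subtracted, and the
  argument repeats with the previous one.\<close>

lemma small_combination:
  assumes T: "is_sub T" "\<And>s. s < n \<Longrightarrow> \<epsilon> *s x s \<in> T" and "n \<le> rr P k"
  shows "z \<in> O_span D (x ` {..<n}) \<Longrightarrow> z \<in> Pk P k \<Longrightarrow> z \<in> T"
  using assms(2,3)
proof (induction n arbitrary: z)
  case 0
  then show ?case using sub_0[OF T(1)] by (simp add: O_span_empty)
next
  case (Suc n)
  obtain z' c where z: "z = z' + c *s x n" "z' \<in> O_span D (x ` {..<n})" "c \<in> \<O>"
    using Suc.prems(1) unfolding lessThan_Suc image_insert O_span_insert by (auto elim!: msumE lineE)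
  have "\<not> is_unit_OO c"
  proof
    assume "is_unit_OO c"
    have "z' \<in> U n" using z(2) unfolding U_def using msum_ge2[OF sub_Pk] by blast
    moreover have "z \<in> U n" using Suc.prems Pk_le_U by blast
    ultimately have "c *s x n \<in> U n" using z(1) sub_diff[OF sub_U, of z n z'] by simp
    then have "x n \<in> U n" using sub_unit[OF sub_U \<open>is_unit_OO c\<close>] by blast
    then show False using x_not_U'[of n] Suc.prems by simp
  qed
  then obtain d where d: "d \<in> \<O>" "c = \<epsilon> * d" using unit_or_ideal[OF z(3)] by blast
  then have cx: "c *s x n = d *s (\<epsilon> *s x n)" by (simp add: mult.commute)
  have "d *s (\<epsilon> *s x n) \<in> Pk P k" by (rule sub_scale[OF sub_Pk d(1)]) (use eps_x_Fil Fil_le_Pk in blast)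
  then have "z' \<in> Pk P k" using sub_diff[OF sub_Pk Suc.prems(2)] z(1) cx by (metis add_diff_cancel_right')
  then have "z' \<in> T" using Suc z(2) by auto
  moreover have "d *s (\<epsilon> *s x n) \<in> T" by (rule sub_scale[OF T(1) d(1)]) (use Suc.prems in auto)
  ultimately show ?case unfolding z(1) cx by (rule sub_add[OF T(1)])
qed

end

text \<open>The progression of exponents from \<open>solutions_param\<close> is exactly the effect
  of tau_0 on monomials. Multiplication by \<epsilon> raises the level by h, hence at least to k +
  1. For \<open>ct k\<close> = 0 the exponents \<open>a0\<close>, \<open>b0\<close> carry no
  information.\<close>

lemma level_generators:
  obtains a0 b0 where "ct k > 0 \<Longrightarrow> a0 * m + b0 * (h - m) = k"
    and "\<And>s. s < ct k \<Longrightarrow> (tau0 D ^^ s) (mon v a0 b0) \<in> Dl v k \<and> \<epsilon> *s (tau0 D ^^ s) (mon v a0 b0) \<in> Dl v (Suc k)"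
    and "Dl v k = msum (O_span D ((\<lambda>s. (tau0 D ^^ s) (mon v a0 b0)) ` {..<ct k})) (Dl v (Suc k))"
proof -
  obtain a0 b0 where sol: "\<And>s. s < ct k \<Longrightarrow> s * m \<le> b0 \<and> (a0 + s * (h - m)) * m + (b0 - s * m) * (h - m) = k"
    and all: "\<And>a b. a * m + b * (h - m) = k \<Longrightarrow> \<exists>s<ct k. a = a0 + s * (h - m) \<and> b = b0 - s * m"
    using solutions_param[OF pq, of k] by blast
  define x where "x = (\<lambda>s. (tau0 D ^^ s) (mon v a0 b0))"
  have x: "x s = mon v (a0 + s * (h - m)) (b0 - s * m)" if "s < ct k" for s
    unfolding x_def using sol[OF that] by (intro tau0_pow_mon) auto
  have xD: "x s \<in> Dl v k \<and> \<epsilon> *s x s \<in> Dl v (Suc k)" if "s < ct k" for s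
    unfolding x[OF that] eps_mon using sol[OF that] pq by (auto intro!: mon_Dl)
  show ?thesis
  proof (rule that[of a0 b0])
    show "ct k > 0 \<Longrightarrow> a0 * m + b0 * (h - m) = k" using sol[of 0] by simp
    show "\<And>s. s < ct k \<Longrightarrow> (tau0 D ^^ s) (mon v a0 b0) \<in> Dl v k \<and> \<epsilon> *s (tau0 D ^^ s) (mon v a0 b0) \<in> Dl v (Suc k)"
      using xD unfolding x_def .
    have "Dl v k = msum (O_span D (x ` {..<ct k})) (Dl v (Suc k))"
    proof
      show "msum (O_span D (x ` {..<ct k})) (Dl v (Suc k)) \<subseteq> Dl v k"
        using xD by (intro msum_le sub_Dl Dl_antimono O_span_min) auto
      show "Dl v k \<subseteq> msum (O_span D (x ` {..<ct k})) (Dl v (Suc k))"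
        unfolding Dl_def[of v k]
      proof (intro O_span_min sub_msum sub_O_span sub_Dl subsetI)
        fix y assume "y \<in> {mon v a b | a b. k \<le> a * m + b * (h - m)}"
        then obtain a b where ab: "y = mon v a b" "k \<le> a * m + b * (h - m)" by blast
        show "y \<in> msum (O_span D (x ` {..<ct k})) (Dl v (Suc k))"
        proof (cases "a * m + b * (h - m) = k")
          case True
          then obtain s where "s < ct k" "a = a0 + s * (h - m)" "b = b0 - s * m" using all by blast
          then have "y \<in> O_span D (x ` {..<ct k})" using x ab by (auto intro: O_span_inc)
          then show ?thesis using msum_ge1[OF sub_Dl] by blast
        next
          case False
          then have "y \<in> Dl v (Suc k)" using ab mon_Dl by simp
          then show ?thesis using msum_ge2[OF sub_O_span] by blast
        qed
      qed
    qed
    then show "Dl v k = msum (O_span D ((\<lambda>s. (tau0 D ^^ s) (mon v a0 b0)) ` {..<ct k})) (Dl v (Suc k))"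
      unfolding x_def .
  qed
qed

text \<open>An element that lies in Fil(k+1) + P has its level-k part in \<open>Pk P k\<close>.
  There \<open>small_combination\<close> makes all coefficients divisible by \<epsilon>, and
  \<epsilon> moves the monomials to a higher level, so the element can be rewritten without level
  k.\<close>

lemma low_levels:
  assumes v: "good v"
  shows "(\<forall>k'<k. ct k' \<le> rr P k') \<Longrightarrow> Dl v 0 \<inter> msum (Fil k) P \<subseteq> Dl v k"
proof (induction k)
  case (Suc k)
  show ?case
  proof
    fix z assume z: "z \<in> Dl v 0 \<inter> msum (Fil (Suc k)) P"
    then have "z \<in> msum (Fil k) P" using msum_mono[OF Fil_antimono[of k "Suc k"] subset_refl] by auto
    then have zk: "z \<in> Dl v k" using Suc z by auto
    obtain a0 b0 where ab: "ct k > 0 \<Longrightarrow> a0 * m + b0 * (h - m) = k"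
      "\<And>s. s < ct k \<Longrightarrow> (tau0 D ^^ s) (mon v a0 b0) \<in> Dl v k \<and> \<epsilon> *s (tau0 D ^^ s) (mon v a0 b0) \<in> Dl v (Suc k)"
      "Dl v k = msum (O_span D ((\<lambda>s. (tau0 D ^^ s) (mon v a0 b0)) ` {..<ct k})) (Dl v (Suc k))"
      by (rule level_generators[of k v]) (rule that; assumption)
    obtain w y where wy: "z = w + y" "w \<in> O_span D ((\<lambda>s. (tau0 D ^^ s) (mon v a0 b0)) ` {..<ct k})" "y \<in> Dl v (Suc k)"
      using zk ab(3) by (metis msumE)
    have vF: "v \<in> Fil 0" using v unfolding good_def by blast
    have "w \<in> Dl v (Suc k)"
    proof (cases "ct k > 0")
      case True
      have "y \<in> Fil (Suc k)" using wy(3) Dl_Fil[OF vF] by blast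
      have sF: "is_sub (msum (Fil (Suc k)) P)" by (intro sub_msum sub_Fil P)
      have "y \<in> msum (Fil (Suc k)) P" using \<open>y \<in> Fil (Suc k)\<close> msum_ge1[OF P(1)] by blast
      then have "w \<in> msum (Fil (Suc k)) P" using sub_diff[OF sF, of z y] z wy(1) by simp
      moreover have "w \<in> Fil k"
        using sub_diff[OF sub_Dl zk, of y] wy Dl_antimono[of k "Suc k" v] Dl_Fil[OF vF, of k] by auto
      ultimately have "w \<in> Pk P k" by (rule Pk_alt)
      show ?thesis
        by (rule small_combination[OF v ab(1)[OF True] sub_Dl _ _ wy(2) \<open>w \<in> Pk P k\<close>])
          (use ab(2) Suc.prems in auto)
    next
      case False
      then show ?thesis using wy(2) sub_0[OF sub_Dl] by (simp add: O_span_empty)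
    qed
    then show "z \<in> Dl v (Suc k)" unfolding wy(1) using wy(3) sub_add[OF sub_Dl] by blast
  qed
qed auto

text \<open>If the room is at most the number of monomials, the first \<open>rr P k\<close>
  monomials already fill \<open>Fil k\<close> modulo \<open>Pk P k\<close>. If there are fewer
  monomials than room, \<open>low_levels\<close> shows that lower levels contribute nothing, and
  only the monomials of level k remain.\<close>

lemma len_level:
  assumes v: "good v"
  shows "len (Dl v 0 \<inter> msum (Fil k) P) (Dl v 0 \<inter> msum (Fil (Suc k)) P) (min (ct k) (rr P k))"
proof -
  define A where "A = (\<lambda>k. Dl v 0 \<inter> msum (Fil k) P)"
  have sA: "is_sub (A k)" for k unfolding A_def by (intro sub_Int sub_Dl sub_msum sub_Fil P)
  have AA: "A (Suc k) \<subseteq> A k" unfolding A_def using msum_mono[OF Fil_antimono[of k "Suc k"] subset_refl] by auto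
  have vF: "v \<in> Fil 0" using v unfolding good_def by blast
  obtain a0 b0 where ab: "ct k > 0 \<Longrightarrow> a0 * m + b0 * (h - m) = k"
    "\<And>s. s < ct k \<Longrightarrow> (tau0 D ^^ s) (mon v a0 b0) \<in> Dl v k \<and> \<epsilon> *s (tau0 D ^^ s) (mon v a0 b0) \<in> Dl v (Suc k)"
    "Dl v k = msum (O_span D ((\<lambda>s. (tau0 D ^^ s) (mon v a0 b0)) ` {..<ct k})) (Dl v (Suc k))"
    by (rule level_generators[of k v]) (rule that; assumption)
  define x where "x s = (tau0 D ^^ s) (mon v a0 b0)" for s
  note ab = ab[folded x_def]
  define C where "C = (\<lambda>s. msum (A (Suc k)) (O_span D (x ` {..<s})))"
  have sC: "is_sub (C s)" for s unfolding C_def by (intro sub_msum sA sub_O_span)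
  have C_Suc: "C (Suc s) = msum (C s) (line (x s))" for s
    unfolding C_def lessThan_Suc image_insert O_span_insert
    unfolding msum_def by (auto, metis add.assoc, metis add.assoc)
  have x0: "x s \<in> Dl v 0" if "s < ct k" for s using ab(2)[OF that] Dl_antimono[of 0 k v] by auto
  have lenC: "s \<le> min (ct k) (rr P k) \<Longrightarrow> len (C s) (A (Suc k)) s" for s
  proof (induction s)
    case 0
    have "C 0 = A (Suc k)" unfolding C_def
      using msum_absorb[OF sA sub_O_span[of "{}"]] sub_0[OF sA] by (simp add: O_span_empty)
    then show ?case using len_refl[OF sA] by simp
  next
    case (Suc s)
    then have IH: "len (C s) (A (Suc k)) s" and s: "s < ct k" "s < rr P k" by auto
    have lev: "a0 * m + b0 * (h - m) = k" using ab(1) s by simp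
    note xF = x_Fil[OF v lev, folded x_def]
    have "x s \<notin> C s"
    proof
      assume "x s \<in> C s"
      then obtain y w where yw: "x s = y + w" "y \<in> A (Suc k)" "w \<in> O_span D (x ` {..<s})"
        unfolding C_def by (rule msumE)
      have "O_span D (x ` {..<s}) \<subseteq> Fil k" using xF by (intro O_span_min sub_Fil) auto
      then have "y \<in> Fil k" using yw sub_diff[OF sub_Fil xF, of w s] by auto
      then have "y \<in> Pk P k" using yw(2) Pk_alt unfolding A_def by blast
      then have "x s \<in> msum (Pk P k) (O_span D (x ` {..<s}))" using yw by (auto intro: msumI)
      then show False using x_not_U'[OF v lev s(2), folded x_def] by blast
    qed
    moreover have "\<epsilon> *s x s \<in> C s"
    proof -
      have "\<epsilon> *s x s \<in> Dl v 0" using x0[OF s(1)] by (rule sub_eps[OF sub_Dl])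
      moreover have "\<epsilon> *s x s \<in> msum (Fil (Suc k)) P"
        using eps_x_Fil[OF v lev, of s, folded x_def] msum_ge1[OF P(1)] by blast
      ultimately show ?thesis unfolding C_def A_def using msum_ge1[OF sub_O_span] by blast
    qed
    ultimately show ?case unfolding C_Suc using len_step[OF sC] IH by blast
  qed
  let ?t = "min (ct k) (rr P k)"
  have "C ?t = A k"
  proof
    show "C ?t \<subseteq> A k" unfolding C_def
    proof (intro msum_le sA AA O_span_min subsetI)
      fix y assume "y \<in> x ` {..<?t}"
      then obtain s where s: "y = x s" "s < ct k" by auto
      have lev: "a0 * m + b0 * (h - m) = k" using ab(1) s by simp
      show "y \<in> A k" unfolding A_def s(1)
        using x0[OF s(2)] x_Fil[OF v lev, of s, folded x_def] msum_ge1[OF P(1), of "Fil k"] by blast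
    qed
    show "A k \<subseteq> C ?t"
    proof (cases "rr P k \<le> ct k")
      case True
      then have t: "?t = rr P k" by simp
      show ?thesis
      proof
        fix z assume z: "z \<in> A k"
        then obtain f p where fp: "z = f + p" "f \<in> Fil k" "p \<in> P" unfolding A_def by (blast elim: msumE)
        have "f \<in> msum (Pk P k) (O_span D (x ` {..<rr P k}))"
        proof (cases "ct k > 0")
          case True
          show ?thesis using U_rr[OF v ab(1)[OF True], folded x_def] fp(2) by blast
        next
          case False
          then have "len (Fil k) (Pk P k) 0" using rr_len[of k] True by simp
          then have "f \<in> Pk P k" using fp(2) len_0_eq by blast
          then show ?thesis using msum_ge1[OF sub_O_span] by blast
        qed
        then obtain q w where qw: "f = q + w" "q \<in> Pk P k" "w \<in> O_span D (x ` {..<rr P k})" by (rule msumE)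
        obtain f' p' where q: "q = f' + p'" "f' \<in> Fil (Suc k)" "p' \<in> P"
          using qw(2) unfolding Pk_def by (blast elim: msumE)
        have "z - w = f' + (p' + p)" using fp qw q by simp
        then have 1: "z - w \<in> msum (Fil (Suc k)) P"
          using msumI[OF q(2) sub_add[OF P(1) q(3) fp(3)]] by simp
        have "O_span D (x ` {..<rr P k}) \<subseteq> Dl v 0" using x0 True by (intro O_span_min sub_Dl) auto
        then have "z - w \<in> Dl v 0" using z qw(3) sub_diff[OF sub_Dl] unfolding A_def by blast
        then have "z - w \<in> A (Suc k)" using 1 unfolding A_def by blast
        then have "(z - w) + w \<in> C ?t" unfolding C_def t by (rule msumI) (rule qw(3))
        then show "z \<in> C ?t" by simp
      qed
    next
      case False
      then have t: "?t = ct k" by simp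
      \<comment> \<open>A level k' < k with \<open>ct k'\<close> above \<open>rr P k'\<close> would
        give \<open>ct k\<close> \<ge> \<open>rr P k'\<close> \<ge> \<open>rr P k\<close>, against
        the present case.\<close>
      have "\<forall>k'<k. ct k' \<le> rr P k'"
      proof (rule ccontr)
        assume "\<not> (\<forall>k'<k. ct k' \<le> rr P k')"
        then obtain k' where k': "k' < k" "rr P k' < ct k'" by auto
        then have "rr P k' \<le> ct k" using cnt_mono[OF pq k'(2)] by simp
        then show False using rr_mono[of k' k] k' False by simp
      qed
      then have "A k \<subseteq> Dl v k" unfolding A_def by (rule low_levels[OF v])
      also have "\<dots> \<subseteq> C ?t"
        unfolding ab(3) t C_def msum_commute[of "A (Suc k)"]
        using Dl_antimono[of 0 "Suc k" v] Dl_Fil[OF vF, of "Suc k"] msum_ge1[OF P(1), of "Fil (Suc k)"]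
        by (intro msum_mono) (auto simp: A_def)
      finally show ?thesis .
    qed
  qed
  then show ?thesis using lenC[of ?t] unfolding A_def by simp
qed

lemma length_formula:
  assumes v: "good v" and K: "Fil K \<subseteq> P"
  shows "len (Dl v 0) (Dl v 0 \<inter> P) (\<Sum>k<K. min (ct k) (rr P k))"
proof -
  have "len (Dl v 0 \<inter> msum (Fil 0) P) (Dl v 0 \<inter> msum (Fil k) P) (\<Sum>k<k. min (ct k) (rr P k))" for k
  proof (induction k)
    case 0
    then show ?case by (simp add: len_refl sub_Int sub_Dl sub_msum sub_Fil P)
  next
    case (Suc k)
    then show ?case using len_trans[OF Suc len_level[OF v]] by simp
  qed
  from this[of K] show ?thesis
  proof -
    assume *: "len (Dl v 0 \<inter> msum (Fil 0) P) (Dl v 0 \<inter> msum (Fil K) P) (\<Sum>k<K. min (ct k) (rr P k))"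
    have "Dl v 0 \<subseteq> msum (Fil 0) P" using v Dl_Fil[of v 0] msum_ge1[OF P(1), of "Fil 0"] unfolding good_def by blast
    moreover have "msum (Fil K) P = P" using msum_absorb[OF P(1) sub_Fil K] msum_commute by metis
    ultimately show ?thesis using * by (simp add: inf.absorb1)
  qed
qed

end

end

text \<open>Translating the sum of all elements by 1 permutes its terms and adds the number of
  elements.\<close>

lemma of_nat_card_UNIV: "of_nat CARD('k::{field,finite}) = (0 :: 'k)"
proof -
  have "(\<Sum>x\<in>UNIV. x + 1) = (\<Sum>x\<in>UNIV. x :: 'k)"
    by (rule sum.reindex_bij_witness[where i = "\<lambda>x. x - 1" and j = "\<lambda>x. x + 1"]) auto
  then show ?thesis by (simp add: sum.distrib)
qed

lemma of_nat_card_alg_closure: "of_nat CARD('k::{field,finite}) = (0 :: 'k alg_closure)"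
  using arg_cong[OF of_nat_card_UNIV, of to_ac] by simp

context isocrystal_over
begin

subsection \<open>Lifting residues fixed by a power of Frobenius\<close>

lemma frob_pow_diff: "(frob D ^^ n) (x - y) = (frob D ^^ n) x - (frob D ^^ n) y"
  by (induction n) (auto simp: frob_diff)

lemma frob_pow_power: "(frob D ^^ n) (x ^ i) = ((frob D ^^ n) x) ^ i"
  by (induction n) (auto simp: frob_power)

lemma frob_pow_val_ideal: "(frob D ^^ n) x \<in> val_ideal D i \<longleftrightarrow> x \<in> val_ideal D i"
  by (induction n) (auto simp: frob_val_ideal)

lemma red_frob_pow: "x \<in> \<O> \<Longrightarrow> red D ((frob D ^^ n) x) = red D x ^ (CARD('k) ^ n)"
  by (induction n) (auto simp: red_frob frob_pow_val_ideal mult.commute simp flip: power_mult)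

lemma red_eq_iff: "x \<in> \<O> \<Longrightarrow> y \<in> \<O> \<Longrightarrow> red D x = red D y \<longleftrightarrow> x - y \<in> val_ideal D 1"
  using red_eq_0_iff[of "x - y"] by (simp add: red_diff OO_diff val_ideal_1_iff)

text \<open>In x^q - y^q = (x - y)S the factor S reduces to q y^(q-1), which is 0 in the residue
  field. This gains one valuation in either characteristic of L.\<close>

lemma val_ideal_power_q:
  assumes "x \<in> \<O>" "y \<in> \<O>" "x - y \<in> val_ideal D n" "1 \<le> n"
  shows "x ^ CARD('k) - y ^ CARD('k) \<in> val_ideal D (n + 1)"
proof -
  have xy: "red D x = red D y" using red_eq_iff[OF assms(1,2)] val_ideal_antimono[OF assms(4,3)] by simp
  let ?S = "\<Sum>i<CARD('k). y ^ (CARD('k) - Suc i) * x ^ i"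
  have S: "?S \<in> \<O>" using assms by (intro OO_sum OO_mult OO_power)
  have "red D ?S = (\<Sum>i<CARD('k). red D y ^ (CARD('k) - Suc i) * red D y ^ i)"
    using assms xy by (subst red_sum) (auto intro!: OO_mult OO_power sum.cong simp: red_mult red_power OO_power)
  also have "\<dots> = (\<Sum>i<CARD('k). red D y ^ (CARD('k) - 1))"
    by (rule sum.cong) (auto simp flip: power_add)
  also have "\<dots> = 0" by (simp add: of_nat_card_alg_closure)
  finally have "?S \<in> val_ideal D 1" using red_eq_0_iff[OF S] unfolding val_ideal_1_iff by blast
  then have "(x - y) * ?S \<in> val_ideal D (n + 1)" using assms(3) by (intro val_ideal_mult)
  then show ?thesis by (simp add: power_diff_sumr2)
qed

lemma val_ideal_power_q_pow:
  assumes "x \<in> \<O>" "y \<in> \<O>" "x - y \<in> val_ideal D 1"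
  shows "x ^ (CARD('k) ^ j) - y ^ (CARD('k) ^ j) \<in> val_ideal D (1 + int j)"
proof (induction j)
  case (Suc j)
  have "(x ^ (CARD('k) ^ j)) ^ CARD('k) - (y ^ (CARD('k) ^ j)) ^ CARD('k) \<in> val_ideal D (1 + int j + 1)"
    using assms Suc by (intro val_ideal_power_q OO_power) auto
  then show ?case by (simp add: ac_simps flip: power_mult)
qed (use assms in simp)

lemma in_all_val_ideals: "(\<And>n :: nat. x \<in> val_ideal D (int n)) \<Longrightarrow> x = 0"
proof (rule ccontr)
  assume *: "\<And>n :: nat. x \<in> val_ideal D (int n)" and "x \<noteq> 0"
  then have "int (nat (val D x + 1)) \<le> val D x" unfolding val_ideal_def by blast
  then show False by linarith
qed

text \<open>The Teichmueller lift is the limit of the powers \<open>y ^ (q ^ (d * n))\<close> of an arbitrary lift \<open>y\<close>.\<close>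

lemma teichmueller:
  assumes c: "c ^ (CARD('k) ^ d) = c" and d: "0 < d"
  shows "\<exists>w\<in>\<O>. (frob D ^^ d) w = w \<and> red D w = c"
proof -
  obtain y where y: "y \<in> \<O>" "red D y = c" using red_surj by blast
  define u where "u = (\<lambda>n. y ^ (CARD('k) ^ (d * n)))"
  have uO: "u n \<in> \<O>" for n unfolding u_def by (intro OO_power y)
  have cn: "c ^ (CARD('k) ^ (d * n)) = c" for n
  proof (induction n)
    case (Suc n)
    have "c ^ (CARD('k) ^ (d * Suc n)) = (c ^ (CARD('k) ^ d)) ^ (CARD('k) ^ (d * n))" by (simp add: power_add flip: power_mult)
    then show ?case using Suc c by simp
  qed simp
  have step: "u (Suc n) - u n \<in> val_ideal D (int n)" for n
  proof -
    have "y ^ (CARD('k) ^ d) - y \<in> val_ideal D 1"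
      using y c by (simp add: red_power OO_power flip: red_eq_iff)
    then have "(y ^ (CARD('k) ^ d)) ^ (CARD('k) ^ (d * n)) - y ^ (CARD('k) ^ (d * n)) \<in> val_ideal D (1 + int (d * n))"
      using y by (intro val_ideal_power_q_pow OO_power)
    moreover have "int n \<le> 1 + int (d * n)" using d by (cases d) auto
    ultimately have "(y ^ (CARD('k) ^ d)) ^ (CARD('k) ^ (d * n)) - y ^ (CARD('k) ^ (d * n)) \<in> val_ideal D (int n)"
      by (rule val_ideal_antimono[rotated])
    then show ?thesis unfolding u_def by (simp add: power_add flip: power_mult)
  qed
  have tail: "u (n + k) - u n \<in> val_ideal D (int n)" for n k
  proof (induction k)
    case (Suc k)
    have "u (Suc (n + k)) - u (n + k) \<in> val_ideal D (int n)"
      by (rule val_ideal_antimono[OF _ step]) simp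
    from val_ideal_add[OF this Suc] show ?case by simp
  qed simp
  have cauchy: "\<forall>n. \<exists>N. \<forall>i\<ge>N. \<forall>j\<ge>N. u i - u j \<in> val_ideal D n"
  proof (intro allI exI impI)
    fix n i j assume "nat n \<le> i" "nat n \<le> j"
    then obtain k k' where "i = nat n + k" "j = nat n + k'" by (metis le_Suc_ex)
    then have "u i - u (nat n) \<in> val_ideal D (int (nat n))" "u j - u (nat n) \<in> val_ideal D (int (nat n))"
      using tail by blast+
    then have "(u i - u (nat n)) - (u j - u (nat n)) \<in> val_ideal D (int (nat n))"
      by (rule val_ideal_diff)
    then show "u i - u j \<in> val_ideal D n" by (auto intro: val_ideal_antimono[rotated])
  qed
  have "complete_in D UNIV" using fs(4) unfolding completed_max_unramified_def by blast
  then have "\<exists>x\<in>UNIV. \<forall>n. \<exists>N. \<forall>i\<ge>N. u i - x \<in> val_ideal D n"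
    using cauchy unfolding complete_in_def by blast
  then obtain w where w: "\<And>n. \<exists>N. \<forall>i\<ge>N. u i - w \<in> val_ideal D n" by blast
  have lim: "u n - w \<in> val_ideal D (int n)" for n
  proof -
    obtain N where "\<forall>i\<ge>N. u i - w \<in> val_ideal D (int n)" using w by blast
    then have "u (n + N) - w \<in> val_ideal D (int n)" by simp
    from val_ideal_diff[OF this tail[of n N]] show ?thesis by simp
  qed
  have wO: "w \<in> \<O>" using OO_diff[OF uO[of 0], of "u 0 - w"] lim[of 0] by simp
  have "red D w = red D (u 1)"
    using lim[of 1] red_eq_iff[OF uO[of 1] wO] by simp
  also have "\<dots> = c" unfolding u_def using y cn[of 1] by (simp add: red_power)
  finally have rw: "red D w = c" .
  have "(frob D ^^ d) w - w = 0"
  proof (rule in_all_val_ideals)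
    fix n :: nat
    have fy: "(frob D ^^ d) y \<in> \<O>" using y by (simp add: frob_pow_val_ideal)
    \<comment> \<open>The d-th Frobenius power of y is another lift of c^(q^d) = c, so its powers
      converge to the same limit as those of y. Hence the limit is fixed.\<close>
    have "(frob D ^^ d) y - y \<in> val_ideal D 1"
      using y c fy by (simp add: red_frob_pow flip: red_eq_iff)
    then have "((frob D ^^ d) y) ^ (CARD('k) ^ (d * n)) - y ^ (CARD('k) ^ (d * n)) \<in> val_ideal D (1 + int (d * n))"
      using y fy by (intro val_ideal_power_q_pow)
    moreover have "int n \<le> 1 + int (d * n)" using d by (cases d) auto
    ultimately have 1: "(frob D ^^ d) (u n) - u n \<in> val_ideal D (int n)"
      unfolding u_def frob_pow_power by (rule val_ideal_antimono[rotated])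
    have 2: "(frob D ^^ d) (u n - w) \<in> val_ideal D (int n)" using lim by (simp add: frob_pow_val_ideal)
    have "(frob D ^^ d) w - w = ((frob D ^^ d) (u n) - u n) - (frob D ^^ d) (u n - w) + (u n - w)"
      by (simp add: frob_pow_diff)
    also have "\<dots> \<in> val_ideal D (int n)" by (intro val_ideal_add val_ideal_diff 1 2 lim)
    finally show "(frob D ^^ d) w - w \<in> val_ideal D (int n)" .
  qed
  then show ?thesis using wO rw by (intro bexI[of _ w]) auto
qed

end

context decomposed_isocrystal
begin

subsection \<open>The group of automorphisms\<close>

lemma coord_sigma: "t < rk D \<Longrightarrow> crd (sigma_N D x) t = frob D (crd x t)"
  unfolding sigma_N_def by (rule coord_unique) simp

lemma bij_sigma_N: "bij (sigma_N D)"
proof (rule bijI)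
  show "inj (sigma_N D)"
  proof (rule injI)
    fix x y assume *: "sigma_N D x = sigma_N D y"
    show "x = y"
    proof (rule coord_eqI)
      fix t assume "t < rk D"
      then have "frob D (crd x t) = frob D (crd y t)" using * coord_sigma by metis
      then show "crd x t = crd y t" using bij_is_inj[OF bij_frob] by (simp add: inj_eq)
    qed
  qed
  show "surj (sigma_N D)"
  proof (rule surjI)
    fix y
    let ?x = "\<Sum>t<rk D. Hilbert_Choice.inv (frob D) (crd y t) *s bv t"
    show "sigma_N D ?x = y"
    proof (rule coord_eqI)
      fix t assume t: "t < rk D"
      have "crd ?x t = Hilbert_Choice.inv (frob D) (crd y t)" by (rule coord_unique[OF refl t])
      then show "crd (sigma_N D ?x) t = crd y t"
        using coord_sigma[OF t] bij_frob by (simp add: bij_is_surj surj_f_inv_f)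
    qed
  qed
qed

lemma sigma_M0: "sigma_N D ` M0 D = M0 D"
proof (intro subset_antisym subsetI)
  fix x assume "x \<in> sigma_N D ` M0 D"
  then show "x \<in> M0 D" by (auto simp: M0_iff coord_sigma frob_val_ideal)
next
  fix x assume x: "x \<in> M0 D"
  obtain y where y: "x = sigma_N D y" using bij_sigma_N by (metis bij_pointE)
  then have "y \<in> M0 D" using x by (auto simp: M0_iff coord_sigma frob_val_ideal)
  then show "x \<in> sigma_N D ` M0 D" using y by blast
qed

lemma inv_sigma_M0: "Hilbert_Choice.inv (sigma_N D) ` M0 D = M0 D"
  using inv_inv_image[OF bij_sigma_N, of "M0 D"] sigma_M0 by simp

lemma b_sigma_G: "b_elt D \<circ> sigma_G D g = Phi D \<circ> g \<circ> Hilbert_Choice.inv (sigma_N D)"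
  using bij_sigma_N by (auto simp: b_elt_def sigma_G_def fun_eq_iff bij_is_inj)

text \<open>With sigma(g) = sigma g sigma^(-1) and b = Phi sigma^(-1), the product b sigma(g) is Phi
  g sigma^(-1). The defining equation of J_b(F) therefore becomes commutation with Phi.\<close>

lemma J_iff: "g \<in> J_group D \<longleftrightarrow> g \<in> GL D \<and> (\<forall>x. g (Phi D x) = Phi D (g x))"
proof -
  have "g \<circ> b_elt D = Phi D \<circ> g \<circ> Hilbert_Choice.inv (sigma_N D) \<longleftrightarrow> (\<forall>x. g (Phi D x) = Phi D (g x))"
  proof
    assume *: "g \<circ> b_elt D = Phi D \<circ> g \<circ> Hilbert_Choice.inv (sigma_N D)"
    show "\<forall>x. g (Phi D x) = Phi D (g x)"
    proof
      fix x
      have "(g \<circ> b_elt D) (sigma_N D x) = (Phi D \<circ> g \<circ> Hilbert_Choice.inv (sigma_N D)) (sigma_N D x)"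
        using * by simp
      then show "g (Phi D x) = Phi D (g x)" using bij_sigma_N by (simp add: b_elt_def bij_is_inj)
    qed
  qed (auto simp: b_elt_def fun_eq_iff)
  then show ?thesis unfolding J_group_def mem_Collect_eq b_sigma_G by blast
qed

lemma J_GL: "g \<in> J_group D \<Longrightarrow> g \<in> GL D"
  by (simp add: J_iff)

lemma J_semilin: "g \<in> J_group D \<Longrightarrow> semilin g"
  by (intro semilin_GL J_GL)

lemma J_bij: "g \<in> J_group D \<Longrightarrow> bij g"
  by (intro semilin_bij J_semilin)

lemma J_Phi: "g \<in> J_group D \<Longrightarrow> g (Phi D x) = Phi D (g x)"
  by (simp add: J_iff)

lemma J_id: "(\<lambda>x. x) \<in> J_group D"
  by (simp add: J_iff GL_id)

lemma J_comp: "f \<in> J_group D \<Longrightarrow> g \<in> J_group D \<Longrightarrow> f \<circ> g \<in> J_group D"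
  by (simp add: J_iff GL_comp)

lemma J_inv: "g \<in> J_group D \<Longrightarrow> Hilbert_Choice.inv g \<in> J_group D"
proof -
  assume g: "g \<in> J_group D"
  note b = J_bij[OF g]
  have T': "g (Hilbert_Choice.inv g x) = x" "Hilbert_Choice.inv g (g x) = x" for x
    using b by (auto simp: bij_is_surj surj_f_inv_f bij_is_inj)
  have "Hilbert_Choice.inv g (Phi D x) = Phi D (Hilbert_Choice.inv g x)" for x
    using T'(1)[of x] T'(2)[of "Phi D (Hilbert_Choice.inv g x)"] J_Phi[OF g] by simp
  then show ?thesis using GL_inv[OF J_GL[OF g]] by (simp add: J_iff)
qed

lemma GL_smul: "c \<noteq> 0 \<Longrightarrow> (\<lambda>x. c *s x) \<in> GL D"
  by (simp add: GL_iff bij_smul N.scale_right_distrib mult.commute)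

lemma J_eps: "(\<lambda>x. \<epsilon> powi n *s x) \<in> J_group D"
  by (simp add: J_iff GL_smul semilin_eps_powi[OF semilin_Phi])

lemma GL_scale: "g \<in> GL D \<Longrightarrow> g (c *s x) = c *s g x"
  by (simp add: GL_iff)

lemma J_Phi_pow: "g \<in> J_group D \<Longrightarrow> g ((Phi D ^^ n) x) = (Phi D ^^ n) (g x)"
  by (induction n) (auto simp: J_Phi)

lemma J_tau0: "g \<in> J_group D \<Longrightarrow> g (tau0 D x) = tau0 D (g x)"
  and J_tau1: "g \<in> J_group D \<Longrightarrow> g (tau1 D x) = tau1 D (g x)"
  by (simp_all add: tau0_alt tau1_alt J_Phi_pow J_GL GL_scale)

lemma J_Ver: "g \<in> J_group D \<Longrightarrow> g (Ver D x) = Ver D (g x)"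
proof -
  assume g: "g \<in> J_group D"
  have "Phi D (g (Ver D x)) = Phi D (Ver D (g x))"
    unfolding J_Phi[OF g, symmetric] Phi_Ver by (rule semilin_eps[OF J_semilin[OF g]])
  then show ?thesis using semilin_inj[OF semilin_Phi] by blast
qed

lemma eps_pow_in_M0: "\<exists>N. \<epsilon> ^ N *s x \<in> M0 D"
proof -
  define N where "N = nat (Max ((\<lambda>t. - val D (crd x t)) ` {..<rk D}))"
  have "crd (\<epsilon> ^ N *s x) t \<in> \<O>" if t: "t < rk D" for t
  proof (cases "crd x t = 0")
    case False
    have "- val D (crd x t) \<le> Max ((\<lambda>t. - val D (crd x t)) ` {..<rk D})" using t by (intro Max_ge) auto
    then have "0 \<le> int N + val D (crd x t)" unfolding N_def by linarith
    then show ?thesis using t False by (simp add: coord_scale val_ideal_def val_mult)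
  qed (simp add: coord_scale t)
  then show ?thesis unfolding M0_iff by blast
qed

lemma eps_pow_Fil: "x \<in> Fil k \<Longrightarrow> \<epsilon> ^ n *s x \<in> Fil (k + n * h)"
proof (induction n)
  case (Suc n)
  then have "\<epsilon> *s (\<epsilon> ^ n *s x) \<in> Fil ((k + n * h) + h)" by (intro eps_mem_Fil) simp
  then show ?case by (simp add: ac_simps)
qed simp

lemma eps_pow_mono: "is_sub A \<Longrightarrow> n \<le> n' \<Longrightarrow> \<epsilon> ^ n *s x \<in> A \<Longrightarrow> \<epsilon> ^ n' *s x \<in> A"
proof -
  assume A: "is_sub A" and n: "n \<le> n'" and x: "\<epsilon> ^ n *s x \<in> A"
  have "\<epsilon> ^ n' = \<epsilon> ^ (n' - n) * \<epsilon> ^ n" using n by (simp flip: power_add)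
  then show ?thesis using sub_scale[OF A OO_power[OF OO_eps] x, of "n' - n"] by simp
qed

lemma eps_pow_in_Fil: "\<exists>N. \<epsilon> ^ N *s x \<in> Fil k"
proof -
  obtain N where "\<epsilon> ^ N *s x \<in> Fil 0" using eps_pow_in_M0 unfolding M0_eq by blast
  then have "\<epsilon> ^ k *s (\<epsilon> ^ N *s x) \<in> Fil (0 + k * h)" by (rule eps_pow_Fil)
  moreover have "k \<le> 0 + k * h" using h_pos by simp
  ultimately have "\<epsilon> ^ (k + N) *s x \<in> Fil k"
    using Fil_antimono[of k "0 + k * h"] by (auto simp: power_add)
  then show ?thesis by blast
qed

lemma finite_eps_pow:
  assumes "finite B" shows "\<exists>N. \<forall>x\<in>O_span D B. \<epsilon> ^ N *s x \<in> Fil k"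
proof -
  define n where "n = (\<lambda>x. SOME N. \<epsilon> ^ N *s x \<in> Fil k)"
  have n: "\<epsilon> ^ (n x) *s x \<in> Fil k" for x unfolding n_def by (rule someI_ex[OF eps_pow_in_Fil])
  let ?N = "Max (n ` B)"
  have sub: "is_sub {x. \<epsilon> ^ ?N *s x \<in> Fil k}"
  proof (rule subI)
    show "0 \<in> {x. \<epsilon> ^ ?N *s x \<in> Fil k}" by (simp add: sub_0[OF sub_Fil])
    show "x + y \<in> {x. \<epsilon> ^ ?N *s x \<in> Fil k}" if "x \<in> {x. \<epsilon> ^ ?N *s x \<in> Fil k}" "y \<in> {x. \<epsilon> ^ ?N *s x \<in> Fil k}" for x y
      using that by (simp add: N.scale_right_distrib sub_add[OF sub_Fil])
    show "c *s x \<in> {x. \<epsilon> ^ ?N *s x \<in> Fil k}" if "c \<in> \<O>" "x \<in> {x. \<epsilon> ^ ?N *s x \<in> Fil k}" for c x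
      using that sub_scale[OF sub_Fil, of c "\<epsilon> ^ ?N *s x" k] by (simp add: mult.commute)
  qed
  have "B \<subseteq> {x. \<epsilon> ^ ?N *s x \<in> Fil k}"
  proof
    fix x assume "x \<in> B"
    then have "n x \<le> ?N" using assms by (intro Max_ge) auto
    then show "x \<in> {x. \<epsilon> ^ ?N *s x \<in> Fil k}" using eps_pow_mono[OF sub_Fil _ n] by blast
  qed
  from O_span_min[OF sub this] show ?thesis by blast
qed

lemma lattice_fin: "g \<in> GL D \<Longrightarrow> \<exists>B. finite B \<and> g ` M0 D = O_span D B"
proof -
  assume "g \<in> GL D"
  then have "g ` M0 D = O_span D (g ` bv ` {..<rk D})" unfolding M0_span by (intro O_span_image semilin_GL)
  moreover have "finite (g ` bv ` {..<rk D})" by simp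
  ultimately show ?thesis by blast
qed

lemma sub_lattice: "g \<in> GL D \<Longrightarrow> is_sub (g ` M0 D)"
  unfolding M0_eq by (intro sub_image semilin_GL sub_Fil)

lemma lattice_bound: "g \<in> GL D \<Longrightarrow> \<exists>N. \<forall>x\<in>g ` M0 D. \<epsilon> ^ N *s x \<in> Fil k"
proof -
  assume "g \<in> GL D"
  then obtain B where "finite B" "g ` M0 D = O_span D B" using lattice_fin by blast
  then show ?thesis using finite_eps_pow[of B k] by simp
qed

lemma lattice_Fil: assumes g: "g \<in> GL D" shows "\<exists>K. Fil K \<subseteq> g ` M0 D"
proof -
  obtain N where N: "\<And>x. x \<in> Hilbert_Choice.inv g ` M0 D \<Longrightarrow> \<epsilon> ^ N *s x \<in> Fil 0"
    using lattice_bound[OF GL_inv[OF g], of 0] by blast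
  have "Fil (N * h) \<subseteq> g ` M0 D"
  proof
    fix x assume x: "x \<in> Fil (N * h)"
    have "Fil (0 + n * h) = (\<lambda>x. \<epsilon> ^ n *s x) ` Fil 0" for n
    proof (induction n)
      case (Suc n)
      have "Fil (0 + Suc n * h) = (\<lambda>x. \<epsilon> *s x) ` Fil (0 + n * h)" unfolding eps_Fil by (simp add: ac_simps)
      then show ?case unfolding Suc by (simp add: image_image)
    qed simp
    then obtain y where y: "x = \<epsilon> ^ N *s y" "y \<in> M0 D" using x unfolding M0_eq by auto
    have "\<epsilon> ^ N *s Hilbert_Choice.inv g y \<in> M0 D" using N y(2) unfolding M0_eq by blast
    then have "g (\<epsilon> ^ N *s Hilbert_Choice.inv g y) \<in> g ` M0 D" by blast
    moreover have "g (\<epsilon> ^ N *s Hilbert_Choice.inv g y) = x"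
      using semilin_bij[OF semilin_GL[OF g]] by (simp add: GL_scale[OF g] y(1) bij_is_surj surj_f_inv_f)
    ultimately show "x \<in> g ` M0 D" by simp
  qed
  then show ?thesis by blast
qed

text \<open>Every vector enters \<open>Fil k\<close> after scaling by a power of \<epsilon>, so the
  range is everything, and finite dimension gives injectivity.\<close>

lemma surj_from_Fil:
  assumes "\<And>x y. f (x + y) = f x + f y" "\<And>c x. f (c *s x) = c *s f x" "Fil k \<subseteq> range f"
  shows "f \<in> GL D"
proof -
  have "surj f"
  proof -
    have "y \<in> range f" for y
    proof -
      obtain N where "\<epsilon> ^ N *s y \<in> Fil k" using eps_pow_in_Fil by blast
      then obtain x where "\<epsilon> ^ N *s y = f x" using assms(3) by blast
      then have "f (inverse (\<epsilon> ^ N) *s x) = y" unfolding assms(2) by (metis N.scale_left_imp_eq N.scale_one N.scale_scale eps_nz left_inverse power_not_zero)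
      then show ?thesis by blast
    qed
    then show ?thesis by blast
  qed
  moreover have "inj f"
  proof -
    interpret F: finite_dimensional_vector_space "smul D" "bv ` {..<rk D}"
      by unfold_locales (auto simp: bv_independent bv_span)
    have "Vector_Spaces.linear (smul D) (smul D) f"
      unfolding Vector_Spaces.linear_iff using assms N.vector_space_axioms by blast
    then show ?thesis using \<open>surj f\<close> F.linear_surj_imp_inj by blast
  qed
  ultimately show ?thesis unfolding GL_iff bij_def using assms by blast
qed

text \<open>The linear map sending e_{i,0} to \<open>y i\<close> and following tau_1 along the
  basis. For \<open>y i\<close> fixed by tau_0 it commutes with Phi; besides scalars, the elements
  of J_b(F) constructed below are built from such maps.\<close>

definition gen_map :: "(nat \<Rightarrow> 'n) \<Rightarrow> 'n \<Rightarrow> 'n" where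
  "gen_map y x = (\<Sum>t<rk D. crd x t *s (tau1 D ^^ (t mod h)) (y (t div h)))"

lemma gen_map_add: "gen_map y (x + x') = gen_map y x + gen_map y x'"
  unfolding gen_map_def by (simp add: coord_add N.scale_left_distrib sum.distrib)

lemma gen_map_scale: "gen_map y (c *s x) = c *s gen_map y x"
  unfolding gen_map_def by (simp add: coord_scale N.scale_sum_right)

lemma gen_map_bv: "t < rk D \<Longrightarrow> gen_map y (bv t) = (tau1 D ^^ (t mod h)) (y (t div h))"
proof -
  assume t: "t < rk D"
  have "gen_map y (bv t) = (\<Sum>s<rk D. if t = s then (tau1 D ^^ (s mod h)) (y (s div h)) else 0)"
    unfolding gen_map_def using t by (intro sum.cong) (auto simp: coord_bv)
  then show ?thesis using t by simp
qed

lemma gen_map_e: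
  assumes i: "i < l" and y: "tfix (y i)"
  shows "gen_map y (e i j) = (tau1 D ^^ j) (y i)"
proof (induction j rule: less_induct)
  case (less j)
  show ?case
  proof (cases "j < h")
    case True
    then show ?thesis using gen_map_bv[OF index_rk[OF i True], of y] bv_index[OF True, of i] by simp
  next
    case False
    then have j: "j = (j - h) + h" "j - h < j" using h_pos by auto
    have "gen_map y (e i j) = \<epsilon> *s (tau1 D ^^ (j - h)) (y i)"
      using e_h[OF i, of "j - h"] less j by (simp add: gen_map_scale)
    also have "\<dots> = (tau1 D ^^ h) ((tau1 D ^^ (j - h)) (y i))"
      using tau1_h[OF tfix_tau1_pow[OF y]] by simp
    also have "\<dots> = (tau1 D ^^ (h + (j - h))) (y i)" by (simp add: funpow_add)
    finally show ?thesis using False by simp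
  qed
qed

lemma gen_map_Phi:
  assumes y: "\<And>i. i < l \<Longrightarrow> tfix (y i)"
  shows "gen_map y (Phi D x) = Phi D (gen_map y x)"
proof -
  have P: "gen_map y (Phi D (bv t)) = Phi D (gen_map y (bv t))" if t: "t < rk D" for t
  proof -
    note i = conjunct1[OF rk_index[OF t]]
    have "gen_map y (Phi D (bv t)) = (tau1 D ^^ (t mod h + m)) (y (t div h))"
      unfolding basis_vec_def Phi_e[OF i] by (rule gen_map_e[of "t div h" y, OF i y[OF i]])
    also have "\<dots> = (tau1 D ^^ m) ((tau1 D ^^ (t mod h)) (y (t div h)))"
      by (subst add.commute) (simp add: funpow_add)
    also have "\<dots> = Phi D ((tau1 D ^^ (t mod h)) (y (t div h)))"
      by (rule tau1_m[OF tfix_tau1_pow[OF y[OF i]]])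
    finally show ?thesis unfolding gen_map_bv[OF t] .
  qed
  have gen_map_sum: "gen_map y (sum f A) = (\<Sum>t\<in>A. gen_map y (f t))" for f and A :: "nat set"
    by (induction A rule: infinite_finite_induct) (auto simp: gen_map_add gen_map_scale[of y 0 0, simplified])
  have "gen_map y (Phi D x) = gen_map y (Phi D (\<Sum>t<rk D. crd x t *s bv t))" by (simp add: coord_sum)
  also have "\<dots> = (\<Sum>t<rk D. frob D (crd x t) *s gen_map y (Phi D (bv t)))"
    by (simp add: semilin_sum[OF semilin_Phi] Phi_scale gen_map_sum gen_map_scale)
  also have "\<dots> = (\<Sum>t<rk D. frob D (crd x t) *s Phi D (gen_map y (bv t)))" using P by simp
  also have "\<dots> = Phi D (gen_map y (\<Sum>t<rk D. crd x t *s bv t))"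
    by (simp add: semilin_sum[OF semilin_Phi] Phi_scale gen_map_sum gen_map_scale)
  finally show ?thesis by (simp add: coord_sum)
qed

lemma gen_map_M0:
  assumes "gen_map y \<in> GL D" and y: "\<And>i. i < l \<Longrightarrow> tfix (y i)"
  shows "gen_map y ` M0 D = O_span D {(tau1 D ^^ j) (y i) | i j. i < l}"
proof -
  have "gen_map y ` {e i j | i j. i < l} = {(tau1 D ^^ j) (y i) | i j. i < l}"
  proof (intro subset_antisym subsetI)
    show "x \<in> {(tau1 D ^^ j) (y i) | i j. i < l}" if "x \<in> gen_map y ` {e i j | i j. i < l}" for x
      using that gen_map_e[of _ y] y by blast
    show "x \<in> gen_map y ` {e i j | i j. i < l}" if "x \<in> {(tau1 D ^^ j) (y i) | i j. i < l}" for x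
      using that gen_map_e[of _ y, symmetric] y by blast
  qed
  then show ?thesis unfolding M0_def O_span_image[OF semilin_GL[OF assms(1)]] by simp
qed

text \<open>Bijectivity is read off from the lattice generated by the images: once it contains some
  \<open>Fil k\<close>, the map is onto.\<close>

lemma gen_map_J:
  assumes y: "\<And>i. i < l \<Longrightarrow> tfix (y i)" and k: "Fil k \<subseteq> O_span D {(tau1 D ^^ j) (y i) | i j. i < l}"
  shows "gen_map y \<in> J_group D" "gen_map y ` M0 D = O_span D {(tau1 D ^^ j) (y i) | i j. i < l}"
proof -
  have "is_sub (range (gen_map y))"
  proof (rule subI)
    show "0 \<in> range (gen_map y)" using gen_map_scale[of y 0 0] by (metis N.scale_zero_left rangeI)
    show "u + w \<in> range (gen_map y)" if "u \<in> range (gen_map y)" "w \<in> range (gen_map y)" for u w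
      using that by (auto simp flip: gen_map_add)
    show "c *s u \<in> range (gen_map y)" if "u \<in> range (gen_map y)" for c u
      using that by (auto simp flip: gen_map_scale)
  qed
  moreover have "{(tau1 D ^^ j) (y i) | i j. i < l} \<subseteq> range (gen_map y)"
  proof clarify
    fix i j assume "i < l"
    then show "(tau1 D ^^ j) (y i) \<in> range (gen_map y)" using gen_map_e[of i y j] y by (metis rangeI)
  qed
  ultimately have "Fil k \<subseteq> range (gen_map y)" using k O_span_min by blast
  then have g: "gen_map y \<in> GL D" using surj_from_Fil gen_map_add gen_map_scale by blast
  then show "gen_map y \<in> J_group D" using gen_map_Phi[OF y] by (simp add: J_iff)
  show "gen_map y ` M0 D = O_span D {(tau1 D ^^ j) (y i) | i j. i < l}" by (rule gen_map_M0[OF g y])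
qed

text \<open>tau_1 itself is only semilinear; the linear map with e_{i,0} going to e_{i,k} has the
  same effect on M_0 as tau_1^k.\<close>

lemma Fil_J: "\<exists>g\<in>J_group D. g ` M0 D = Fil k"
proof -
  have "{(tau1 D ^^ j) (e i k) | i j. i < l} = {e i j | i j. i < l \<and> k \<le> j}"
    unfolding tau1_pow_e
    by (auto, metis le_add2, metis le_add_diff_inverse2)
  then have eq: "O_span D {(tau1 D ^^ j) (e i k) | i j. i < l} = Fil k" unfolding Fil_def by simp
  show ?thesis
    using gen_map_J[of "\<lambda>i. e i k" k] tfix_e unfolding eq by blast
qed

subsection \<open>Dieudonne lattices\<close>

definition dieudonne :: "'n set \<Rightarrow> bool" where
  "dieudonne M \<longleftrightarrow> Phi D ` M \<subseteq> M \<and> Ver D ` M \<subseteq> M"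

lemma coord_cochar: "t < rk D \<Longrightarrow> crd (cochar_at_unif D xi x) t = \<epsilon> powi (xi ! t) * crd x t"
  unfolding cochar_at_unif_def by (rule coord_unique) simp

text \<open>Entries 0 and 1 of mu give \<epsilon>M_0 \<subseteq> mu(\<epsilon>)M_0 \<subseteq> M_0.
  Transported to M = gM_0 this reads \<epsilon>M \<subseteq> Phi M \<subseteq> M, and the first
  inclusion is stability under V.\<close>

lemma X_mu_dieudonne:
  assumes g: "g \<in> GL D" "coset_K D g \<in> X_mu_b D mu"
    and mu: "length mu = rk D" "set mu \<subseteq> {0, 1}"
  shows "dieudonne (g ` M0 D)"
proof -
  let ?inv = Hilbert_Choice.inv
  \<comment> \<open>Membership of the coset in X_mu(b) is witnessed by some representative g',
    possibly different from g; both define the same lattice.\<close>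
  obtain g' where g': "g' \<in> GL D" "coset_K D g = coset_K D g'"
    "?inv g' \<circ> b_elt D \<circ> sigma_G D g' \<in> double_coset D mu"
    using g(2) unfolding X_mu_b_def by blast
  have "g \<in> coset_K D g"
    unfolding coset_K_def K_stab_def using GL_id by (auto intro!: exI[of _ "\<lambda>x. x"])
  then obtain u where u: "g = g' \<circ> u" "u \<in> K_stab D" unfolding g'(2) unfolding coset_K_def by blast
  have "g ` M0 D = g' ` (u ` M0 D)" unfolding u(1) by (rule image_comp[symmetric])
  then have gM: "g ` M0 D = g' ` M0 D" using u(2) unfolding K_stab_def by simp
  obtain k1 k2 where k: "k1 \<in> K_stab D" "k2 \<in> K_stab D"
    "?inv g' \<circ> b_elt D \<circ> sigma_G D g' = k1 \<circ> cochar_at_unif D mu \<circ> k2"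
    using g'(3) unfolding double_coset_def by blast
  have bg: "bij g'" by (rule semilin_bij[OF semilin_GL[OF g'(1)]])
  have "?inv g' \<circ> (Phi D \<circ> g' \<circ> ?inv (sigma_N D)) = k1 \<circ> cochar_at_unif D mu \<circ> k2"
    using k(3) b_sigma_G[of g'] by (simp add: comp_assoc)
  then have "(?inv g' \<circ> (Phi D \<circ> g' \<circ> ?inv (sigma_N D))) ` M0 D = (k1 \<circ> cochar_at_unif D mu \<circ> k2) ` M0 D"
    by simp
  note eq = this
  have "?inv g' ` (Phi D ` (g' ` M0 D)) = k1 ` (cochar_at_unif D mu ` M0 D)"
  proof -
    have "k2 ` M0 D = M0 D" using k(2) unfolding K_stab_def by blast
    then show ?thesis
      using eq unfolding image_comp[symmetric] inv_sigma_M0 by simp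
  qed
  then have "g' ` (?inv g' ` (Phi D ` (g' ` M0 D))) = g' ` (k1 ` (cochar_at_unif D mu ` M0 D))" by simp
  then have PM: "Phi D ` (g' ` M0 D) = g' ` (k1 ` (cochar_at_unif D mu ` M0 D))"
    unfolding image_inv_image[OF bg] .
  have mu01: "mu ! t \<in> {0, 1}" if "t < rk D" for t
    using mu(2) nth_mem[of t mu] that unfolding mu(1) by auto
  have c1: "cochar_at_unif D mu ` M0 D \<subseteq> M0 D"
  proof clarify
    fix x assume x: "x \<in> M0 D"
    have "\<epsilon> powi (mu ! t) \<in> \<O>" if "t < rk D" for t using mu01[OF that] by (intro OO_abs_powi) auto
    then show "cochar_at_unif D mu x \<in> M0 D" using x unfolding M0_iff by (simp add: coord_cochar OO_mult)
  qed
  have c2: "\<epsilon> *s x \<in> cochar_at_unif D mu ` M0 D" if x: "x \<in> M0 D" for x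
  proof -
    let ?y = "\<Sum>t<rk D. (\<epsilon> powi (1 - mu ! t) * crd x t) *s bv t"
    have y: "crd ?y t = \<epsilon> powi (1 - mu ! t) * crd x t" if "t < rk D" for t by (rule coord_unique[OF refl that])
    have "\<epsilon> powi (1 - mu ! t) \<in> \<O>" if "t < rk D" for t using mu01[OF that] by (intro OO_abs_powi) auto
    then have "?y \<in> M0 D" using x y unfolding M0_iff by (simp add: OO_mult)
    moreover have "\<epsilon> *s x = cochar_at_unif D mu ?y"
    proof (rule coord_eqI)
      fix t assume t: "t < rk D"
      have "\<epsilon> powi (mu ! t) * \<epsilon> powi (1 - mu ! t) = \<epsilon>" by (simp flip: power_int_add)
      then show "crd (\<epsilon> *s x) t = crd (cochar_at_unif D mu ?y) t"
        using t y by (simp add: coord_cochar coord_scale flip: mult.assoc)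
    qed
    ultimately show ?thesis by blast
  qed
  have k1: "k1 \<in> GL D" "k1 ` M0 D = M0 D" using k(1) unfolding K_stab_def by auto
  have 1: "Phi D ` (g' ` M0 D) \<subseteq> g' ` M0 D"
  proof -
    have "k1 ` (cochar_at_unif D mu ` M0 D) \<subseteq> k1 ` M0 D" by (rule image_mono[OF c1])
    then show ?thesis unfolding PM k1(2) by (rule image_mono)
  qed
  have 2: "\<epsilon> *s x \<in> Phi D ` (g' ` M0 D)" if xM: "x \<in> g' ` M0 D" for x
  proof -
    obtain y where y: "x = g' y" "y \<in> M0 D" using xM by blast
    obtain z where z: "y = k1 z" "z \<in> M0 D" using y(2) k1(2) by blast
    have "\<epsilon> *s x = g' (k1 (\<epsilon> *s z))" unfolding y z by (simp add: GL_scale g'(1) k1(1))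
    then show ?thesis unfolding PM using c2[OF z(2)] by blast
  qed
  have "Ver D x \<in> g' ` M0 D" if xM: "x \<in> g' ` M0 D" for x
  proof -
    obtain y where y: "\<epsilon> *s x = Phi D y" "y \<in> g' ` M0 D" using 2[OF xM] by blast
    then have "Phi D (Ver D x) = Phi D y" by (simp add: Phi_Ver)
    then show ?thesis using y(2) semilin_inj[OF semilin_Phi] by metis
  qed
  then show ?thesis unfolding gM dieudonne_def using 1 by blast
qed

lemma J_dieudonne: "g \<in> J_group D \<Longrightarrow> dieudonne M \<Longrightarrow> dieudonne (g ` M)"
  unfolding dieudonne_def by (auto simp: J_Phi[symmetric] J_Ver[symmetric])


subsection \<open>Smaller translates of the standard lattice\<close>

lemma tau0_scale: "tau0 D (c *s x) = (frob D ^^ h) c *s tau0 D x"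
proof -
  have "(Phi D ^^ n) (c *s x) = (frob D ^^ n) c *s (Phi D ^^ n) x" for n
    by (induction n) (auto simp: Phi_scale)
  then show ?thesis unfolding tau0_alt by (simp add: mult.commute)
qed

lemma O_span_lessThan: "z \<in> O_span D (f ` {..<n :: nat}) \<Longrightarrow> \<exists>c. (\<forall>i<n. c i \<in> \<O>) \<and> z = (\<Sum>i<n. c i *s f i)"
proof (induction n arbitrary: z)
  case 0
  then show ?case by (simp add: O_span_empty)
next
  case (Suc n)
  then obtain y d where z: "z = y + d *s f n" "y \<in> O_span D (f ` {..<n})" "d \<in> \<O>"
    by (auto simp: lessThan_Suc O_span_insert elim!: msumE lineE)
  obtain c where c: "\<forall>i<n. c i \<in> \<O>" "y = (\<Sum>i<n. c i *s f i)" using Suc.IH[OF z(2)] by blast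
  have "(\<Sum>i<n. (c(n := d)) i *s f i) = (\<Sum>i<n. c i *s f i)" by (intro sum.cong) auto
  then show ?case using c z by (intro exI[of _ "c(n := d)"]) (auto simp: less_Suc_eq)
qed

lemma val_ideal_sum: "(\<And>i. i \<in> A \<Longrightarrow> f i \<in> val_ideal D n) \<Longrightarrow> sum f A \<in> val_ideal D n"
  by (induction A rule: infinite_finite_induct) (auto simp: val_ideal_add)

text \<open>\<open>Fil 1\<close> is generated by the e_{i,j} with 1 \<le> j \<le> h, and among them
  only e_{i,h} = \<epsilon>e_{i,0} has a nonzero coordinate at e_{i,0}.\<close>

lemma Fil1_coord: "x \<in> Fil 1 \<Longrightarrow> i < l \<Longrightarrow> crd x (i * h) \<in> val_ideal D 1"
proof -
  assume i: "i < l"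
  have t: "i * h < rk D" using index_rk[OF i, of 0] h_pos by simp
  have sub: "is_sub {x. crd x (i * h) \<in> val_ideal D 1}"
  proof (rule subI)
    show "0 \<in> {x. crd x (i * h) \<in> val_ideal D 1}" using coord_scale[OF t, of 0 0] by simp
    show "c *s x \<in> {x. crd x (i * h) \<in> val_ideal D 1}" if "c \<in> \<O>" "x \<in> {x. crd x (i * h) \<in> val_ideal D 1}" for c x
      using that val_ideal_mult[of c 0 _ 1] by (simp add: coord_scale[OF t])
  qed (simp add: coord_add[OF t] val_ideal_add)
  have "e i' j \<in> {x. crd x (i * h) \<in> val_ideal D 1}" if "i' < l" "1 \<le> j" "j < 1 + h" for i' j
  proof (cases "j = h")
    case True
    have "e i' j = \<epsilon> *s e i' 0" using e_h[OF that(1), of 0] True by simp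
    also have "e i' 0 = bv (i' * h)" using bv_index[of 0 i'] h_pos by simp
    finally show ?thesis using t index_rk[OF that(1), of 0] h_pos
      by (simp add: coord_scale coord_bv) (simp add: val_ideal_def)
  next
    case False
    then have j: "j < h" using that by simp
    have "i' * h + j \<noteq> i * h"
    proof
      assume "i' * h + j = i * h"
      then have "(i' * h + j) mod h = 0" by simp
      then show False using j that by simp
    qed
    then show ?thesis using t index_rk[OF that(1) j] by (simp add: coord_bv flip: bv_index[OF j])
  qed
  then have "Fil 1 \<subseteq> {x. crd x (i * h) \<in> val_ideal D 1}"
    unfolding Fil_fin by (intro O_span_min sub) auto
  then show "x \<in> Fil 1 \<Longrightarrow> ?thesis" by blast
qed

lemma e0_coord: "i < l \<Longrightarrow> i' < l \<Longrightarrow> crd (e i 0) (i' * h) = (if i = i' then 1 else 0)"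
  using bv_index[of 0 i] index_rk[of i 0] index_rk[of i' 0] h_pos coord_bv[of "i * h" "i' * h"] by auto

lemma e0_not_Fil1: "i < l \<Longrightarrow> e i 0 \<notin> Fil 1"
  using Fil1_coord[of "e i 0" i] e0_coord[of i i] by (auto simp: val_ideal_def)

text \<open>A linear functional on \<open>Fil 0 / Fil 1\<close> that vanishes on \<open>P'\<close> and is a coordinate with
  respect to a basis of \<open>Fil 0 / P'\<close> consisting of \<open>tau0\<close>-fixed vectors has coefficients fixed by
  the \<open>h\<close>-th power of Frobenius, so it lifts to an element of the automorphism group.\<close>

lemma smaller_translate:
  assumes P': "is_sub P'" "Fil 1 \<subseteq> P'" "P' \<subseteq> Fil 0" "P' \<noteq> Fil 0" "tau0 D ` P' \<subseteq> P'"
  shows "\<exists>k\<in>J_group D. P' \<subseteq> k ` M0 D \<and> k ` M0 D \<subseteq> M0 D \<and> k ` M0 D \<noteq> M0 D"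
proof -
  let ?B1 = "(\<lambda>i. e i 0) ` {..<l}"
  have B1: "{e i 0 | i. i < l} = ?B1" by auto
  have F0: "Fil 0 = msum (Fil 1) (O_span D ?B1)" using Fil_step[of 0] unfolding B1 by simp
  have epsP: "\<epsilon> *s w \<in> P'" if "w \<in> Fil 0" for w using eps_mem_Fil1[OF that] P'(2) by auto
  have "\<epsilon> *s w \<in> P'" if "w \<in> ?B1" for w
    using that epsP e_Fil[of _ 0 0] by blast
  then obtain B where B: "B \<subseteq> ?B1" "?B1 \<subseteq> msum P' (O_span D B)" "res_indep P' B"
    using res_indep_subset[OF P'(1), of ?B1] by blast
  have finB: "finite B" using B(1) finite_subset by blast
  have "B \<noteq> {}"
  proof
    assume "B = {}"
    then have "?B1 \<subseteq> P'" using B(2) msum_absorb[OF P'(1) sub_O_span[of "{}"]] sub_0[OF P'(1)]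
      by (simp add: O_span_empty)
    then have "Fil 0 \<subseteq> P'" unfolding F0 by (intro msum_le P' O_span_min)
    then show False using P' by blast
  qed
  then obtain s0 where s0: "s0 < l" "e s0 0 \<in> B" using B(1) by blast
  \<comment> \<open>The functional is the coordinate at this member of the basis \<open>B\<close> of
    \<open>Fil 0\<close> modulo \<open>P'\<close>; its value on e_{i,0} is the reduction of
    \<open>c i ?w\<close>.\<close>
  let ?w = "e s0 0"
  have "\<forall>i. \<exists>c. i < l \<longrightarrow> (\<forall>w\<in>B. c w \<in> \<O>) \<and> e i 0 - (\<Sum>w\<in>B. c w *s w) \<in> P'"
  proof (intro allI)
    fix i
    show "\<exists>c. i < l \<longrightarrow> (\<forall>w\<in>B. c w \<in> \<O>) \<and> e i 0 - (\<Sum>w\<in>B. c w *s w) \<in> P'"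
    proof (cases "i < l")
      case True
      then have "e i 0 \<in> msum P' (O_span D B)" using B(2) by blast
      then obtain p z where pz: "e i 0 = p + z" "p \<in> P'" "z \<in> O_span D B" by (rule msumE)
      then show ?thesis using O_span_finite[OF finB pz(3)] by (metis add_diff_cancel_right')
    qed simp
  qed
  from choice[OF this] obtain c
    where c': "\<forall>i. i < l \<longrightarrow> (\<forall>w\<in>B. c i w \<in> \<O>) \<and> e i 0 - (\<Sum>w\<in>B. c i w *s w) \<in> P'" by blast
  then have c: "\<And>i. i < l \<Longrightarrow> (\<forall>w\<in>B. c i w \<in> \<O>) \<and> e i 0 - (\<Sum>w\<in>B. c i w *s w) \<in> P'" by blast
  have indep: "red D (d w) = 0" if "\<And>w. w \<in> B \<Longrightarrow> d w \<in> \<O>" "(\<Sum>w\<in>B. d w *s w) \<in> P'" "w \<in> B" for d w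
    using B(3) that unfolding res_indep_def by blast
  have tauB: "tau0 D w = w" if "w \<in> B" for w using that B(1) tau0_e by auto
  \<comment> \<open>tau_0 fixes the e_{i,0} and maps \<open>P'\<close> into itself. Applying it to
    an expansion modulo \<open>P'\<close> replaces the coefficients by their images under the h-th
    Frobenius power, and expansions are unique after reduction.\<close>
  have fixc: "red D (c i ?w) ^ (CARD('k) ^ h) = red D (c i ?w)" if i: "i < l" for i
  proof -
    have cO: "c i w \<in> \<O>" if "w \<in> B" for w using c[OF i] that by blast
    have fO: "(frob D ^^ h) (c i w) \<in> \<O>" if "w \<in> B" for w using cO[OF that] by (simp add: frob_pow_val_ideal)
    have "tau0 D (e i 0 - (\<Sum>w\<in>B. c i w *s w)) = e i 0 - (\<Sum>w\<in>B. (frob D ^^ h) (c i w) *s w)"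
      unfolding semilin_diff[OF semilin_tau0] semilin_sum[OF semilin_tau0] tau0_scale tau0_e[OF i]
      using tauB by simp
    then have "e i 0 - (\<Sum>w\<in>B. (frob D ^^ h) (c i w) *s w) \<in> P'" using c[OF i] P'(5) by (metis image_subset_iff)
    from sub_diff[OF P'(1) conjunct2[OF c[OF i]] this]
    have "(\<Sum>w\<in>B. ((frob D ^^ h) (c i w) - c i w) *s w) \<in> P'"
      by (simp add: N.scale_left_diff_distrib sum_subtractf)
    then have "red D ((frob D ^^ h) (c i ?w) - c i ?w) = 0"
      by (intro indep[of "\<lambda>w. (frob D ^^ h) (c i w) - c i w"]) (auto intro: OO_diff cO fO s0)
    then show ?thesis using cO[OF s0(2)] fO[OF s0(2)] by (simp add: red_diff red_frob_pow)
  qed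
  have "\<exists>u. i < l \<longrightarrow> u \<in> \<O> \<and> (frob D ^^ h) u = u \<and> red D u = red D (c i ?w)" for i
    using teichmueller[OF fixc, of i] h_pos by (cases "i < l") auto
  then obtain u where u: "\<And>i. i < l \<Longrightarrow> u i \<in> \<O> \<and> (frob D ^^ h) (u i) = u i \<and> red D (u i) = red D (c i ?w)"
    by metis
  have red_s0: "red D (c s0 ?w) = 1"
  proof -
    have "(\<Sum>w\<in>B. (if w = ?w then 1 else 0) *s w) = ?w" using finB s0(2)
      by (simp add: if_distrib[where f = "\<lambda>c. c *s _"] sum.delta cong: if_cong)
    then have "(\<Sum>w\<in>B. ((if w = ?w then 1 else 0) - c s0 w) *s w) \<in> P'"
      using c[OF s0(1)] by (simp add: N.scale_left_diff_distrib sum_subtractf)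
    then have "red D ((if ?w = ?w then 1 else 0) - c s0 ?w) = 0"
      using c[OF s0(1)] s0(2) by (intro indep[of "\<lambda>w. (if w = ?w then 1 else 0) - c s0 w"]) (auto intro!: OO_diff OO_minus)
    then show ?thesis using c[OF s0(1)] s0(2) by (simp add: red_diff)
  qed
  \<comment> \<open>The vectors e_{i,0} - u_i e_{s0,0} lie in the kernel of the lifted functional,
    and e_{s0,1} makes up for the lost direction. Since the u_i are fixed by the h-th Frobenius
    power, all of them are fixed by tau_0.\<close>
  define y where "y = (\<lambda>i. if i = s0 then e s0 1 else e i 0 - u i *s ?w)"
  have fy: "tfix (y i)" if i: "i < l" for i
    unfolding tfix_def y_def using u[OF i] i s0
    by (simp add: semilin_diff[OF semilin_tau0] tau0_scale tau0_e)
  define Q where "Q = O_span D {(tau1 D ^^ j) (y i) | i j. i < l}"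
  have sQ: "is_sub Q" unfolding Q_def by (rule sub_O_span)
  have yQ: "(tau1 D ^^ j) (y i) \<in> Q" if "i < l" for i j
    unfolding Q_def using that by (intro O_span_inc) blast
  have s0Q: "e s0 j \<in> Q" if "1 \<le> j" for j
    using yQ[OF s0(1), of "j - 1"] that unfolding y_def by (simp add: tau1_pow_e)
  have tl: "(tau1 D ^^ j) (u i *s ?w) \<in> line (e s0 j)" if i: "i < l" for i j
  proof -
    have "u i *s ?w \<in> line ?w" using u[OF i] by (intro lineI) simp
    then have "(tau1 D ^^ j) (u i *s ?w) \<in> (tau1 D ^^ j) ` line ?w" by blast
    then show ?thesis using line_image[OF semilin_funpow[OF semilin_tau1]] by (simp add: tau1_pow_e)
  qed
  have Fil1Q: "Fil 1 \<subseteq> Q"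
    unfolding Fil_def
  proof (intro O_span_min sQ subsetI)
    fix x assume "x \<in> {e i j | i j. i < l \<and> 1 \<le> j}"
    then obtain i j where ij: "i < l" "1 \<le> j" "x = e i j" by blast
    show "x \<in> Q"
    proof (cases "i = s0")
      case False
      have "(tau1 D ^^ j) (y i) = e i j - (tau1 D ^^ j) (u i *s ?w)"
        unfolding y_def using False by (simp add: semilin_diff[OF semilin_funpow[OF semilin_tau1]] tau1_pow_e)
      then have "x = (tau1 D ^^ j) (y i) + (tau1 D ^^ j) (u i *s ?w)" using ij by simp
      moreover have "(tau1 D ^^ j) (u i *s ?w) \<in> Q" using tl[OF ij(1), of j] line_le[OF sQ s0Q[OF ij(2)]] by blast
      ultimately show ?thesis using yQ[OF ij(1)] sub_add[OF sQ] by simp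
    qed (use ij s0Q in simp)
  qed
  have J: "gen_map y \<in> J_group D" "gen_map y ` M0 D = Q"
    using gen_map_J[of y 1] fy Fil1Q unfolding Q_def by blast+
  have yF: "(tau1 D ^^ j) (y i) \<in> Fil j" if "i < l" for i j
  proof -
    have "y i \<in> Fil 0" unfolding y_def using u[OF that] that s0
      by (auto intro!: sub_diff sub_scale sub_Fil e_Fil)
    moreover have "(tau1 D ^^ j) ` Fil 0 = Fil j"
      using Fil_shift[OF semilin_funpow[OF semilin_tau1], of j j 0] by (simp add: tau1_pow_e add.commute)
    ultimately show ?thesis by blast
  qed
  have QM: "Q \<subseteq> M0 D"
    unfolding Q_def M0_eq using yF Fil_antimono by (intro O_span_min sub_Fil) blast
  have "P' \<subseteq> Q"
  proof
    fix p assume p: "p \<in> P'"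
    then have "p \<in> msum (Fil 1) (O_span D ?B1)" using P'(3) F0 by blast
    then obtain f z where fz: "p = f + z" "f \<in> Fil 1" "z \<in> O_span D ?B1" by (rule msumE)
    obtain x where x: "\<forall>i<l. x i \<in> \<O>" "z = (\<Sum>i<l. x i *s e i 0)" using O_span_lessThan[OF fz(3)] by blast
    have "z \<in> P'" using sub_diff[OF P'(1) p, of f] fz P'(2) by auto
    moreover have "(\<Sum>i<l. x i *s (e i 0 - (\<Sum>w\<in>B. c i w *s w))) \<in> P'"
      using x c by (intro sub_sum[OF P'(1)] sub_scale[OF P'(1)]) auto
    ultimately have "z - (\<Sum>i<l. x i *s (e i 0 - (\<Sum>w\<in>B. c i w *s w))) \<in> P'" by (rule sub_diff[OF P'(1)])
    also have "z - (\<Sum>i<l. x i *s (e i 0 - (\<Sum>w\<in>B. c i w *s w))) = (\<Sum>i<l. \<Sum>w\<in>B. (x i * c i w) *s w)"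
      unfolding x(2) by (simp add: N.scale_right_diff_distrib sum_subtractf N.scale_sum_right)
    also have "\<dots> = (\<Sum>w\<in>B. (\<Sum>i<l. x i * c i w) *s w)"
      by (subst sum.swap) (simp add: N.scale_sum_left)
    finally have "red D (\<Sum>i<l. x i * c i ?w) = 0"
      using x c s0 by (intro indep[of "\<lambda>w. \<Sum>i<l. x i * c i w"]) (auto intro!: OO_sum OO_mult)
    moreover have "red D (\<Sum>i<l. x i * c i ?w) = (\<Sum>i<l. red D (x i) * red D (c i ?w))"
      using x c s0 by (subst red_sum) (auto intro!: OO_mult sum.cong simp: red_mult)
    moreover have "\<dots> = red D (x s0) + (\<Sum>i\<in>{..<l} - {s0}. red D (x i) * red D (u i))"
      using s0 red_s0 u by (subst sum.remove[of _ s0]) auto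
    ultimately have 0: "red D (x s0) + (\<Sum>i\<in>{..<l} - {s0}. red D (x i) * red D (u i)) = 0" by simp
    \<comment> \<open>This is the lifted functional evaluated at \<open>z\<close>. It is divisible
      by \<epsilon> because the functional vanishes on \<open>P'\<close>, and z is ?d times e_{s0,0}
      plus a combination of the y_i.\<close>
    let ?d = "x s0 + (\<Sum>i\<in>{..<l} - {s0}. x i * u i)"
    have dO: "(\<Sum>i\<in>{..<l} - {s0}. x i * u i) \<in> \<O>" using x u by (intro OO_sum OO_mult) auto
    have "red D (\<Sum>i\<in>{..<l} - {s0}. x i * u i) = (\<Sum>i\<in>{..<l} - {s0}. red D (x i) * red D (u i))"
      using x u by (subst red_sum) (auto intro!: OO_mult sum.cong simp: red_mult)
    then have "red D ?d = 0" using 0 x s0 dO by (simp add: red_add)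
    moreover have "?d \<in> \<O>" using x s0 dO by (auto intro: OO_add)
    ultimately obtain d' where d': "d' \<in> \<O>" "?d = \<epsilon> * d'" using red_eq_0_iff by blast
    have "z = x s0 *s ?w + (\<Sum>i\<in>{..<l} - {s0}. x i *s e i 0)"
      unfolding x(2) using s0 by (subst sum.remove[of _ s0]) auto
    also have "(\<Sum>i\<in>{..<l} - {s0}. x i *s e i 0) = (\<Sum>i\<in>{..<l} - {s0}. x i *s y i + (x i * u i) *s ?w)"
      by (rule sum.cong) (auto simp: y_def N.scale_right_diff_distrib)
    finally have "z = ?d *s ?w + (\<Sum>i\<in>{..<l} - {s0}. x i *s y i)"
      by (simp add: sum.distrib N.scale_left_distrib N.scale_sum_left)
    moreover have "?d *s ?w \<in> Q"
    proof -
      have "?d *s ?w = d' *s (\<epsilon> *s ?w)" unfolding d'(2) by (simp add: mult.commute)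
      moreover have "\<epsilon> *s ?w \<in> Q" using e_h[OF s0(1), of 0] s0Q[OF h_pos] by simp
      ultimately show ?thesis using sub_scale[OF sQ d'(1)] by metis
    qed
    moreover have "(\<Sum>i\<in>{..<l} - {s0}. x i *s y i) \<in> Q"
    proof (rule sub_sum[OF sQ])
      fix i assume i: "i \<in> {..<l} - {s0}"
      show "x i *s y i \<in> Q" by (rule sub_scale[OF sQ]) (use x yQ[of i 0] i in auto)
    qed
    ultimately have "z \<in> Q" using sub_add[OF sQ] by simp
    then show "p \<in> Q" using fz Fil1Q sub_add[OF sQ] by blast
  qed
  moreover have "Q \<noteq> M0 D"
  proof
    assume eq: "Q = M0 D"
    let ?u = "\<lambda>i. if i = s0 then 1 else u i"
    \<comment> \<open>The vectors on which the functional vanishes modulo \<epsilon>.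
      \<open>Q\<close> lies inside, whereas \<open>?w\<close> in M_0 has value 1.\<close>
    let ?H = "{x \<in> M0 D. (\<Sum>i<l. crd x (i * h) * ?u i) \<in> val_ideal D 1}"
    have t: "i * h < rk D" if "i < l" for i using index_rk[OF that, of 0] h_pos by simp
    have uO: "?u i \<in> \<O>" if "i < l" for i using u[OF that] by simp
    have sM: "is_sub (M0 D)" unfolding M0_eq by (rule sub_Fil)
    have Hsub: "is_sub ?H"
    proof (rule subI)
      have "(\<Sum>i<l. crd 0 (i * h) * ?u i) = 0"
        using t coord_scale[of _ 0 0] by (intro sum.neutral) simp
      then show "0 \<in> ?H" using sub_0[OF sM] by (simp only: mem_Collect_eq val_ideal_0)
      show "x + x' \<in> ?H" if "x \<in> ?H" "x' \<in> ?H" for x x'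
      proof -
        have "(\<Sum>i<l. crd (x + x') (i * h) * ?u i) = (\<Sum>i<l. crd x (i * h) * ?u i) + (\<Sum>i<l. crd x' (i * h) * ?u i)"
          unfolding sum.distrib[symmetric] using t by (intro sum.cong refl) (simp only: coord_add distrib_right lessThan_iff)
        then show ?thesis using that sub_add[OF sM] val_ideal_add by (simp only: mem_Collect_eq)
      qed
      show "a *s x \<in> ?H" if "a \<in> \<O>" "x \<in> ?H" for a x
      proof -
        have "(\<Sum>i<l. crd (a *s x) (i * h) * ?u i) = a * (\<Sum>i<l. crd x (i * h) * ?u i)"
          unfolding sum_distrib_left using t by (intro sum.cong refl) (simp only: coord_scale mult.assoc lessThan_iff)
        then show ?thesis using that sub_scale[OF sM] val_ideal_mult[of a 0 _ 1] by (simp only: mem_Collect_eq) simp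
      qed
    qed
    have Fil1H: "Fil 1 \<subseteq> ?H"
    proof
      fix x assume x: "x \<in> Fil 1"
      have "(\<Sum>i<l. crd x (i * h) * ?u i) \<in> val_ideal D 1"
      proof -
        have "crd x (i * h) * ?u i \<in> val_ideal D 1" if "i < l" for i
          using val_ideal_mult[OF Fil1_coord[OF x that] uO[OF that]] by simp
        then show ?thesis by (intro val_ideal_sum) blast
      qed
      then show "x \<in> ?H" using x Fil_antimono[of 0 1] unfolding M0_eq by auto
    qed
    have "Q \<subseteq> ?H"
      unfolding Q_def
    proof (intro O_span_min Hsub subsetI)
      fix x assume "x \<in> {(tau1 D ^^ j) (y i) | i j. i < l}"
      then obtain i j where ij: "x = (tau1 D ^^ j) (y i)" "i < l" by blast
      show "x \<in> ?H"
      proof (cases "j \<ge> 1 \<or> i = s0")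
        case True
        have "x \<in> Fil 1"
        proof (cases "j \<ge> 1")
          case True
          then show ?thesis using yF[OF ij(2), of j] ij(1) Fil_antimono[of 1 j] by auto
        next
          case False
          then have "j = 0" by simp
          then have "x = e s0 1" using True ij(1) by (simp add: y_def)
          then show ?thesis using e_Fil[OF s0(1), of 1 1] by simp
        qed
        then show ?thesis using Fil1H by blast
      next
        case False
        then have j0: "j = 0" "i \<noteq> s0" by auto
        then have xy: "x = e i 0 - u i *s ?w" "i \<noteq> s0" using ij(1) unfolding y_def by auto
        have "crd x (i' * h) = (if i' = i then 1 else 0) - u i * (if i' = s0 then 1 else 0)" if "i' < l" for i'
        proof -
          have "crd (e i 0 + (- u i) *s ?w) (i' * h) = crd (e i 0) (i' * h) + (- u i) * crd ?w (i' * h)"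
            using t[OF that] by (simp only: coord_add coord_scale)
          then show ?thesis unfolding xy(1) using e0_coord[OF ij(2) that] e0_coord[OF s0(1) that] by auto
        qed
        then have "(\<Sum>i'<l. crd x (i' * h) * ?u i') = (\<Sum>i'<l. (if i' = i then u i else 0) - (if i' = s0 then u i else 0))"
          using xy(2) by (intro sum.cong) auto
        also have "\<dots> = 0" using ij(2) s0(1) by (simp add: sum_subtractf)
        finally have "(\<Sum>i'<l. crd x (i' * h) * ?u i') \<in> val_ideal D 1" by (simp only: val_ideal_0)
        moreover have "x \<in> M0 D" unfolding ij(1) M0_eq using yF[OF ij(2), of j] Fil_antimono[of 0 j] by auto
        ultimately show ?thesis by blast
      qed
    qed
    then have "?w \<in> ?H" using eq e_Fil[OF s0(1), of 0 0] unfolding M0_eq by auto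
    moreover have "(\<Sum>i<l. crd ?w (i * h) * ?u i) = (\<Sum>i<l. if i = s0 then 1 else 0)"
      using e0_coord[OF s0(1)] by (intro sum.cong) auto
    ultimately show False using s0(1) by (auto simp: val_ideal_def)
  qed
  ultimately show ?thesis using J QM by blast
qed

subsection \<open>Normalized lattices\<close>

definition normalized :: "'n set \<Rightarrow> bool" where
  "normalized M \<longleftrightarrow> M \<subseteq> M0 D \<and> (\<forall>k\<in>J_group D. M \<subseteq> k ` M0 D \<longrightarrow> k ` M0 D \<subseteq> M0 D \<longrightarrow> k ` M0 D = M0 D)"

lemma len_sandwich:
  assumes g: "g \<in> GL D" "k \<in> GL D" and le: "g ` M0 D \<subseteq> k ` M0 D"
  shows "\<exists>n. len (k ` M0 D) (g ` M0 D) n"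
proof -
  have "Hilbert_Choice.inv k \<circ> g \<in> GL D" by (intro GL_comp GL_inv g)
  then obtain K where K: "Fil K \<subseteq> (Hilbert_Choice.inv k \<circ> g) ` M0 D" using lattice_Fil by blast
  have bk: "bij k" by (rule semilin_bij[OF semilin_GL[OF g(2)]])
  have "k ` Fil K \<subseteq> k ` (Hilbert_Choice.inv k ` (g ` M0 D))" using K by (intro image_mono) (simp add: image_comp)
  then have 1: "k ` Fil K \<subseteq> g ` M0 D" unfolding image_inv_image[OF bk] .
  obtain n where "len (M0 D) (Fil K) n" using len_Fil[of 0 K] unfolding M0_eq by auto
  then have "len (k ` M0 D) (k ` Fil K) n" by (rule len_image[OF _ semilin_GL[OF g(2)]])
  then show ?thesis using len_split[OF _ sub_lattice[OF g(1)] 1 le] by blast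
qed

text \<open>A sufficiently negative power of \<epsilon> gives some translate jM_0 that contains the
  lattice. One with the least length over the lattice admits no smaller translate in between; j^(-1)
  then does the normalizing.\<close>

lemma normalize:
  assumes g: "g \<in> GL D"
  shows "\<exists>p\<in>J_group D. normalized (p ` g ` M0 D)"
proof -
  let ?M = "g ` M0 D"
  let ?Q = "\<lambda>n. \<exists>j\<in>J_group D. len (j ` M0 D) ?M n"
  obtain N where N: "\<forall>x\<in>?M. \<epsilon> ^ N *s x \<in> M0 D" using lattice_bound[OF g, of 0] unfolding M0_eq by blast
  let ?j = "\<lambda>x. \<epsilon> powi (- int N) *s x"
  have j: "?j \<in> J_group D" by (rule J_eps)
  have "?M \<subseteq> ?j ` M0 D"
  proof
    fix x assume "x \<in> ?M"
    then have "x = ?j (\<epsilon> ^ N *s x)" "\<epsilon> ^ N *s x \<in> M0 D" using N by (auto simp: power_int_minus)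
    then show "x \<in> ?j ` M0 D" by blast
  qed
  then have "\<exists>n. ?Q n" using len_sandwich[OF g J_GL[OF j]] j by blast
  then have "?Q (LEAST n. ?Q n)" by (rule LeastI_ex)
  then obtain j where j: "j \<in> J_group D" "len (j ` M0 D) ?M (LEAST n. ?Q n)" by blast
  have bj: "bij j" by (rule J_bij[OF j(1)])
  have "normalized (Hilbert_Choice.inv j ` ?M)"
    unfolding normalized_def
  proof (intro conjI ballI impI)
    have "Hilbert_Choice.inv j ` ?M \<subseteq> Hilbert_Choice.inv j ` (j ` M0 D)"
      using len_sub[OF j(2)] by (intro image_mono) blast
    then show "Hilbert_Choice.inv j ` ?M \<subseteq> M0 D" unfolding inv_inv_image[OF bj] .
  next
    fix k assume k: "k \<in> J_group D" "Hilbert_Choice.inv j ` ?M \<subseteq> k ` M0 D" "k ` M0 D \<subseteq> M0 D"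
    have jk: "j \<circ> k \<in> J_group D" by (intro J_comp j k)
    have "j ` (Hilbert_Choice.inv j ` ?M) \<subseteq> j ` (k ` M0 D)" by (rule image_mono[OF k(2)])
    then have Mjk: "?M \<subseteq> (j \<circ> k) ` M0 D" unfolding image_inv_image[OF bj] by (simp add: image_comp)
    have jkj: "(j \<circ> k) ` M0 D \<subseteq> j ` M0 D" using image_mono[OF k(3), of j] by (simp add: image_comp)
    obtain n1 n2 where n: "len (j ` M0 D) ((j \<circ> k) ` M0 D) n1" "len ((j \<circ> k) ` M0 D) ?M n2"
      "n1 + n2 = (LEAST n. ?Q n)"
      using len_split[OF j(2) sub_lattice[OF J_GL[OF jk]] Mjk jkj] by blast
    have "(LEAST n. ?Q n) \<le> n2" using jk n(2) by (intro Least_le) blast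
    then have "n1 = 0" using n(3) by simp
    then have "j ` M0 D = (j \<circ> k) ` M0 D" using n(1) len_0_eq by blast
    then have "Hilbert_Choice.inv j ` (j ` M0 D) = Hilbert_Choice.inv j ` (j ` (k ` M0 D))" by (simp add: image_comp)
    then show "k ` M0 D = M0 D" unfolding inv_inv_image[OF bj] by simp
  qed
  then show ?thesis using J_inv[OF j(1)] by blast
qed

section \<open>The submodule Phi M + V M and the a-invariant\<close>

definition PV :: "'n set \<Rightarrow> 'n set" where
  "PV M = msum (Phi D ` M) (Ver D ` M)"

lemma a_invariant_PV: "a_invariant D M = residue_dim D M (PV M)"
proof -
  have "{Phi D x + Ver D y | x y. x \<in> M \<and> y \<in> M} = PV M"
    unfolding PV_def msum_def by blast
  then show ?thesis unfolding a_invariant_def by simp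
qed

lemma sub_PV: "is_sub M \<Longrightarrow> is_sub (PV M)"
  unfolding PV_def by (intro sub_msum sub_image semilin_Phi semilin_Ver)

lemma PV_le: "is_sub M \<Longrightarrow> dieudonne M \<Longrightarrow> PV M \<subseteq> M"
  unfolding PV_def dieudonne_def by (intro msum_le) auto

lemma eps_PV: "is_sub M \<Longrightarrow> dieudonne M \<Longrightarrow> w \<in> M \<Longrightarrow> \<epsilon> *s w \<in> PV M"
proof -
  assume M: "is_sub M" "dieudonne M" "w \<in> M"
  then have "Ver D w \<in> M" unfolding dieudonne_def by blast
  then have "\<epsilon> *s w \<in> Phi D ` M" using Phi_Ver[of w] by (metis imageI)
  then show ?thesis unfolding PV_def using msum_ge1[OF sub_image[OF semilin_Ver M(1)]] by blast
qed

lemma a_invariant_1_iff: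
  assumes g: "g \<in> GL D" "dieudonne (g ` M0 D)"
  shows "a_invariant D (g ` M0 D) = 1 \<longleftrightarrow>
    (\<exists>v\<in>g ` M0 D. v \<notin> PV (g ` M0 D) \<and> g ` M0 D = msum (PV (g ` M0 D)) (line v))"
proof -
  obtain B where B: "finite B" "g ` M0 D = O_span D B" using lattice_fin[OF g(1)] by blast
  note s = sub_lattice[OF g(1)]
  show ?thesis unfolding a_invariant_PV
    by (rule residue_dim_1_iff[OF sub_PV[OF s] B PV_le[OF s g(2)] eps_PV[OF s g(2)]])
qed

lemma PV_image: "p \<in> J_group D \<Longrightarrow> p ` PV M = PV (p ` M)"
proof -
  assume p: "p \<in> J_group D"
  have "p ` Phi D ` M = Phi D ` p ` M" "p ` Ver D ` M = Ver D ` p ` M"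
    by (simp_all add: image_image J_Phi[OF p] J_Ver[OF p])
  then show ?thesis unfolding PV_def msum_image[OF J_semilin[OF p]] by simp
qed

lemma a_invariant_1_J:
  assumes g: "g \<in> GL D" "dieudonne (g ` M0 D)" and p: "p \<in> J_group D" and a: "a_invariant D (g ` M0 D) = 1"
  shows "a_invariant D (p ` g ` M0 D) = 1"
proof -
  let ?M = "g ` M0 D"
  obtain v where v: "v \<in> ?M" "v \<notin> PV ?M" "?M = msum (PV ?M) (line v)"
    using a a_invariant_1_iff[OF g] by blast
  have pg: "p \<circ> g \<in> GL D" by (intro GL_comp J_GL p g)
  have pM: "(p \<circ> g) ` M0 D = p ` ?M" by (simp add: image_comp)
  have "p v \<in> p ` ?M" using v(1) by blast
  moreover have "p v \<notin> PV (p ` ?M)"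
    unfolding PV_image[OF p, symmetric] using v(2) semilin_inj[OF J_semilin[OF p], of v] by (metis imageE)
  moreover have "p ` ?M = msum (PV (p ` ?M)) (line (p v))"
    unfolding PV_image[OF p, symmetric] line_image[OF J_semilin[OF p], symmetric]
      msum_image[OF J_semilin[OF p], symmetric] using v(3) by simp
  ultimately show ?thesis
    using a_invariant_1_iff[OF pg] J_dieudonne[OF p g(2)] unfolding pM by blast
qed

text \<open>A semilinear bijection preserving one lattice preserves lengths, so it cannot shrink another
  lattice.\<close>

lemma no_shrink:
  assumes T: "semilin T" and F: "\<And>k. T ` Fil k = Fil k" and g: "g \<in> GL D" and M: "T ` g ` M0 D \<subseteq> g ` M0 D"
  shows "T ` g ` M0 D = g ` M0 D"
proof -
  let ?M = "g ` M0 D"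
  obtain K where K: "Fil K \<subseteq> ?M" using lattice_Fil[OF g] by blast
  obtain K' where K': "Fil K' \<subseteq> Hilbert_Choice.inv g ` M0 D" using lattice_Fil[OF GL_inv[OF g]] by blast
  have 1: "g ` Fil K' \<subseteq> M0 D"
    using image_mono[OF K', of g] image_inv_image[OF semilin_bij[OF semilin_GL[OF g]]] by metis
  have "\<exists>n. len ?M (Fil K) n"
  proof -
    obtain h' where h': "h' \<in> J_group D" "h' ` M0 D = Fil K" using Fil_J by blast
    then show ?thesis using len_sandwich[OF J_GL[OF h'(1)] g] K by simp
  qed
  then obtain n where n: "len ?M (Fil K) n" by blast
  then have Tn: "len (T ` ?M) (Fil K) n" using len_image[OF n T] F by simp
  obtain n1 n2 where "len ?M (T ` ?M) n1" "len (T ` ?M) (Fil K) n2" "n1 + n2 = n"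
    using len_split[OF n _ _ M] len_sub[OF Tn] by blast
  then have "n1 = 0" using len_unique[OF Tn] by fastforce
  then show ?thesis using \<open>len ?M (T ` ?M) n1\<close> len_0_eq[of ?M "T ` ?M"] by simp
qed

lemma degenerate_a_invariant:
  assumes "m = 0 \<or> m = h" and g: "g \<in> GL D" "dieudonne (g ` M0 D)"
  shows "a_invariant D (g ` M0 D) \<noteq> 1"
proof -
  let ?M = "g ` M0 D"
  have "Phi D ` ?M = ?M \<or> Ver D ` ?M = ?M"
  proof (cases "m = 0")
    case True
    then show ?thesis using no_shrink[OF semilin_Phi _ g(1)] g(2) Phi_Fil unfolding dieudonne_def by simp
  next
    case False
    then show ?thesis using assms(1) no_shrink[OF semilin_Ver _ g(1)] g(2) Ver_Fil unfolding dieudonne_def by simp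
  qed
  then have "?M \<subseteq> PV ?M"
    unfolding PV_def
    using msum_ge1[OF sub_image[OF semilin_Ver sub_lattice[OF g(1)]], of "Phi D ` ?M"]
      msum_ge2[OF sub_image[OF semilin_Phi sub_lattice[OF g(1)]], of "Ver D ` ?M"] by auto
  then show ?thesis using a_invariant_1_iff[OF g] by blast
qed

end

section \<open>Lattices generated by one element\<close>

context nondegenerate_isocrystal
begin

lemma PV_Fil: "M \<subseteq> Fil k \<Longrightarrow> PV M \<subseteq> Fil (Suc k)"
proof -
  assume M: "M \<subseteq> Fil k"
  have "Phi D ` M \<subseteq> Fil (k + m)" "Ver D ` M \<subseteq> Fil (k + (h - m))"
    using image_mono[OF M] Phi_Fil Ver_Fil by metis+
  then have "Phi D ` M \<subseteq> Fil (Suc k)" "Ver D ` M \<subseteq> Fil (Suc k)"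
  proof -
    have "Suc k \<le> k + m" "Suc k \<le> k + (h - m)" using pq by linarith+
    then have "Fil (k + m) \<subseteq> Fil (Suc k)" "Fil (k + (h - m)) \<subseteq> Fil (Suc k)" by (intro Fil_antimono; simp)+
    then show "Phi D ` M \<subseteq> Fil (Suc k)" "Ver D ` M \<subseteq> Fil (Suc k)"
      using \<open>Phi D ` M \<subseteq> Fil (k + m)\<close> \<open>Ver D ` M \<subseteq> Fil (k + (h - m))\<close> by blast+
  qed
  then show ?thesis unfolding PV_def by (intro msum_le sub_Fil)
qed

text \<open>Phi M + V M lies in \<open>Fil 1\<close>, so any \<open>P'\<close> containing
  \<open>v\<close> and \<open>Fil 1\<close> contains M. If \<open>P'\<close> were proper,
  \<open>smaller_translate\<close> would contradict minimality.\<close>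

lemma good_generator:
  assumes M: "normalized M" and v: "v \<in> M" "M = msum (PV M) (line v)"
  shows "good v"
  unfolding good_def
proof (intro conjI allI impI)
  have MF: "M \<subseteq> Fil 0" using M unfolding normalized_def M0_eq by blast
  show "v \<in> Fil 0" using MF v by blast
  fix P' assume P': "is_sub P'" "Fil 1 \<subseteq> P'" "P' \<subseteq> Fil 0" "v \<in> P'" "tau0 D ` P' \<subseteq> P'"
  show "P' = Fil 0"
  proof (rule ccontr)
    assume "P' \<noteq> Fil 0"
    then obtain k where k: "k \<in> J_group D" "P' \<subseteq> k ` M0 D" "k ` M0 D \<subseteq> M0 D" "k ` M0 D \<noteq> M0 D"
      using smaller_translate[OF P'(1-3) _ P'(5)] by blast
    have "PV M \<subseteq> P'" using PV_Fil[OF MF] P'(2) by auto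
    then have "msum (PV M) (line v) \<subseteq> P'" by (intro msum_le line_le P')
    then have "M \<subseteq> k ` M0 D" using v(2) k(2) by blast
    then show False using M k unfolding normalized_def by blast
  qed
qed

lemma good_not_Fil1: "good v \<Longrightarrow> v \<notin> Fil 1"
proof
  assume v: "good v" "v \<in> Fil 1"
  have "Fil 1 = Fil 0"
    using v sub_Fil[of 1] tau0_Fil[of 1] Fil_antimono[of 0 1] unfolding good_def by auto
  then show False using e0_not_Fil1[OF ncomp_pos] e_Fil[OF ncomp_pos, of 0 0] by simp
qed

lemma Dl_stable: "Phi D ` Dl v 0 \<subseteq> Dl v 0" "Ver D ` Dl v 0 \<subseteq> Dl v 0"
proof -
  have 1: "Phi D ` {mon v a b | a b. 0 \<le> a * m + b * (h - m)} \<subseteq> Dl v 0"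
    using Phi_mon mon_Dl[of 0] by auto
  have 2: "Ver D ` {mon v a b | a b. 0 \<le> a * m + b * (h - m)} \<subseteq> Dl v 0"
    using Ver_mon mon_Dl[of 0] by auto
  show "Phi D ` Dl v 0 \<subseteq> Dl v 0"
    using O_span_min[OF sub_Dl 1] unfolding O_span_image[OF semilin_Phi, symmetric] Dl_def[of v 0, symmetric] .
  show "Ver D ` Dl v 0 \<subseteq> Dl v 0"
    using O_span_min[OF sub_Dl 2] unfolding O_span_image[OF semilin_Ver, symmetric] Dl_def[of v 0, symmetric] .
qed

lemma v_Dl: "v \<in> Dl v 0"
  using mon_Dl[of 0 0 0 v] by (simp add: mon_def)

lemma Dl_min: 
  assumes M: "is_sub M" "dieudonne M" and v: "v \<in> M" shows "Dl v 0 \<subseteq> M"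
proof -
  have V: "(Ver D ^^ b) v \<in> M" for b using M(2) v unfolding dieudonne_def by (induction b) auto
  have "mon v a b \<in> M" for a b
    unfolding mon_def using M(2) V[of b] unfolding dieudonne_def by (induction a) auto
  then show ?thesis unfolding Dl_def by (intro O_span_min M) blast
qed

text \<open>Substituting M = Phi M + V M + Ov into itself improves the inclusion of M in Dl + (M
  \<inter> Fil k) by one level at a time. At level K + h the error lies in \<epsilon> Fil K, hence
  in \<epsilon>M, and Nakayama finishes.\<close>

lemma generated_Dl:
  assumes fin: "finite B" "M = O_span D B" and M: "dieudonne M" "M \<subseteq> Fil 0" "Fil K \<subseteq> M"
    and v: "v \<in> M" "M = msum (PV M) (line v)"
  shows "M = Dl v 0"
proof
  have sM: "is_sub M" using fin sub_O_span by simp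
  show "Dl v 0 \<subseteq> M" by (rule Dl_min[OF sM M(1) v(1)])
  have approx: "M \<subseteq> msum (Dl v 0) (M \<inter> Fil k)" for k
  proof (induction k)
    case 0
    then show ?case using M(2) msum_ge2[OF sub_Dl, of "M \<inter> Fil 0"] by auto
  next
    case (Suc k)
    let ?S = "msum (Dl v 0) (M \<inter> Fil (Suc k))"
    have sS: "is_sub ?S" by (intro sub_msum sub_Dl sub_Int sM sub_Fil)
    have DS: "Dl v 0 \<subseteq> ?S" by (intro msum_ge1 sub_Int sM sub_Fil)
    have "PV (M \<inter> Fil k) \<subseteq> M \<inter> Fil (Suc k)"
    proof -
      have "PV (M \<inter> Fil k) \<subseteq> PV M" unfolding PV_def by (intro msum_mono image_mono) auto
      then show ?thesis using PV_Fil[of "M \<inter> Fil k" k] PV_le[OF sM M(1)] by auto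
    qed
    then have PVS: "PV (M \<inter> Fil k) \<subseteq> ?S" using msum_ge2[OF sub_Dl] by blast
    have sI: "is_sub (M \<inter> Fil k)" by (intro sub_Int sM sub_Fil)
    have "Phi D ` M \<subseteq> ?S"
    proof
      fix x assume "x \<in> Phi D ` M"
      then obtain d f where df: "x = Phi D (d + f)" "d \<in> Dl v 0" "f \<in> M \<inter> Fil k"
        using Suc by (blast elim: msumE)
      have "Phi D f \<in> PV (M \<inter> Fil k)"
        unfolding PV_def using msum_ge1[OF sub_image[OF semilin_Ver sI], of "Phi D ` (M \<inter> Fil k)"] df(3) by blast
      moreover have "Phi D d \<in> Dl v 0" using Dl_stable df(2) by blast
      ultimately show "x \<in> ?S" unfolding df(1) Phi_add using DS PVS sub_add[OF sS] by blast
    qed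
    moreover have "Ver D ` M \<subseteq> ?S"
    proof
      fix x assume "x \<in> Ver D ` M"
      then obtain d f where df: "x = Ver D (d + f)" "d \<in> Dl v 0" "f \<in> M \<inter> Fil k"
        using Suc by (blast elim: msumE)
      have "Ver D f \<in> PV (M \<inter> Fil k)"
        unfolding PV_def using msum_ge2[OF sub_image[OF semilin_Phi sI], of "Ver D ` (M \<inter> Fil k)"] df(3) by blast
      moreover have "Ver D d \<in> Dl v 0" using Dl_stable df(2) by blast
      ultimately show "x \<in> ?S" unfolding df(1) semilin_add[OF semilin_Ver] using DS PVS sub_add[OF sS] by blast
    qed
    ultimately have "PV M \<subseteq> ?S" unfolding PV_def by (intro msum_le sS)
    then have "msum (PV M) (line v) \<subseteq> ?S" using DS v_Dl by (intro msum_le line_le sS) auto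
    then show ?case using v(2) by blast
  qed
  show "M \<subseteq> Dl v 0"
  proof (rule nakayama_span[OF fin(1) sub_Dl fin(2)])
    fix x assume "x \<in> M"
    then obtain d f where df: "x = d + f" "d \<in> Dl v 0" "f \<in> Fil (K + h)"
      using approx[of "K + h"] by (blast elim: msumE)
    then obtain s where "f = \<epsilon> *s s" "s \<in> Fil K" using eps_Fil[of K] by blast
    then show "\<exists>a\<in>Dl v 0. \<exists>s\<in>M. x = a + \<epsilon> *s s" using df M(3) by blast
  qed
qed

lemma Dl_generated:
  assumes v: "good v" and M: "M = Dl v 0"
  shows "v \<in> M" "v \<notin> PV M" "M = msum (PV M) (line v)"
proof -
  have sM: "is_sub M" and dM: "dieudonne M" using M sub_Dl Dl_stable unfolding dieudonne_def by auto
  show "v \<in> M" using M v_Dl by simp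
  have "M \<subseteq> Fil 0" using M Dl_Fil v unfolding good_def by blast
  then show "v \<notin> PV M" using PV_Fil[of M 0] good_not_Fil1[OF v] by auto
  show "M = msum (PV M) (line v)"
  proof
    show "msum (PV M) (line v) \<subseteq> M" using PV_le[OF sM dM] \<open>v \<in> M\<close> sM by (intro msum_le line_le)
    have "mon v a b \<in> msum (PV M) (line v)" for a b
    proof (cases "a = 0 \<and> b = 0")
      case True
      then show ?thesis using msum_line_mem[OF sub_PV[OF sM]] by (simp add: mon_def)
    next
      case False
      have mM: "mon v a b \<in> M" for a b unfolding M by (rule mon_Dl) simp
      have "mon v a b \<in> PV M"
      proof (cases a)
        case (Suc a')
        then have "mon v a b \<in> Phi D ` M" using Phi_mon[of v a' b] mM by (metis imageI)
        then show ?thesis unfolding PV_def using msum_ge1[OF sub_image[OF semilin_Ver sM]] by blast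
      next
        case 0
        then obtain b' where "b = Suc b'" using False not0_implies_Suc by blast
        then have "mon v a b \<in> Ver D ` M" using Ver_mon[of v a b'] mM by (metis imageI)
        then show ?thesis unfolding PV_def using msum_ge2[OF sub_image[OF semilin_Phi sM]] by blast
      qed
      then show ?thesis using msum_ge1[OF sub_line] by blast
    qed
    then show "M \<subseteq> msum (PV M) (line v)"
      unfolding M[unfolded Dl_def] using sM by (intro O_span_min sub_msum sub_PV sub_line) (auto simp: M[unfolded Dl_def])
  qed
qed

lemma J_lattice_stable:
  assumes "j \<in> J_group D"
  shows "is_sub (j ` M0 D)" "tau0 D ` (j ` M0 D) \<subseteq> j ` M0 D" "tau1 D ` (j ` M0 D) \<subseteq> j ` M0 D"
proof -
  show "is_sub (j ` M0 D)" by (rule sub_lattice[OF J_GL[OF assms]])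
  have "tau0 D ` (j ` M0 D) = j ` (tau0 D ` M0 D)" by (simp add: image_image J_tau0[OF assms])
  then show "tau0 D ` (j ` M0 D) \<subseteq> j ` M0 D" using tau0_Fil unfolding M0_eq by simp
  have "tau1 D ` (j ` M0 D) = j ` (tau1 D ` M0 D)" by (simp add: image_image J_tau1[OF assms])
  then show "tau1 D ` (j ` M0 D) \<subseteq> j ` M0 D"
    using tau1_Fil[of 0] Fil_antimono[of 0 1] unfolding M0_eq by auto
qed

text \<open>The value in \<open>length_formula\<close> involves only j, m and h, so all good vectors
  share it.\<close>

lemma len_good:
  assumes v: "good v" "good v'" and j: "j \<in> J_group D"
  shows "\<exists>n. len (Dl v 0) (Dl v 0 \<inter> j ` M0 D) n \<and> len (Dl v' 0) (Dl v' 0 \<inter> j ` M0 D) n"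
proof -
  obtain K where "Fil K \<subseteq> j ` M0 D" using lattice_Fil[OF J_GL[OF j]] by blast
  then show ?thesis
    using length_formula[OF J_lattice_stable[OF j] v(1)] length_formula[OF J_lattice_stable[OF j] v(2)] by blast
qed

end

section \<open>Recovering a dominant cocharacter from lengths\<close>

text \<open>The function n \<mapsto> max(n - a, 0) has its only kink at a, so its second difference
  is the indicator of n = a. Summed over a list, second differences therefore count
  multiplicities.\<close>

lemma nat_second_difference:
  "nat (n + 1 - a) + nat (n - 1 - a) = 2 * nat (n - a) + (if a = n then 1 else 0)" for a n :: int
  by auto

lemma count_list_second_difference:
  "(\<Sum>a\<leftarrow>xs. nat (n + 1 - a)) + (\<Sum>a\<leftarrow>xs. nat (n - 1 - a)) = 2 * (\<Sum>a\<leftarrow>xs. nat (n - a)) + count_list xs n"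
  for n :: int
proof (induction xs)
  case (Cons a xs)
  then show ?case using nat_second_difference[of n a] by (cases "a = n") auto
qed simp

lemma dominant_eqI:
  fixes xs ys :: "int list"
  assumes "sorted_wrt (\<ge>) xs" "sorted_wrt (\<ge>) ys"
    and eq: "\<And>n. (\<Sum>a\<leftarrow>xs. nat (n - a)) = (\<Sum>a\<leftarrow>ys. nat (n - a))"
  shows "xs = ys"
proof -
  have "count_list xs n = count_list ys n" for n
    using count_list_second_difference[where xs = xs and n = n]
      count_list_second_difference[where xs = ys and n = n] eq[of "n + 1"] eq[of "n - 1"] eq[of n] by linarith
  then have "mset xs = mset ys" by (intro multiset_eqI) (simp add: count_mset)
  then have "mset (rev xs) = mset (rev ys)" by simp
  moreover have "sorted (rev xs)" "sorted (rev ys)" using assms by (simp_all add: sorted_wrt_rev)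
  ultimately have "rev xs = rev ys" by (metis properties_for_sort)
  then show ?thesis by simp
qed

context isocrystal_over
begin

subsection \<open>Elementary divisors\<close>

lemma O_span_le_span: "O_span D S \<subseteq> N.span S"
  by (rule O_span_min) (auto intro!: subI N.span_zero intro: N.span_add N.span_scale N.span_base)

text \<open>Pivot on an entry of minimal valuation of the matrix expressing \<open>W\<close> by \<open>U\<close>.\<close>

lemma elementary_divisors:
  "finite U \<Longrightarrow> N.independent U \<Longrightarrow> finite W \<Longrightarrow> N.span W = N.span U \<Longrightarrow>
    \<exists>Z f. finite Z \<and> card Z = card U \<and> O_span D Z = O_span D U \<and>
      O_span D ((\<lambda>z. \<epsilon> powi (f z) *s z) ` Z) = O_span D W"
  for U W :: "'n set"
proof (induction "card U" arbitrary: U W)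
  case 0
  then have U: "U = {}" by simp
  then have "W \<subseteq> {0}" using 0 N.span_superset[of W] by simp
  then have "O_span D W = {0}"
    using O_span_min[of "{0}" W] sub_0[OF sub_O_span[of W]] O_span_empty sub_O_span[of "{}"] by auto
  then show ?case unfolding U by (intro exI[of _ "{}"]) (simp add: O_span_empty)
next
  case (Suc n)
  define A where "A = (\<lambda>y x. N.representation U y x)"
  have rep: "(\<Sum>x\<in>U. A y x *s x) = y" if "y \<in> N.span U" for y
    unfolding A_def using Suc.prems that by (intro N.sum_representation_eq) auto
  let ?E = "{(y, x). y \<in> W \<and> x \<in> U \<and> A y x \<noteq> 0}"
  have "finite (W \<times> U)" using Suc.prems by simp
  then have finE: "finite ?E" by (rule finite_subset[rotated]) auto
  have "?E \<noteq> {}"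
  proof
    assume "?E = {}"
    then have 0: "y = 0" if "y \<in> W" for y
    proof -
      have yU: "y \<in> N.span U" using that Suc.prems N.span_superset by blast
      have "(\<Sum>x\<in>U. A y x *s x) = 0"
        using that \<open>?E = {}\<close> by (intro sum.neutral) auto
      then show ?thesis unfolding rep[OF yU] .
    qed
    then have "W \<subseteq> {0}" by blast
    then have "N.span W \<subseteq> {0}" using N.span_mono[of W "{0}"] by simp
    then have "U \<subseteq> {0}" using Suc.prems N.span_superset[of U] by simp
    moreover have "0 \<notin> U" using Suc.prems N.dependent_zero by blast
    ultimately have "U = {}" by blast
    then show False using Suc.hyps(2) by simp
  qed
  then obtain y1 x1 where p: "(y1, x1) \<in> ?E" "\<And>y x. (y, x) \<in> ?E \<Longrightarrow> val D (A y1 x1) \<le> val D (A y x)"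
    using ex_min_if_finite[of "(\<lambda>(y, x). val D (A y x)) ` ?E"] finE
    by (auto simp: not_less)
  have p1: "y1 \<in> W" "x1 \<in> U" "A y1 x1 \<noteq> 0" using p(1) by auto
  define v where "v = val D (A y1 x1)"
  \<comment> \<open>Removing the minimal valuation from y1 keeps its coefficients integral and makes
    the one at x1 a unit, so \<open>z\<close> can replace \<open>x1\<close> in the basis.\<close>
  define z where "z = \<epsilon> powi (- v) *s y1"
  let ?X = "U - {x1}"
  have quot: "A y x / A y1 x1 \<in> \<O>" if "y \<in> W" "x \<in> U" for y x
  proof (cases "A y x = 0")
    case False
    then have "val D (A y1 x1) \<le> val D (A y x)" using p(2) that by blast
    then show ?thesis using False p1(3) by (simp add: val_ideal_def divide_inverse val_mult val_inverse)
  qed simp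
  have zc: "\<epsilon> powi (- v) * A y1 x \<in> \<O>" if "x \<in> U" for x
  proof (cases "A y1 x = 0")
    case False
    then have "v \<le> val D (A y1 x)" using p(2) that p1(1) unfolding v_def by blast
    then show ?thesis using False by (simp add: val_ideal_def val_mult)
  qed simp
  have zu: "is_unit_OO (\<epsilon> powi (- v) * A y1 x1)"
    using p1(3) unfolding is_unit_OO_def v_def by (simp add: val_ideal_def val_mult val_inverse)
  have y1X: "y1 \<in> N.span U" using p1(1) Suc.prems N.span_superset by blast
  have zsum: "z = (\<epsilon> powi (- v) * A y1 x1) *s x1 + (\<Sum>x\<in>?X. (\<epsilon> powi (- v) * A y1 x) *s x)"
  proof -
    have "z = (\<Sum>x\<in>U. (\<epsilon> powi (- v) * A y1 x) *s x)"
      unfolding z_def by (subst rep[OF y1X, symmetric]) (simp add: N.scale_sum_right)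
    then show ?thesis using p1(2) Suc.prems(1) by (simp add: sum.remove)
  qed
  have rest: "(\<Sum>x\<in>?X. (\<epsilon> powi (- v) * A y1 x) *s x) \<in> O_span D ?X"
    using zc by (intro sub_sum sub_scale sub_O_span O_span_inc) auto
  have spanX: "O_span D (insert z ?X) = O_span D U"
  proof
    show "O_span D (insert z ?X) \<subseteq> O_span D U"
    proof (intro O_span_min sub_O_span insert_subsetI)
      show "?X \<subseteq> O_span D U" by (auto intro: O_span_inc)
      have "O_span D ?X \<subseteq> O_span D U" by (rule O_span_mono) auto
      moreover have "(\<epsilon> powi (- v) * A y1 x1) *s x1 \<in> O_span D U"
        using zc p1(2) by (intro sub_scale sub_O_span O_span_inc)
      ultimately show "z \<in> O_span D U" unfolding zsum using rest by (intro sub_add sub_O_span) auto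
    qed
    show "O_span D U \<subseteq> O_span D (insert z ?X)"
    proof (intro O_span_min sub_O_span subsetI)
      fix x assume x: "x \<in> U"
      have sI: "O_span D ?X \<subseteq> O_span D (insert z ?X)" by (rule O_span_mono) auto
      have "(\<epsilon> powi (- v) * A y1 x1) *s x1 = z - (\<Sum>x\<in>?X. (\<epsilon> powi (- v) * A y1 x) *s x)"
        using zsum by simp
      also have "\<dots> \<in> O_span D (insert z ?X)"
        using rest sI by (intro sub_diff sub_O_span) (auto intro: O_span_inc)
      finally have "x1 \<in> O_span D (insert z ?X)" by (rule sub_unit[OF sub_O_span zu])
      then show "x \<in> O_span D (insert z ?X)" using x by (cases "x = x1") (auto intro: O_span_inc)
    qed
  qed
  \<comment> \<open>The column of x1 is cleared with multiples of y1; the multipliers are integral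
    by minimality of the pivot.\<close>
  define W' where "W' = (\<lambda>y. y - (A y x1 / A y1 x1) *s y1) ` W"
  have Asp: "A y x1 = 0" if "y \<in> N.span ?X" for y
  proof -
    have "N.representation U y = N.representation ?X y"
      using Suc.prems(2) that by (intro N.representation_extend) auto
    then show ?thesis unfolding A_def using N.representation_ne_zero[of ?X y x1] by auto
  qed
  have W'sp: "w \<in> N.span ?X" if "w \<in> W'" for w
  proof -
    obtain y where y: "y \<in> W" "w = y - (A y x1 / A y1 x1) *s y1" using \<open>w \<in> W'\<close> unfolding W'_def by blast
    have yX: "y \<in> N.span U" using y(1) Suc.prems N.span_superset by blast
    let ?c = "A y x1 / A y1 x1"
    have "w = (\<Sum>x\<in>U. A y x *s x) - ?c *s (\<Sum>x\<in>U. A y1 x *s x)" unfolding rep[OF yX] rep[OF y1X] by (rule y(2))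
    also have "\<dots> = (\<Sum>x\<in>U. (A y x - ?c * A y1 x) *s x)"
      by (simp add: N.scale_left_diff_distrib sum_subtractf N.scale_sum_right)
    also have "\<dots> = (\<Sum>x\<in>?X. (A y x - ?c * A y1 x) *s x)"
      using p1 Suc.prems(1) by (simp add: sum.remove[of U x1])
    finally show ?thesis by (auto intro!: N.span_sum N.span_scale intro: N.span_base)
  qed
  have Yspan: "N.span (insert y1 W') = N.span W"
  proof (rule N.span_eq[THEN iffD2], intro conjI subsetI)
    fix w assume "w \<in> insert y1 W'"
    then show "w \<in> N.span W" using p1(1) unfolding W'_def
      by (auto intro!: N.span_diff N.span_scale intro: N.span_base)
  next
    fix y assume y: "y \<in> W"
    have "y - (A y x1 / A y1 x1) *s y1 \<in> N.span (insert y1 W')"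
      using y unfolding W'_def by (intro N.span_base) auto
    moreover have "(A y x1 / A y1 x1) *s y1 \<in> N.span (insert y1 W')" by (auto intro: N.span_scale N.span_base)
    ultimately show "y \<in> N.span (insert y1 W')" using N.span_add by fastforce
  qed
  \<comment> \<open>The induction hypothesis needs equal spans. A vector of ?X is a combination of
    y1 and W', and the coefficient of y1 vanishes because y1 alone has a component at x1.\<close>
  have "N.span W' = N.span ?X"
  proof
    show "N.span W' \<subseteq> N.span ?X" using W'sp by (intro N.span_minimal) auto
    show "N.span ?X \<subseteq> N.span W'"
    proof (rule N.span_minimal, rule subsetI)
      fix x assume x: "x \<in> ?X"
      then have "x \<in> N.span (insert y1 W')" unfolding Yspan Suc.prems(4) by (auto intro: N.span_base)
      then obtain c where c: "x - c *s y1 \<in> N.span W'" using N.span_breakdown_eq by blast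
      then have d: "x - c *s y1 \<in> N.span ?X" using \<open>N.span W' \<subseteq> N.span ?X\<close> by blast
      have "x \<in> N.span ?X" using x by (rule N.span_base)
      then have "x - (x - c *s y1) \<in> N.span ?X" using d by (rule N.span_diff)
      then have cy: "c *s y1 \<in> N.span ?X" by simp
      have "c = 0"
      proof (rule ccontr)
        assume "c \<noteq> 0"
        then have "y1 \<in> N.span ?X" using N.span_scale[OF cy, of "inverse c"] by simp
        then show False using Asp p1(3) by blast
      qed
      then show "x \<in> N.span W'" using c by simp
    qed (rule N.subspace_span)
  qed
  moreover have "finite ?X" "N.independent ?X" "finite W'" "n = card ?X"
    using Suc.prems Suc.hyps(2) p1(2) N.independent_mono[OF Suc.prems(2), of ?X] unfolding W'_def by auto
  ultimately obtain Z f where Z: "finite Z" "card Z = card ?X" "O_span D Z = O_span D ?X"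
    "O_span D ((\<lambda>z. \<epsilon> powi (f z) *s z) ` Z) = O_span D W'"
    using Suc.hyps(1)[of ?X W'] by blast
  have znX: "z \<notin> N.span ?X"
  proof
    assume "z \<in> N.span ?X"
    then have "\<epsilon> powi v *s z \<in> N.span ?X" by (rule N.span_scale)
    moreover have "\<epsilon> powi v *s z = y1" unfolding z_def by (simp add: power_int_minus)
    ultimately show False using Asp p1(3) by metis
  qed
  have zZ: "z \<notin> Z"
  proof
    assume "z \<in> Z"
    then have "z \<in> O_span D ?X" using O_span_inc Z(3) by metis
    then show False using znX O_span_le_span by blast
  qed
  let ?Z = "insert z Z" and ?f = "f(z := v)"
  have "card ?Z = card U" using Z zZ p1(2) Suc.prems(1) by (simp add: card_Suc_Diff1 Suc.hyps(2)[symmetric] \<open>n = card ?X\<close>[symmetric])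
  moreover have "O_span D ?Z = O_span D U"
    unfolding spanX[symmetric] O_span_insert Z(3) ..
  moreover have "O_span D ((\<lambda>z. \<epsilon> powi (?f z) *s z) ` ?Z) = O_span D W"
  proof -
    have "(\<lambda>z. \<epsilon> powi (?f z) *s z) ` Z = (\<lambda>z. \<epsilon> powi (f z) *s z) ` Z"
      using zZ by (intro image_cong) auto
    moreover have "\<epsilon> powi (?f z) *s z = y1" unfolding z_def by (simp add: power_int_minus)
    ultimately have "O_span D ((\<lambda>z. \<epsilon> powi (?f z) *s z) ` ?Z) = O_span D (insert y1 W')"
      unfolding image_insert O_span_insert Z(4)[symmetric] by simp
    also have "\<dots> = O_span D W"
    proof
      have 1: "A y x1 / A y1 x1 \<in> \<O>" if "y \<in> W" for y using quot that p1(2) by blast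
      show "O_span D (insert y1 W') \<subseteq> O_span D W"
      proof (intro O_span_min sub_O_span subsetI)
        fix w assume "w \<in> insert y1 W'"
        then show "w \<in> O_span D W" using p1(1) 1 unfolding W'_def
          by (auto intro!: sub_diff sub_scale sub_O_span intro: O_span_inc)
      qed
      show "O_span D W \<subseteq> O_span D (insert y1 W')"
      proof (intro O_span_min sub_O_span subsetI)
        fix y assume y: "y \<in> W"
        have "y - (A y x1 / A y1 x1) *s y1 \<in> O_span D (insert y1 W')"
          using y unfolding W'_def by (intro O_span_inc) auto
        moreover have "(A y x1 / A y1 x1) *s y1 \<in> O_span D (insert y1 W')"
          by (rule sub_scale[OF sub_O_span 1[OF y] O_span_inc]) simp
        ultimately show "y \<in> O_span D (insert y1 W')" using sub_diff_cancel[OF sub_O_span] by blast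
      qed
    qed
    finally show ?thesis .
  qed
  ultimately show ?case using Z(1) by (intro exI[of _ ?Z] exI[of _ ?f]) auto
qed

end

section \<open>Cartan decomposition and relative positions in terms of lengths\<close>

context decomposed_isocrystal
begin

lemma cochar_GL: "cochar_at_unif D xi \<in> GL D"
proof -
  have c: "crd (cochar_at_unif D xi x) t = \<epsilon> powi (xi ! t) * crd x t" if "t < rk D" for x t
    by (rule coord_cochar[OF that])
  show ?thesis unfolding GL_iff
  proof (intro conjI allI bijI)
    show "inj (cochar_at_unif D xi)"
    proof (rule injI, rule coord_eqI)
      fix x y t assume *: "cochar_at_unif D xi x = cochar_at_unif D xi y" "t < rk D"
      then have "\<epsilon> powi (xi ! t) * crd x t = \<epsilon> powi (xi ! t) * crd y t" using c by metis
      then show "crd x t = crd y t" by simp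
    qed
    show "surj (cochar_at_unif D xi)"
    proof (rule surjI, rule coord_eqI)
      fix y t assume t: "t < rk D"
      let ?x = "\<Sum>t<rk D. (\<epsilon> powi (- (xi ! t)) * crd y t) *s bv t"
      have "crd ?x t = \<epsilon> powi (- (xi ! t)) * crd y t" by (rule coord_unique[OF refl t])
      then show "crd (cochar_at_unif D xi ?x) t = crd y t" using c[OF t, of ?x] by (simp add: power_int_minus)
    qed
    show "cochar_at_unif D xi (x + y) = cochar_at_unif D xi x + cochar_at_unif D xi y" for x y
      by (rule coord_eqI) (simp add: c coord_add distrib_left)
    show "cochar_at_unif D xi (a *s x) = a *s cochar_at_unif D xi x" for a x
      by (rule coord_eqI) (simp add: c coord_scale mult.left_commute)
  qed
qed

lemma cochar_bv: "t < rk D \<Longrightarrow> cochar_at_unif D xi (bv t) = \<epsilon> powi (xi ! t) *s bv t"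
  by (rule coord_eqI) (auto simp: coord_cochar coord_scale coord_bv)

lemma K_GL: "u \<in> K_stab D \<Longrightarrow> u \<in> GL D" and K_M0: "u \<in> K_stab D \<Longrightarrow> u ` M0 D = M0 D"
  unfolding K_stab_def by auto

text \<open>Let Z be a basis of M_0 whose multiples by powers of \<epsilon> form a basis of gM_0.
  The map k1 from the standard basis to Z preserves M_0; k1 xi(\<epsilon>) and g send M_0 to the
  same lattice, so they differ by an element k2 of K on the right.\<close>

lemma cartan_exists:
  assumes g: "g \<in> GL D"
  shows "\<exists>xi. xi \<in> dominant_cochars D \<and> g \<in> double_coset D xi"
proof -
  let ?X = "bv ` {..<rk D}"
  let ?inv = Hilbert_Choice.inv
  have gM: "g ` M0 D = O_span D (g ` ?X)" unfolding M0_span by (rule O_span_image[OF semilin_GL[OF g]])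
  have "N.span (g ` ?X) = UNIV"
  proof -
    have "y \<in> N.span (g ` ?X)" for y
    proof -
      obtain x where x: "y = g x" using semilin_bij[OF semilin_GL[OF g]] by (metis bij_pointE)
      have "y = (\<Sum>t<rk D. crd x t *s g (bv t))"
        unfolding x by (subst coord_sum[of x, symmetric]) (simp add: semilin_sum[OF semilin_GL[OF g]] GL_scale[OF g])
      then show ?thesis by (auto intro!: N.span_sum N.span_scale intro: N.span_base)
    qed
    then show ?thesis by blast
  qed
  then obtain Z f where Z: "finite Z" "card Z = card ?X" "O_span D Z = O_span D ?X"
    "O_span D ((\<lambda>z. \<epsilon> powi (f z) *s z) ` Z) = O_span D (g ` ?X)"
    using elementary_divisors[of ?X "g ` ?X"] bv_independent bv_span by auto
  have cZ: "card Z = rk D" using Z(2) inj_bv by (simp add: card_image)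
  \<comment> \<open>Sorting by the negated exponents makes the resulting cocharacter weakly
    decreasing.\<close>
  define zs where "zs = sort_key (\<lambda>z. - f z) (SOME zs. set zs = Z \<and> distinct zs)"
  have "\<exists>zs. set zs = Z \<and> distinct zs" using finite_distinct_list[OF Z(1)] .
  then have S: "set (SOME zs. set zs = Z \<and> distinct zs) = Z \<and> distinct (SOME zs. set zs = Z \<and> distinct zs)"
    by (rule someI_ex)
  then have zs: "set zs = Z" "distinct zs" unfolding zs_def by simp_all
  have lzs: "length zs = rk D" using distinct_card[OF zs(2)] zs(1) cZ by simp
  define xi where "xi = map f zs"
  have lxi: "length xi = rk D" unfolding xi_def using lzs by simp
  have "sorted (map (\<lambda>z. - f z) zs)" unfolding zs_def by simp
  then have "sorted_wrt (\<ge>) xi" unfolding xi_def sorted_wrt_map by (simp add: sorted_wrt_map)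
  then have dom: "xi \<in> dominant_cochars D" unfolding dominant_cochars_def using lxi by simp
  define k1 where "k1 = (\<lambda>x. \<Sum>t<rk D. crd x t *s (zs ! t))"
  have k1add: "k1 (x + y) = k1 x + k1 y" for x y
    unfolding k1_def by (simp add: coord_add N.scale_left_distrib sum.distrib)
  have k1scale: "k1 (c *s x) = c *s k1 x" for c x
    unfolding k1_def by (simp add: coord_scale N.scale_sum_right)
  have k1bv: "k1 (bv t) = zs ! t" if t: "t < rk D" for t
  proof -
    have "k1 (bv t) = (\<Sum>s<rk D. if t = s then zs ! s else 0)"
      unfolding k1_def using t by (intro sum.cong) (auto simp: coord_bv)
    then show ?thesis using t by simp
  qed
  have k1X: "k1 ` ?X = Z"
  proof -
    have "k1 ` ?X = (\<lambda>t. zs ! t) ` {..<rk D}" using k1bv by (auto simp: image_iff)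
    also have "\<dots> = set zs" using lzs by (auto simp: set_conv_nth)
    finally show ?thesis using zs by simp
  qed
  have "Fil 0 \<subseteq> range k1"
  proof -
    have "is_sub (range k1)"
    proof (rule subI)
      show "0 \<in> range k1" using k1scale[of 0 0] by (metis N.scale_zero_left rangeI)
      show "u + w \<in> range k1" if "u \<in> range k1" "w \<in> range k1" for u w
        using that by (auto simp flip: k1add)
      show "c *s u \<in> range k1" if "u \<in> range k1" for c u
        using that by (auto simp flip: k1scale)
    qed
    moreover have "Z \<subseteq> range k1" using k1X by blast
    ultimately have "O_span D Z \<subseteq> range k1" by (rule O_span_min)
    then show ?thesis unfolding Z(3) M0_span[symmetric] M0_eq .
  qed
  then have k1G: "k1 \<in> GL D" using surj_from_Fil k1add k1scale by blast
  have k1M: "k1 ` M0 D = M0 D"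
    unfolding M0_span O_span_image[OF semilin_GL[OF k1G]] k1X Z(3) ..
  define c where "c = k1 \<circ> cochar_at_unif D xi"
  have cG: "c \<in> GL D" unfolding c_def by (intro GL_comp k1G cochar_GL)
  have cM: "c ` M0 D = g ` M0 D"
  proof -
    have "c ` ?X = (\<lambda>z. \<epsilon> powi (f z) *s z) ` Z"
    proof -
      have "c (bv t) = \<epsilon> powi (f (zs ! t)) *s (zs ! t)" if "t < rk D" for t
        using that lzs by (simp add: c_def cochar_bv k1scale k1bv xi_def)
      then have "c ` ?X = (\<lambda>t. \<epsilon> powi (f (zs ! t)) *s (zs ! t)) ` {..<rk D}" by (auto simp: image_iff)
      also have "\<dots> = (\<lambda>z. \<epsilon> powi (f z) *s z) ` set zs" using lzs by (auto simp: set_conv_nth image_iff)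
      finally show ?thesis using zs by simp
    qed
    then show ?thesis unfolding gM unfolding M0_span O_span_image[OF semilin_GL[OF cG]] using Z(4) by simp
  qed
  let ?k2 = "?inv c \<circ> g"
  have bc: "bij c" by (rule semilin_bij[OF semilin_GL[OF cG]])
  have "?k2 ` M0 D = ?inv c ` (g ` M0 D)" by (simp add: image_comp)
  also have "\<dots> = M0 D" unfolding cM[symmetric] by (rule inv_inv_image[OF bc])
  finally have k2: "?k2 \<in> K_stab D" unfolding K_stab_def using GL_comp[OF GL_inv[OF cG] g] by simp
  have "g = k1 \<circ> cochar_at_unif D xi \<circ> ?k2"
    unfolding c_def[symmetric] using bc by (auto simp: fun_eq_iff bij_is_surj surj_f_inv_f)
  moreover have "k1 \<in> K_stab D" unfolding K_stab_def using k1G k1M by simp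
  ultimately have "g \<in> double_coset D xi" unfolding double_coset_def using k2 by blast
  then show ?thesis using dom by blast
qed

definition Lat :: "(nat \<Rightarrow> int) \<Rightarrow> 'n set" where
  "Lat \<eta> = {x. \<forall>t<rk D. crd x t \<in> val_ideal D (\<eta> t)}"

lemma sub_Lat: "is_sub (Lat \<eta>)"
proof (rule subI)
  show "0 \<in> Lat \<eta>" unfolding Lat_def using coord_scale[of _ 0 0] by simp
  show "x + y \<in> Lat \<eta>" if "x \<in> Lat \<eta>" "y \<in> Lat \<eta>" for x y
    using that unfolding Lat_def by (simp add: coord_add val_ideal_add)
  show "c *s x \<in> Lat \<eta>" if "c \<in> \<O>" "x \<in> Lat \<eta>" for c x
    using that val_ideal_mult[of c 0] unfolding Lat_def by (simp add: coord_scale)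
qed

text \<open>Each step of the chain lowers one exponent by one, adding the vector \<epsilon>^(\<eta>
  s) times a basis vector.\<close>

lemma len_Lat:
  "(\<And>t. t < rk D \<Longrightarrow> \<eta> t \<le> \<eta>' t) \<Longrightarrow> len (Lat \<eta>) (Lat \<eta>') (\<Sum>t<rk D. nat (\<eta>' t - \<eta> t))"
proof (induction "\<Sum>t<rk D. nat (\<eta>' t - \<eta> t)" arbitrary: \<eta>)
  case 0
  then have "\<eta> t = \<eta>' t" if "t < rk D" for t using that by force
  then have "Lat \<eta> = Lat \<eta>'" unfolding Lat_def by simp
  then show ?case using 0(1) len_refl[OF sub_Lat] by simp
next
  case (Suc n)
  then have "\<exists>t<rk D. nat (\<eta>' t - \<eta> t) \<noteq> 0"
    by (metis (no_types, lifting) lessThan_iff nat.distinct(1) sum.neutral)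
  then obtain s where s: "s < rk D" "\<eta> s < \<eta>' s" by auto
  let ?n = "\<eta>(s := \<eta> s + 1)" and ?z = "\<epsilon> powi (\<eta> s) *s bv s"
  have zc: "crd ?z t = (if t = s then \<epsilon> powi (\<eta> s) else 0)" if "t < rk D" for t
    using that s by (simp add: coord_scale coord_bv)
  have "(\<Sum>t<rk D. nat (\<eta>' t - \<eta> t)) = nat (\<eta>' s - \<eta> s) + (\<Sum>t\<in>{..<rk D} - {s}. nat (\<eta>' t - \<eta> t))"
    using s by (intro sum.remove) auto
  moreover have "(\<Sum>t<rk D. nat (\<eta>' t - ?n t)) = nat (\<eta>' s - ?n s) + (\<Sum>t\<in>{..<rk D} - {s}. nat (\<eta>' t - ?n t))"
    using s by (intro sum.remove) auto
  moreover have "(\<Sum>t\<in>{..<rk D} - {s}. nat (\<eta>' t - ?n t)) = (\<Sum>t\<in>{..<rk D} - {s}. nat (\<eta>' t - \<eta> t))"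
    by (rule sum.cong) auto
  ultimately have n: "(\<Sum>t<rk D. nat (\<eta>' t - \<eta> t)) = Suc (\<Sum>t<rk D. nat (\<eta>' t - ?n t))" using s by simp
  then have IH: "len (Lat ?n) (Lat \<eta>') (\<Sum>t<rk D. nat (\<eta>' t - ?n t))"
    using Suc s by (intro Suc.hyps(1)) auto
  have z1: "?z \<notin> Lat ?n"
  proof
    assume "?z \<in> Lat ?n"
    then have "crd ?z s \<in> val_ideal D (\<eta> s + 1)" unfolding Lat_def using s by auto
    then show False using zc[OF s(1)] by (simp add: val_ideal_def)
  qed
  have z2: "\<epsilon> *s ?z \<in> Lat ?n"
  proof -
    have "crd (\<epsilon> *s ?z) t \<in> val_ideal D (?n t)" if t: "t < rk D" for t
      unfolding coord_scale[OF t, of \<epsilon>] zc[OF t] by (simp add: val_ideal_def val_mult)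
    then show ?thesis unfolding Lat_def by blast
  qed
  have z3: "msum (Lat ?n) (line ?z) = Lat \<eta>"
  proof
    have "Lat ?n \<subseteq> Lat \<eta>"
    proof
      fix x assume x: "x \<in> Lat ?n"
      have "crd x t \<in> val_ideal D (\<eta> t)" if "t < rk D" for t
      proof (rule val_ideal_antimono)
        show "\<eta> t \<le> ?n t" by simp
        show "crd x t \<in> val_ideal D (?n t)" using x that unfolding Lat_def by blast
      qed
      then show "x \<in> Lat \<eta>" unfolding Lat_def by blast
    qed
    moreover have "?z \<in> Lat \<eta>" unfolding Lat_def using zc by (auto simp: val_ideal_def)
    ultimately show "msum (Lat ?n) (line ?z) \<subseteq> Lat \<eta>" by (intro msum_le line_le sub_Lat)
    show "Lat \<eta> \<subseteq> msum (Lat ?n) (line ?z)"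
    proof
      fix x assume x: "x \<in> Lat \<eta>"
      then have "crd x s \<in> val_ideal D (\<eta> s)" unfolding Lat_def using s by blast
      then obtain c where c: "c \<in> \<O>" "crd x s = \<epsilon> powi (\<eta> s) * c" using val_ideal_iff_eps_powi by blast
      have "x - c *s ?z \<in> Lat ?n"
        unfolding Lat_def
      proof (intro CollectI allI impI)
        fix t assume t: "t < rk D"
        have "crd (x + (- c) *s ?z) t = crd x t + (- c) * crd ?z t" using t by (simp only: coord_add coord_scale)
        then have "crd (x - c *s ?z) t = (if t = s then 0 else crd x t)" using zc[OF t] c by (simp add: mult.commute)
        then show "crd (x - c *s ?z) t \<in> val_ideal D (?n t)" using x t unfolding Lat_def by auto
      qed
      from msumI[OF this lineI[OF c(1), of ?z]] show "x \<in> msum (Lat ?n) (line ?z)" by simp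
    qed
  qed
  show ?case using len_step[OF sub_Lat z1 z2 IH] unfolding z3 n .
qed

lemma cochar_M0: "cochar_at_unif D xi ` M0 D = Lat (\<lambda>t. xi ! t)"
proof (intro subset_antisym subsetI)
  fix x assume "x \<in> cochar_at_unif D xi ` M0 D"
  then obtain y where "x = cochar_at_unif D xi y" "\<forall>t<rk D. crd y t \<in> \<O>" using M0_iff by blast
  then show "x \<in> Lat (\<lambda>t. xi ! t)"
    unfolding Lat_def val_ideal_iff_eps_powi by (auto simp: coord_cochar)
next
  fix x assume x: "x \<in> Lat (\<lambda>t. xi ! t)"
  obtain y where y: "x = cochar_at_unif D xi y" using semilin_bij[OF semilin_GL[OF cochar_GL]] by (metis bij_pointE)
  have "crd y t \<in> \<O>" if t: "t < rk D" for t
  proof -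
    have "crd x t \<in> val_ideal D (xi ! t)" using x t unfolding Lat_def by blast
    then obtain c where "c \<in> \<O>" "crd x t = \<epsilon> powi (xi ! t) * c"
      using val_ideal_iff_eps_powi by blast
    then show ?thesis using coord_cochar[OF t, of xi y] y by simp
  qed
  then show "x \<in> cochar_at_unif D xi ` M0 D" unfolding y using M0_iff by blast
qed

lemma eps_powi_M0: "(\<lambda>x. \<epsilon> powi n *s x) ` M0 D = Lat (\<lambda>_. n)"
proof (intro subset_antisym subsetI)
  fix x assume "x \<in> (\<lambda>x. \<epsilon> powi n *s x) ` M0 D"
  then obtain y where "x = \<epsilon> powi n *s y" "\<forall>t<rk D. crd y t \<in> \<O>" using M0_iff by blast
  then show "x \<in> Lat (\<lambda>_. n)"
    unfolding Lat_def val_ideal_iff_eps_powi by (auto simp: coord_scale)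
next
  fix x assume x: "x \<in> Lat (\<lambda>_. n)"
  let ?y = "\<epsilon> powi (- n) *s x"
  have "crd ?y t \<in> \<O>" if t: "t < rk D" for t
  proof -
    have "crd x t \<in> val_ideal D n" using x t unfolding Lat_def by blast
    then obtain c where "c \<in> \<O>" "crd x t = \<epsilon> powi n * c"
      using val_ideal_iff_eps_powi by blast
    then show ?thesis using t by (simp add: coord_scale power_int_minus flip: mult.assoc)
  qed
  then have "?y \<in> M0 D" using M0_iff by blast
  moreover have "x = \<epsilon> powi n *s ?y" by (simp add: power_int_minus)
  ultimately show "x \<in> (\<lambda>x. \<epsilon> powi n *s x) ` M0 D" by blast
qed

lemma Lat_Int: "Lat \<eta> \<inter> Lat \<eta>' = Lat (\<lambda>t. max (\<eta> t) (\<eta>' t))"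
  unfolding Lat_def by (auto simp: val_ideal_def)

text \<open>The factor k1 fixes M_0 and all its multiples, so it can be removed from both lattices;
  what remains are diagonal lattices, whose intersection has the larger exponents.\<close>

lemma cartan_len:
  assumes g: "g \<in> double_coset D xi" and xi: "length xi = rk D"
  shows "len (g ` M0 D) (g ` M0 D \<inter> (\<lambda>x. \<epsilon> powi n *s x) ` M0 D) (\<Sum>a\<leftarrow>xi. nat (n - a))"
proof -
  obtain k1 k2 where k: "k1 \<in> K_stab D" "k2 \<in> K_stab D" "g = k1 \<circ> cochar_at_unif D xi \<circ> k2"
    using g unfolding double_coset_def by blast
  note k1 = K_GL[OF k(1)]
  have "g ` M0 D = k1 ` (cochar_at_unif D xi ` (k2 ` M0 D))" unfolding k(3) by (simp add: image_comp)
  then have gM: "g ` M0 D = k1 ` Lat (\<lambda>t. xi ! t)" unfolding K_M0[OF k(2)] cochar_M0 .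
  have "(\<lambda>x. \<epsilon> powi n *s x) ` M0 D = (\<lambda>x. \<epsilon> powi n *s x) ` (k1 ` M0 D)" unfolding K_M0[OF k(1)] ..
  also have "\<dots> = k1 ` ((\<lambda>x. \<epsilon> powi n *s x) ` M0 D)" by (simp add: image_image GL_scale[OF k1])
  finally have nM: "(\<lambda>x. \<epsilon> powi n *s x) ` M0 D = k1 ` Lat (\<lambda>_. n)" unfolding eps_powi_M0 .
  have inj: "inj k1" using semilin_bij[OF semilin_GL[OF k1]] by (rule bij_is_inj)
  have "len (Lat (\<lambda>t. xi ! t)) (Lat (\<lambda>t. max (xi ! t) n)) (\<Sum>t<rk D. nat (max (xi ! t) n - xi ! t))"
    by (rule len_Lat) simp
  also have "(\<Sum>t<rk D. nat (max (xi ! t) n - xi ! t)) = (\<Sum>t<length xi. nat (n - xi ! t))"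
    unfolding xi by (rule sum.cong) auto
  also have "\<dots> = (\<Sum>a\<leftarrow>xi. nat (n - a))" by (simp add: sum_list_sum_nth atLeast0LessThan)
  finally have "len (k1 ` Lat (\<lambda>t. xi ! t)) (k1 ` Lat (\<lambda>t. max (xi ! t) n)) (\<Sum>a\<leftarrow>xi. nat (n - a))"
    by (rule len_image[OF _ semilin_GL[OF k1]])
  then show ?thesis unfolding gM nM image_Int[OF inj, symmetric] Lat_Int .
qed

text \<open>Allowing two elements g and g' gives at once uniqueness in the Cartan decomposition and
  a way of comparing relative positions of different lattices.\<close>

lemma cartan_unique_len:
  assumes "xi \<in> dominant_cochars D" "xi' \<in> dominant_cochars D" "g \<in> double_coset D xi" "g' \<in> double_coset D xi'"
    and eq: "\<And>n. \<exists>k. len (g ` M0 D) (g ` M0 D \<inter> (\<lambda>x. \<epsilon> powi n *s x) ` M0 D) k \<and>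
      len (g' ` M0 D) (g' ` M0 D \<inter> (\<lambda>x. \<epsilon> powi n *s x) ` M0 D) k"
  shows "xi = xi'"
proof (rule dominant_eqI)
  show "sorted_wrt (\<ge>) xi" "sorted_wrt (\<ge>) xi'" using assms(1,2) unfolding dominant_cochars_def by auto
  have l: "length xi = rk D" "length xi' = rk D" using assms(1,2) unfolding dominant_cochars_def by auto
  show "(\<Sum>a\<leftarrow>xi. nat (n - a)) = (\<Sum>a\<leftarrow>xi'. nat (n - a))" for n
    using eq[of n] len_unique cartan_len[OF assms(3) l(1), of n] cartan_len[OF assms(4) l(2), of n] by blast
qed

lemma cartan_unique:
  assumes "xi \<in> dominant_cochars D" "xi' \<in> dominant_cochars D" "g \<in> double_coset D xi" "g \<in> double_coset D xi'"
  shows "xi = xi'"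
proof (rule cartan_unique_len[OF assms])
  fix n
  have "length xi = rk D" using assms(1) unfolding dominant_cochars_def by auto
  then show "\<exists>k. len (g ` M0 D) (g ` M0 D \<inter> (\<lambda>x. \<epsilon> powi n *s x) ` M0 D) k \<and>
      len (g ` M0 D) (g ` M0 D \<inter> (\<lambda>x. \<epsilon> powi n *s x) ` M0 D) k"
    using cartan_len[OF assms(3)] by blast
qed

lemma rel_pos:
  assumes "j \<in> J_group D" "g \<in> GL D"
  shows "rel_pos D j g \<in> dominant_cochars D \<and> Hilbert_Choice.inv j \<circ> g \<in> double_coset D (rel_pos D j g)"
proof -
  have "Hilbert_Choice.inv j \<circ> g \<in> GL D" by (intro GL_comp GL_inv J_GL assms)
  then obtain xi where xi: "xi \<in> dominant_cochars D \<and> Hilbert_Choice.inv j \<circ> g \<in> double_coset D xi"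
    using cartan_exists by blast
  then show ?thesis unfolding rel_pos_def by (rule theI) (use cartan_unique xi in blast)
qed

lemma rel_pos_eqI:
  assumes "j \<in> J_group D" "g \<in> GL D" "xi \<in> dominant_cochars D" "Hilbert_Choice.inv j \<circ> g \<in> double_coset D xi"
  shows "rel_pos D j g = xi"
  using rel_pos[OF assms(1,2)] cartan_unique assms(3,4) by blast

text \<open>Write j^(-1)g and j^(-1)g' with the same middle factor xi(\<epsilon>) and left factors
  k1, k1' from K. Then j k1' k1^(-1) j^(-1) carries gM_0 to g'M_0 and fixes jM_0.\<close>

lemma rel_pos_match:
  assumes j: "j \<in> J_group D" and g: "g \<in> GL D" "g' \<in> GL D" and eq: "rel_pos D j g = rel_pos D j g'"
  shows "\<exists>k\<in>GL D. k ` (j ` M0 D) = j ` M0 D \<and> k ` (g ` M0 D) = g' ` M0 D"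
proof -
  let ?inv = Hilbert_Choice.inv
  have bj: "bij j" by (rule J_bij[OF j])
  obtain k1 k2 where k: "k1 \<in> K_stab D" "k2 \<in> K_stab D" "?inv j \<circ> g = k1 \<circ> cochar_at_unif D (rel_pos D j g) \<circ> k2"
    using rel_pos[OF j g(1)] unfolding double_coset_def by blast
  obtain k1' k2' where k': "k1' \<in> K_stab D" "k2' \<in> K_stab D" "?inv j \<circ> g' = k1' \<circ> cochar_at_unif D (rel_pos D j g) \<circ> k2'"
    using rel_pos[OF j g(2)] unfolding eq[symmetric] double_coset_def by blast
  let ?C = "cochar_at_unif D (rel_pos D j g) ` M0 D"
  have 1: "?inv j ` (g ` M0 D) = k1 ` ?C"
  proof -
    have "?inv j ` (g ` M0 D) = (?inv j \<circ> g) ` M0 D" by (simp add: image_comp)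
    also have "\<dots> = k1 ` (cochar_at_unif D (rel_pos D j g) ` (k2 ` M0 D))" unfolding k(3) by (simp add: image_comp)
    finally show ?thesis unfolding K_M0[OF k(2)] .
  qed
  have 2: "?inv j ` (g' ` M0 D) = k1' ` ?C"
  proof -
    have "?inv j ` (g' ` M0 D) = (?inv j \<circ> g') ` M0 D" by (simp add: image_comp)
    also have "\<dots> = k1' ` (cochar_at_unif D (rel_pos D j g) ` (k2' ` M0 D))" unfolding k'(3) by (simp add: image_comp)
    finally show ?thesis unfolding K_M0[OF k'(2)] .
  qed
  note k1G = K_GL[OF k(1)] and k1'G = K_GL[OF k'(1)]
  have bk: "bij k1" by (rule semilin_bij[OF semilin_GL[OF k1G]])
  let ?k = "\<lambda>x. j (k1' (?inv k1 (?inv j x)))"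
  have kG: "?k \<in> GL D"
    using GL_comp[OF J_GL[OF j] GL_comp[OF k1'G GL_comp[OF GL_inv[OF k1G] GL_inv[OF J_GL[OF j]]]]]
    by (simp add: o_def)
  have kim: "?k ` S = j ` (k1' ` (?inv k1 ` (?inv j ` S)))" for S by (simp add: image_image)
  have "?inv k1 ` M0 D = M0 D" using inv_inv_image[OF bk, of "M0 D"] K_M0[OF k(1)] by simp
  then have "?k ` (j ` M0 D) = j ` M0 D" unfolding kim inv_inv_image[OF bj] using K_M0[OF k'(1)] by simp
  moreover have "?k ` (g ` M0 D) = g' ` M0 D"
    unfolding kim 1 inv_inv_image[OF bk] 2[symmetric] image_inv_image[OF bj] ..
  ultimately show ?thesis using kG by blast
qed

text \<open>The lattices j\<epsilon>^n M_0 that detect the position relative to j are themselves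
  translates under J_b(F), so lengths against translates suffice.\<close>

lemma rel_pos_len_eq:
  assumes j: "j \<in> J_group D" and g: "g \<in> GL D" "g' \<in> GL D"
    and eq: "\<And>i. i \<in> J_group D \<Longrightarrow> \<exists>n. len (g ` M0 D) (g ` M0 D \<inter> i ` M0 D) n \<and> len (g' ` M0 D) (g' ` M0 D \<inter> i ` M0 D) n"
  shows "rel_pos D j g = rel_pos D j g'"
proof (rule cartan_unique_len)
  let ?inv = Hilbert_Choice.inv
  show "rel_pos D j g \<in> dominant_cochars D" "rel_pos D j g' \<in> dominant_cochars D"
    "?inv j \<circ> g \<in> double_coset D (rel_pos D j g)" "?inv j \<circ> g' \<in> double_coset D (rel_pos D j g')"
    using rel_pos[OF j] g by auto
  fix n
  let ?T = "\<lambda>x. \<epsilon> powi n *s x"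
  have bj: "bij j" by (rule J_bij[OF j])
  have inj: "inj (?inv j)" using bj by (simp add: bij_imp_bij_inv bij_is_inj)
  have "j \<circ> ?T \<in> J_group D" by (intro J_comp j J_eps)
  then obtain k where k: "len (g ` M0 D) (g ` M0 D \<inter> (j \<circ> ?T) ` M0 D) k"
    "len (g' ` M0 D) (g' ` M0 D \<inter> (j \<circ> ?T) ` M0 D) k" using eq by blast
  have im: "?inv j ` ((j \<circ> ?T) ` M0 D) = ?T ` M0 D"
    unfolding image_comp[symmetric] by (rule inv_inv_image[OF bj])
  have "len ((?inv j \<circ> f) ` M0 D) ((?inv j \<circ> f) ` M0 D \<inter> ?T ` M0 D) k"
    if "len (f ` M0 D) (f ` M0 D \<inter> (j \<circ> ?T) ` M0 D) k" for f
    using len_image[OF that J_semilin[OF J_inv[OF j]]] unfolding image_Int[OF inj] im by (simp add: image_comp)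
  then show "\<exists>k. len ((?inv j \<circ> g) ` M0 D) ((?inv j \<circ> g) ` M0 D \<inter> ?T ` M0 D) k \<and>
      len ((?inv j \<circ> g') ` M0 D) ((?inv j \<circ> g') ` M0 D \<inter> ?T ` M0 D) k" using k by blast
qed

lemma inv_comp_apply: "bij f \<Longrightarrow> bij g \<Longrightarrow> Hilbert_Choice.inv (f \<circ> g) = Hilbert_Choice.inv g \<circ> Hilbert_Choice.inv f"
  by (rule o_inv_distrib)

lemma comp_inv_cancel: "bij r \<Longrightarrow> r \<circ> (Hilbert_Choice.inv r \<circ> j) = j"
  by (simp add: fun_eq_iff bij_is_surj surj_f_inv_f)

lemma rel_pos_translate:
  assumes "p \<in> J_group D" "j \<in> J_group D"
  shows "rel_pos D (p \<circ> j) (p \<circ> g) = rel_pos D j g"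
proof -
  have "Hilbert_Choice.inv (p \<circ> j) \<circ> (p \<circ> g) = Hilbert_Choice.inv j \<circ> g"
    using J_bij[OF assms(1)] J_bij[OF assms(2)]
    by (auto simp: inv_comp_apply fun_eq_iff bij_is_inj)
  then show ?thesis unfolding rel_pos_def by simp
qed

lemma J_orbit_iff:
  assumes g: "g \<in> GL D" "g' \<in> GL D"
  shows "f_of D g \<in> J_orbit D (f_of D g') \<longleftrightarrow> (\<exists>p\<in>J_group D. \<forall>j\<in>J_group D. rel_pos D j g = rel_pos D j (p \<circ> g'))"
proof -
  have act: "J_act D p (f_of D g') j = rel_pos D j (p \<circ> g')" if p: "p \<in> J_group D" and j: "j \<in> J_group D" for p j
  proof -
    have i: "Hilbert_Choice.inv p \<circ> j \<in> J_group D" by (intro J_comp J_inv p j)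
    have "p \<circ> (Hilbert_Choice.inv p \<circ> j) = j"
      using J_bij[OF p] by (auto simp: fun_eq_iff bij_is_surj surj_f_inv_f)
    then have "rel_pos D (Hilbert_Choice.inv p \<circ> j) g' = rel_pos D j (p \<circ> g')"
      using rel_pos_translate[OF p i, of g'] by simp
    then show ?thesis unfolding J_act_def f_of_def using i j by simp
  qed
  have "f_of D g = J_act D p (f_of D g') \<longleftrightarrow> (\<forall>j\<in>J_group D. rel_pos D j g = rel_pos D j (p \<circ> g'))"
    if p: "p \<in> J_group D" for p
  proof
    assume eq: "f_of D g = J_act D p (f_of D g')"
    show "\<forall>j\<in>J_group D. rel_pos D j g = rel_pos D j (p \<circ> g')"
    proof
      fix j assume j: "j \<in> J_group D"
      have "f_of D g j = J_act D p (f_of D g') j" using eq by simp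
      then show "rel_pos D j g = rel_pos D j (p \<circ> g')" using act[OF p j] j by (simp add: f_of_def)
    qed
  next
    assume *: "\<forall>j\<in>J_group D. rel_pos D j g = rel_pos D j (p \<circ> g')"
    show "f_of D g = J_act D p (f_of D g')"
    proof
      fix j
      show "f_of D g j = J_act D p (f_of D g') j"
      proof (cases "j \<in> J_group D")
        case True
        then show ?thesis using act[OF p True] * by (simp add: f_of_def)
      next
        case False
        then show ?thesis by (simp add: f_of_def J_act_def)
      qed
    qed
  qed
  then show ?thesis unfolding J_orbit_def by blast
qed

lemma f_of_mem: "g \<in> GL D \<Longrightarrow> f_of D g \<in> J_group D \<rightarrow>\<^sub>E dominant_cochars D"
  unfolding f_of_def using rel_pos by auto

lemma cochar_shift: "length xi = rk D \<Longrightarrow> (\<lambda>x. \<epsilon> powi n *s cochar_at_unif D xi x) = cochar_at_unif D (map (\<lambda>a. a + n) xi)"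
  by (rule ext, rule coord_eqI) (simp add: coord_scale coord_cochar power_int_add)

text \<open>No \<open>f_g\<close> is constant: multiplication by the uniformizer shifts its values.\<close>

lemma not_constant_orbit:
  assumes g: "g \<in> GL D"
  shows "f_of D g \<notin> J_orbit D (\<lambda>j\<in>J_group D. replicate (rk D) 0)"
proof
  assume "f_of D g \<in> J_orbit D (\<lambda>j\<in>J_group D. replicate (rk D) 0)"
  then obtain p where p: "p \<in> J_group D" "f_of D g = J_act D p (\<lambda>j\<in>J_group D. replicate (rk D) 0)"
    unfolding J_orbit_def by blast
  have const: "rel_pos D j g = replicate (rk D) 0" if j: "j \<in> J_group D" for j
  proof -
    have "Hilbert_Choice.inv p \<circ> j \<in> J_group D" by (intro J_comp J_inv p j)
    moreover have "f_of D g j = J_act D p (\<lambda>j\<in>J_group D. replicate (rk D) 0) j" using p(2) by simp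
    ultimately show ?thesis using j by (simp add: f_of_def J_act_def)
  qed
  let ?z = "replicate (rk D) (0::int)" and ?o = "replicate (rk D) (1::int)"
  \<comment> \<open>Passing from the identity to this element of J_b(F) raises every entry of the
    relative position by 1. The list is not empty, so the values differ.\<close>
  let ?T = "\<lambda>x. \<epsilon> powi (-1) *s x"
  have "g \<in> double_coset D ?z"
    using rel_pos[OF J_id g] const[OF J_id] by (simp add: o_def)
  then obtain k1 k2 where k: "k1 \<in> K_stab D" "k2 \<in> K_stab D" "g = k1 \<circ> cochar_at_unif D ?z \<circ> k2"
    unfolding double_coset_def by blast
  have invT: "Hilbert_Choice.inv ?T = (\<lambda>x. \<epsilon> *s x)"
    by (rule inv_equality) (auto simp: power_int_minus)
  have "(\<lambda>x. \<epsilon> powi 1 *s cochar_at_unif D ?z x) = cochar_at_unif D (map (\<lambda>a. a + 1) ?z)"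
    by (rule cochar_shift) simp
  then have sh: "\<epsilon> *s cochar_at_unif D ?z x = cochar_at_unif D ?o x" for x
    by (simp add: fun_eq_iff)
  have "Hilbert_Choice.inv ?T \<circ> g = k1 \<circ> cochar_at_unif D ?o \<circ> k2"
    unfolding invT k(3) by (auto simp: fun_eq_iff GL_scale[OF K_GL[OF k(1)]] sh[symmetric])
  then have "Hilbert_Choice.inv ?T \<circ> g \<in> double_coset D ?o" unfolding double_coset_def using k by blast
  moreover have "?o \<in> dominant_cochars D" unfolding dominant_cochars_def by (simp add: sorted_wrt_iff_nth_less)
  ultimately have "rel_pos D ?T g = ?o" using rel_pos_eqI[OF J_eps g] by blast
  then show False using const[OF J_eps[of "-1"]] rk_pos by (simp add: replicate_eq_replicate)
qed

end

section \<open>Orbits and the a-invariant\<close>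

context nondegenerate_isocrystal
begin

lemma generated_lattice:
  assumes g: "g \<in> GL D" "dieudonne (g ` M0 D)" "normalized (g ` M0 D)" and a: "a_invariant D (g ` M0 D) = 1"
  obtains v where "good v" "g ` M0 D = Dl v 0"
proof -
  obtain v where v: "v \<in> g ` M0 D" "g ` M0 D = msum (PV (g ` M0 D)) (line v)"
    using a a_invariant_1_iff[OF g(1,2)] by blast
  obtain B where B: "finite B" "g ` M0 D = O_span D B" using lattice_fin[OF g(1)] by blast
  obtain K where K: "Fil K \<subseteq> g ` M0 D" using lattice_Fil[OF g(1)] by blast
  have "g ` M0 D \<subseteq> Fil 0" using g(3) unfolding normalized_def M0_eq by blast
  then show ?thesis
    using that good_generator[OF g(3) v] generated_Dl[OF B g(2) _ K v] by blast
qed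

lemma same_orbit:
  assumes g: "g \<in> GL D" "dieudonne (g ` M0 D)" "normalized (g ` M0 D)" "a_invariant D (g ` M0 D) = 1"
    and g': "g' \<in> GL D" "dieudonne (g' ` M0 D)" "normalized (g' ` M0 D)" "a_invariant D (g' ` M0 D) = 1"
    and j: "j \<in> J_group D"
  shows "rel_pos D j g = rel_pos D j g'"
proof -
  obtain v where v: "good v" "g ` M0 D = Dl v 0" using generated_lattice[OF g] .
  obtain v' where v': "good v'" "g' ` M0 D = Dl v' 0" using generated_lattice[OF g'] .
  show ?thesis
    using len_good[OF v(1) v'(1)] unfolding v(2)[symmetric] v'(2)[symmetric]
    by (intro rel_pos_len_eq[OF j g(1) g'(1)]) blast
qed

lemma orbit_a_invariant:
  assumes g: "g \<in> GL D" "dieudonne (g ` M0 D)"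
    and g': "g' \<in> GL D" "dieudonne (g' ` M0 D)" "normalized (g' ` M0 D)" "a_invariant D (g' ` M0 D) = 1"
    and eq: "\<And>j. j \<in> J_group D \<Longrightarrow> rel_pos D j g = rel_pos D j g'"
  shows "a_invariant D (g ` M0 D) = 1"
proof -
  let ?M = "g ` M0 D" and ?M' = "g' ` M0 D"
  obtain v' where v': "good v'" "?M' = Dl v' 0" using generated_lattice[OF g'] .
  have match: "\<exists>k\<in>GL D. k ` (j ` M0 D) = j ` M0 D \<and> k ` ?M = ?M'" if "j \<in> J_group D" for j
    using rel_pos_match[OF that g(1) g'(1) eq[OF that]] .
  \<comment> \<open>Containment in translates is visible in the relative positions, so normalization
    passes from ?M' to ?M.\<close>
  have le: "?M \<subseteq> j ` M0 D \<longleftrightarrow> ?M' \<subseteq> j ` M0 D" if j: "j \<in> J_group D" for j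
  proof -
    obtain k where k: "k \<in> GL D" "k ` (j ` M0 D) = j ` M0 D" "k ` ?M = ?M'"
      using match[OF j] by (elim bexE conjE) (rule that)
    have "inj k" using semilin_bij[OF semilin_GL[OF k(1)]] by (rule bij_is_inj)
    then show ?thesis using inj_image_subset_iff[of k ?M "j ` M0 D"] k by simp
  qed
  have lens: "len ?M (?M \<inter> j ` M0 D) n \<longleftrightarrow> len ?M' (?M' \<inter> j ` M0 D) n" if j: "j \<in> J_group D" for j n
  proof -
    obtain k where k: "k \<in> GL D" "k ` (j ` M0 D) = j ` M0 D" "k ` ?M = ?M'"
      using match[OF j] by (elim bexE conjE) (rule that)
    have "inj k" using semilin_bij[OF semilin_GL[OF k(1)]] by (rule bij_is_inj)
    then have im: "k ` (?M \<inter> j ` M0 D) = ?M' \<inter> j ` M0 D" using image_Int[of k ?M "j ` M0 D"] k by simp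
    show ?thesis
      using len_image[OF _ semilin_GL[OF k(1)], of ?M "?M \<inter> j ` M0 D" n]
        len_inv_image[OF semilin_GL[OF k(1)], of ?M "?M \<inter> j ` M0 D" n] unfolding im k(3) by blast
  qed
  have norm: "normalized ?M"
    using g'(3) le[OF J_id] le unfolding normalized_def by auto
  have MF: "?M \<subseteq> Fil 0" using norm unfolding normalized_def M0_eq by blast
  obtain f1 where f1: "f1 \<in> J_group D" "f1 ` M0 D = Fil 1" using Fil_J by blast
  note gen' = Dl_generated[OF v'(1) v'(2)]
  have sM: "is_sub ?M" "is_sub ?M'" using sub_lattice g(1) g'(1) by auto
  \<comment> \<open>Length one over the intersection with \<open>Fil 1\<close> also passes to ?M and
    yields the candidate \<open>v\<close>, a generator modulo \<open>Fil 1\<close> only; that it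
    generates ?M is the content of what follows.\<close>
  have "len ?M' (?M' \<inter> Fil 1) 1"
  proof -
    have "?M' \<subseteq> Fil 0" using g'(3) unfolding normalized_def M0_eq by blast
    then have PF: "PV ?M' \<subseteq> ?M' \<inter> Fil 1" using PV_Fil[of ?M' 0] PV_le[OF sM(2) g'(2)] by auto
    have sI: "is_sub (?M' \<inter> Fil 1)" by (intro sub_Int sM sub_Fil)
    have "?M' = msum (?M' \<inter> Fil 1) (line v')"
    proof
      show "?M' \<subseteq> msum (?M' \<inter> Fil 1) (line v')" using gen'(3) msum_mono[OF PF subset_refl] by blast
      show "msum (?M' \<inter> Fil 1) (line v') \<subseteq> ?M'" using gen'(1) by (intro msum_le line_le sM) auto
    qed
    moreover have "v' \<notin> ?M' \<inter> Fil 1" using good_not_Fil1[OF v'(1)] by blast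
    moreover have "\<epsilon> *s v' \<in> ?M' \<inter> Fil 1" using eps_PV[OF sM(2) g'(2) gen'(1)] PF by blast
    ultimately show ?thesis using len_step[OF sI _ _ len_refl[OF sI], of v'] by simp
  qed
  then have "len ?M (?M \<inter> Fil 1) 1" using lens[OF f1(1)] unfolding f1(2) by blast
  then obtain v where v: "?M = msum (?M \<inter> Fil 1) (line v)"
  proof (cases rule: len.cases)
    case (len_step A' z n)
    then have "A' = ?M \<inter> Fil 1" using len_0_eq by auto
    then show ?thesis using that len_step by blast
  qed simp
  have vM: "v \<in> ?M" using v msum_line_mem[OF sub_Int[OF sM(1) sub_Fil]] by blast
  have good: "good v"
    unfolding good_def
  proof (intro conjI allI impI)
    show "v \<in> Fil 0" using vM MF by blast
    fix P' assume P': "is_sub P'" "Fil 1 \<subseteq> P'" "P' \<subseteq> Fil 0" "v \<in> P'" "tau0 D ` P' \<subseteq> P'"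
    show "P' = Fil 0"
    proof (rule ccontr)
      assume "P' \<noteq> Fil 0"
      then obtain k where k: "k \<in> J_group D" "P' \<subseteq> k ` M0 D" "k ` M0 D \<subseteq> M0 D" "k ` M0 D \<noteq> M0 D"
        using smaller_translate[OF P'(1-3) _ P'(5)] by blast
      have "msum (?M \<inter> Fil 1) (line v) \<subseteq> P'" using P' by (intro msum_le line_le) auto
      then have "?M \<subseteq> k ` M0 D" using v k(2) by blast
      then show False using norm k unfolding normalized_def by blast
    qed
  qed
  have DM: "Dl v 0 \<subseteq> ?M" by (rule Dl_min[OF sM(1) g(2) vM])
  obtain K where K: "Fil K \<subseteq> ?M" using lattice_Fil[OF g(1)] by blast
  \<comment> \<open>The level K + h is chosen so that Fil(K+h) = \<epsilon> Fil K lies in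
    \<epsilon>M, as Nakayama needs.\<close>
  obtain fK where fK: "fK \<in> J_group D" "fK ` M0 D = Fil (K + h)" using Fil_J by blast
  obtain n where n: "len (Dl v 0) (Dl v 0 \<inter> Fil (K + h)) n" "len ?M (?M \<inter> Fil (K + h)) n"
    using len_good[OF good v'(1) fK(1)] lens[OF fK(1)] unfolding v'(2)[symmetric] fK(2) by blast
  let ?I = "?M \<inter> Fil (K + h)"
  have sI: "is_sub ?I" by (intro sub_Int sM sub_Fil)
  \<comment> \<open>\<open>Dl v 0\<close> and ?M have the same length modulo Fil(K+h): the former
    agrees with ?M' by \<open>len_good\<close>, the latter with ?M' by hypothesis. Inclusion with
    equal length leaves no gap.\<close>
  have dec: "msum (Dl v 0) ?I = ?M"
  proof -
    have 1: "len (msum (Dl v 0) ?I) (msum (Dl v 0 \<inter> Fil (K + h)) ?I) n"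
      by (rule len_msum[OF n(1) sI]) blast
    have "msum (Dl v 0 \<inter> Fil (K + h)) ?I = ?I"
      using msum_absorb[OF sI sub_Int[OF sub_Dl sub_Fil], of v 0 "K + h"] DM by (subst msum_commute) auto
    then have 2: "len (msum (Dl v 0) ?I) ?I n" using 1 by simp
    have 3: "msum (Dl v 0) ?I \<subseteq> ?M" using DM by (intro msum_le sM) auto
    obtain n1 n2 where n12: "len ?M (msum (Dl v 0) ?I) n1" "len (msum (Dl v 0) ?I) ?I n2" "n1 + n2 = n"
      using len_split[OF n(2) _ _ 3] len_sub[OF 2] by blast
    then have "n1 = 0" using len_unique[OF 2 n12(2)] by simp
    then show ?thesis using n12(1) len_0_eq by auto
  qed
  obtain B where B: "finite B" "?M = O_span D B" using lattice_fin[OF g(1)] by blast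
  have "?M \<subseteq> Dl v 0"
  proof (rule nakayama_span[OF B(1) sub_Dl B(2)])
    fix x assume "x \<in> ?M"
    then have "x \<in> msum (Dl v 0) ?I" using dec by simp
    then obtain d f where df: "x = d + f" "d \<in> Dl v 0" "f \<in> ?I" by (rule msumE)
    then obtain s where "f = \<epsilon> *s s" "s \<in> Fil K" using eps_Fil[of K] by blast
    then show "\<exists>a\<in>Dl v 0. \<exists>s\<in>?M. x = a + \<epsilon> *s s" using df K by blast
  qed
  then have MD: "?M = Dl v 0" using DM by blast
  show ?thesis using a_invariant_1_iff[OF g] Dl_generated[OF good MD] by blast
qed

lemma a_invariant_orbit:
  assumes g: "g \<in> GL D" "dieudonne (g ` M0 D)"
    and g': "g' \<in> GL D" "dieudonne (g' ` M0 D)" "a_invariant D (g' ` M0 D) = 1"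
  shows "a_invariant D (g ` M0 D) = 1 \<longleftrightarrow> f_of D g \<in> J_orbit D (f_of D g')"
proof
  let ?inv = Hilbert_Choice.inv
  have c: "(p \<circ> f) ` M0 D = p ` f ` M0 D" for p f :: "'n \<Rightarrow> 'n" by (simp add: image_comp)
  obtain p' where p': "p' \<in> J_group D" "normalized (p' ` g' ` M0 D)" using normalize[OF g'(1)] by blast
  have pg': "p' \<circ> g' \<in> GL D" "dieudonne ((p' \<circ> g') ` M0 D)" "normalized ((p' \<circ> g') ` M0 D)"
    "a_invariant D ((p' \<circ> g') ` M0 D) = 1"
    unfolding c
    by (rule GL_comp[OF J_GL[OF p'(1)] g'(1)], rule J_dieudonne[OF p'(1) g'(2)], rule p'(2),
        rule a_invariant_1_J[OF g'(1,2) p'(1) g'(3)])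
  {
    assume a: "a_invariant D (g ` M0 D) = 1"
    obtain p where p: "p \<in> J_group D" "normalized (p ` g ` M0 D)" using normalize[OF g(1)] by blast
    have pg: "p \<circ> g \<in> GL D" "dieudonne ((p \<circ> g) ` M0 D)" "normalized ((p \<circ> g) ` M0 D)"
      "a_invariant D ((p \<circ> g) ` M0 D) = 1"
      unfolding c
      by (rule GL_comp[OF J_GL[OF p(1)] g(1)], rule J_dieudonne[OF p(1) g(2)], rule p(2),
          rule a_invariant_1_J[OF g p(1) a])
    \<comment> \<open>The normalized lattices of g and g' have equal relative positions, so undoing
      p and applying p' connects the original ones.\<close>
    let ?r = "?inv p \<circ> p'"
    have r: "?r \<in> J_group D" by (intro J_comp J_inv p p')
    have "rel_pos D j g = rel_pos D j (?r \<circ> g')" if j: "j \<in> J_group D" for j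
    proof -
      have pj: "p \<circ> j \<in> J_group D" by (intro J_comp p j)
      have "rel_pos D j g = rel_pos D (p \<circ> j) (p \<circ> g)" by (rule rel_pos_translate[OF p(1) j, symmetric])
      also have "\<dots> = rel_pos D (p \<circ> j) (p' \<circ> g')" by (rule same_orbit[OF pg pg' pj])
      also have "p' \<circ> g' = p \<circ> (?r \<circ> g')"
        using J_bij[OF p(1)] by (auto simp: fun_eq_iff bij_is_surj surj_f_inv_f)
      also have "rel_pos D (p \<circ> j) (p \<circ> (?r \<circ> g')) = rel_pos D j (?r \<circ> g')" by (rule rel_pos_translate[OF p(1) j])
      finally show ?thesis .
    qed
    then show "f_of D g \<in> J_orbit D (f_of D g')" using J_orbit_iff[OF g(1) g'(1)] r by blast
  }
  {
    assume "f_of D g \<in> J_orbit D (f_of D g')"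
    then obtain p where p: "p \<in> J_group D" "\<forall>j\<in>J_group D. rel_pos D j g = rel_pos D j (p \<circ> g')"
      using J_orbit_iff[OF g(1) g'(1)] by blast
    \<comment> \<open>Chosen so that f of rg equals f of p'g', whose lattice is normalized as
      \<open>orbit_a_invariant\<close> demands.\<close>
    let ?r = "p' \<circ> ?inv p"
    have r: "?r \<in> J_group D" by (intro J_comp J_inv p p')
    have br: "bij ?r" by (rule J_bij[OF r])
    have rg: "?r \<circ> g \<in> GL D" "dieudonne ((?r \<circ> g) ` M0 D)"
      unfolding c[of ?r g] by (rule GL_comp[OF J_GL[OF r] g(1)], rule J_dieudonne[OF r g(2)])
    have "rel_pos D j (?r \<circ> g) = rel_pos D j (p' \<circ> g')" if j: "j \<in> J_group D" for j
    proof -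
      let ?i = "?inv ?r \<circ> j"
      have i: "?i \<in> J_group D" by (intro J_comp J_inv r j)
      have ri: "?r \<circ> ?i = j" by (rule comp_inv_cancel[OF br])
      have "rel_pos D j (?r \<circ> g) = rel_pos D ?i g" using rel_pos_translate[OF r i, of g] unfolding ri .
      also have "\<dots> = rel_pos D ?i (p \<circ> g')" using p(2) i by blast
      also have "\<dots> = rel_pos D j (?r \<circ> (p \<circ> g'))" using rel_pos_translate[OF r i, of "p \<circ> g'"] unfolding ri by simp
      also have "?r \<circ> (p \<circ> g') = p' \<circ> g'" using J_bij[OF p(1)] by (auto simp: fun_eq_iff bij_is_inj)
      finally show ?thesis .
    qed
    then have a: "a_invariant D ((?r \<circ> g) ` M0 D) = 1" by (rule orbit_a_invariant[OF rg pg'])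
    have "a_invariant D (?inv ?r ` (?r \<circ> g) ` M0 D) = 1"
      by (rule a_invariant_1_J[OF rg J_inv[OF r] a])
    moreover have "?inv ?r ` (?r \<circ> g) ` M0 D = g ` M0 D"
      unfolding c[of ?r g] by (rule inv_inv_image[OF br])
    ultimately show "a_invariant D (g ` M0 D) = 1" by simp
  }
qed

end

theorem proposition5p11:
  fixes D :: "('a::field, 'k::{field,finite}, 'n::ab_group_add) decomposed_data"
    and mu :: "int list"
  assumes "field_setting D"
    and "1 \<le> slope_h D" and "slope_m D \<le> slope_h D" and "coprime (slope_m D) (slope_h D)"
    and "isoclinic D (of_nat (slope_m D) / of_nat (slope_h D))"
    and "simple_decomposition D"
    and "tau0_fixed_generators D"
    and "mu \<in> dominant_cochars D" and "set mu \<subseteq> {0, 1}" and "in_B_G_mu D mu"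
  shows "\<exists>f \<in> J_group D \<rightarrow>\<^sub>E dominant_cochars D.
           \<forall>g \<in> GL D. coset_K D g \<in> X_mu_b D mu \<longrightarrow>
             (a_invariant D (g ` M0 D) = 1 \<longleftrightarrow> f_of D g \<in> J_orbit D f)"
proof -
  have iso: "isocrystal D" and slopes: "newton_slopes D = {of_nat (slope_m D) / of_nat (slope_h D)}"
    using assms(5) unfolding isoclinic_def by blast+
  interpret I: isocrystal_over D by unfold_locales (rule assms(1), rule iso)
  \<comment> \<open>An isocrystal with a slope has a nonzero slope part, so N is not zero.\<close>
  have "0 < ncomp D"
  proof (rule ccontr)
    assume "\<not> 0 < ncomp D"
    then have 0: "x = 0" for x :: 'n
      using assms(6) unfolding simple_decomposition_def by auto
    have "slope_part D (of_nat (slope_m D) / of_nat (slope_h D)) \<noteq> {0}"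
      using slopes unfolding newton_slopes_def by blast
    moreover have "0 \<in> slope_part D (of_nat (slope_m D) / of_nat (slope_h D))"
      unfolding slope_part_def by (rule I.N.span_zero)
    ultimately show False using 0 by blast
  qed
  then interpret decomposed_isocrystal D
    using assms by unfold_locales
  have lmu: "length mu = rk D" using assms(8) unfolding dominant_cochars_def by blast
  have dieu: "dieudonne (g ` M0 D)" if "g \<in> GL D" "coset_K D g \<in> X_mu_b D mu" for g
    by (rule X_mu_dieudonne[OF that lmu assms(9)])
  \<comment> \<open>Splitting on the existence of a lattice with a-invariant 1, rather than on m,
    avoids having to construct one when 0 < m < h.\<close>
  show ?thesis
  proof (cases "\<exists>g\<in>GL D. coset_K D g \<in> X_mu_b D mu \<and> a_invariant D (g ` M0 D) = 1")
    case True
    then obtain g' where g': "g' \<in> GL D" "coset_K D g' \<in> X_mu_b D mu" "a_invariant D (g' ` M0 D) = 1" by blast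
    have "\<not> (slope_m D = 0 \<or> slope_m D = slope_h D)"
      using degenerate_a_invariant[OF _ g'(1) dieu[OF g'(1,2)]] g'(3) by blast
    then interpret nondegenerate_isocrystal D
      using assms(3) by unfold_locales auto
    show ?thesis
      using a_invariant_orbit[OF _ dieu g'(1) dieu[OF g'(1,2)] g'(3)] f_of_mem[OF g'(1)] by blast
  next
    case False
    have "(\<lambda>j\<in>J_group D. replicate (rk D) 0) \<in> J_group D \<rightarrow>\<^sub>E dominant_cochars D"
      unfolding dominant_cochars_def by (auto simp: sorted_wrt_iff_nth_less)
    then show ?thesis using False not_constant_orbit by blast
  qed
qed

end
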